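(* Let $n\ge2$, $N\ge1$ be integers, $s\in(0,1)$, $\Lambda\ge1$, and let $\delta_0$ be such that $0<s<s+\delta_0<1$. There exist numbers $t\in(s,1)$ and $p>2$, both depending only on $n,N,s,\Lambda,\delta_0$, such that the following holds. Let $a_0\in\mathbb{R}^{N\times N}$ be such that $\Lambda^{-1}|\xi|^2\le\langle a_0\xi,\xi\rangle$ for all $\xi\in\mathbb{R}^N$ and $|a_0|\le\Lambda$. Let $B\Subset\tilde B\Subset\mathbb{R}^n$ be concentric balls with radii belonging to $(1/32,1)$, and put $\mathtt d:=\mathrm{dist}(B,\partial\tilde B)>0$. Let $v\in W^{s,2}(\mathbb{R}^n;\mathbb{R}^N)$ and $g\in L^\infty(\mathbb{R}^n;\mathbb{R}^N)$ be such that $$\|v\|_{W^{s,2}(\mathbb{R}^n)}+\|v\|_{W^{s+\delta_0,2}(\mathbb{R}^n)}+\mathtt{Tail}(v;\tilde B)+\|g\|_{L^\infty(\mathbb{R}^n)}\le c_0$$ for some $c_0>0$. There exists a constant $c_h\ge1$ depending only on $n,N,s,\Lambda,c_0,\delta_0,\mathtt d$ such that, if for some $\varepsilon\in(0,1)$ $$\left|\int_{\mathbb{R}^n}\int_{\mathbb{R}^n}\langle a_0(v(x)-v(y)),\varphi(x)-\varphi(y)\rangle\frac{dx\,dy}{|x-y|^{n+2s}}-\int_B\langle g,\varphi\rangle dx\right|\le\Big(\frac{\varepsilon}{c_h}\Big)^{\frac{2p}{p-2}}[\varphi]_{0,t;\mathbb{R}^n}$$ holds for all $\varphi\in C^{0,t}(\mathbb{R}^n;\mathbb{R}^N)$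 vanishing outside $B$, and if $h\in\mathbb{X}^{s,2}_v(B,\tilde B)$ solves $$\begin{cases}-\mathcal{L}_{a_0}h=g&\text{in }B\\ h=v&\text{in }\mathbb{R}^n\setminus B,\end{cases}$$ then $$\|h\|_{W^{s,2}(\tilde B)}+\mathtt{Tail}(h-(h)_B;B)\le c$$ with $c$ depending only on $n,N,s,\Lambda,c_0$, and $$[h-v]_{s,2;\tilde B}<\varepsilon,\qquad\|h-v\|_{L^2(B)}\le\frac{c'}{\sqrt{\mathtt d}}\,\varepsilon$$ with $c'$ depending only on $n,s$.
   Context: $(h)_B$ is the average of $h$ on $B$. $[w]_{s,2;A}:=\big(\int_A\int_A\frac{|w(x)-w(y)|^2}{|x-y|^{n+2s}}dx\,dy\big)^{1/2}$, $\|w\|_{W^{s,2}(A)}:=\|w\|_{L^2(A)}+[w]_{s,2;A}$, and $[\varphi]_{0,t;A}:=\sup_{x\ne y\in A}\frac{|\varphi(x)-\varphi(y)|}{|x-y|^t}$. $\mathtt{Tail}(w;B_\varrho(x)):=\varrho^{2s}\int_{\mathbb{R}^n\setminus B_\varrho(x)}\frac{|w(y)|}{|y-x|^{n+2s}}dy$; $L^1_{2s}:=\{w\in L^1_{\mathrm{loc}}(\mathbb{R}^n;\mathbb{R}^N)\colon\int_{\mathbb{R}^n}\frac{|w(x)|}{1+|x|^{n+2s}}dx<\infty\}$; and $$\mathbb{X}^{s,2}_v(B,\tilde B):=\{w\in W^{s,2}(\tilde B;\mathbb{R}^N)\cap L^1_{2s}\colon w\equiv v\text{ a.e. in }\mathbb{R}^n\setminus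 B\}.$$ That $h\in\mathbb{X}^{s,2}_v(B,\tilde B)$ solves the Dirichlet problem means $$\int_{\mathbb{R}^n}\int_{\mathbb{R}^n}\langle a_0(h(x)-h(y)),\varphi(x)-\varphi(y)\rangle\frac{dx\,dy}{|x-y|^{n+2s}}=\int_B\langle g,\varphi\rangle dx\qquad\forall\,\varphi\in\mathbb{X}^{s,2}_0(B,\tilde B).$$ *)

theory Defs
  imports "HOL-Analysis.Analysis" "HOL-Probability.Essential_Supremum"
begin

text \<open>
  The domain is \<open>real ^ 'n\<close>. The target dimension \<open>N\<close> is a natural number and not a type, because
  one constant of the lemma must be chosen independently of it: a vector of the target space
  is a function \<open>nat \<Rightarrow> real\<close> of which only the components with index below \<open>N\<close> are ever read, and an
  \<open>N \<times> N\<close> matrix is a function \<open>nat \<Rightarrow> nat \<Rightarrow> real\<close> read likewise.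

  Nonnegative quantities that may be infinite (norms, seminorms, tails) have values in
  \<open>ennreal\<close>, so that an upper bound on them includes their finiteness.
\<close>

definition vnorm :: "nat \<Rightarrow> (nat \<Rightarrow> real) \<Rightarrow> real" where
  "vnorm N \<xi> = L2_set \<xi> {..<N}"

definition vinner :: "nat \<Rightarrow> (nat \<Rightarrow> real) \<Rightarrow> (nat \<Rightarrow> real) \<Rightarrow> real" where
  "vinner N \<xi> \<eta> = (\<Sum>i<N. \<xi> i * \<eta> i)"

definition mat_app :: "nat \<Rightarrow> (nat \<Rightarrow> nat \<Rightarrow> real) \<Rightarrow> (nat \<Rightarrow> real) \<Rightarrow> nat \<Rightarrow> real" where
  "mat_app N a \<xi> = (\<lambda>i. \<Sum>j<N. a i j * \<xi> j)"

text \<open>Euclidean (Frobenius) norm.\<close>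

definition mat_norm :: "nat \<Rightarrow> (nat \<Rightarrow> nat \<Rightarrow> real) \<Rightarrow> real" where
  "mat_norm N a = sqrt (\<Sum>i<N. \<Sum>j<N. (a i j)\<^sup>2)"

definition ennreal_sqrt :: "ennreal \<Rightarrow> ennreal" where
  "ennreal_sqrt x = (if x = \<infinity> then \<infinity> else ennreal (sqrt (enn2real x)))"

definition vmeasurable_on :: "nat \<Rightarrow> (real ^ 'n) set \<Rightarrow> (real ^ 'n \<Rightarrow> nat \<Rightarrow> real) \<Rightarrow> bool" where
  "vmeasurable_on N A w \<longleftrightarrow> (\<forall>i<N. (\<lambda>x. w x i) \<in> borel_measurable (lebesgue_on A))"

definition L2_norm :: "nat \<Rightarrow> (real ^ 'n) set \<Rightarrow> (real ^ 'n \<Rightarrow> nat \<Rightarrow> real) \<Rightarrow> ennreal" where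
  "L2_norm N A w = ennreal_sqrt (\<integral>\<^sup>+ x\<in>A. ennreal ((vnorm N (w x))\<^sup>2) \<partial>lebesgue)"

text \<open>Here and in \<open>nonlocal_form\<close> the double integral is taken over the product space
  \<open>(real ^ 'n) \<times> (real ^ 'n)\<close> with its Lebesgue measure. On the diagonal, which is a null set,
  the integrand is \<open>0\<close> because \<open>0 / 0 = 0\<close>.\<close>

definition gagliardo_seminorm ::
    "nat \<Rightarrow> real \<Rightarrow> (real ^ 'n) set \<Rightarrow> (real ^ 'n \<Rightarrow> nat \<Rightarrow> real) \<Rightarrow> ennreal" where
  "gagliardo_seminorm N s A w =
     ennreal_sqrt (\<integral>\<^sup>+ z\<in>A \<times> A.
       ennreal ((vnorm N (w (fst z) - w (snd z)))\<^sup>2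
                / norm (fst z - snd z) powr (real CARD('n) + 2 * s)) \<partial>lebesgue)"

definition Ws2_norm ::
    "nat \<Rightarrow> real \<Rightarrow> (real ^ 'n) set \<Rightarrow> (real ^ 'n \<Rightarrow> nat \<Rightarrow> real) \<Rightarrow> ennreal" where
  "Ws2_norm N s A w = L2_norm N A w + gagliardo_seminorm N s A w"

definition Ws2 :: "nat \<Rightarrow> real \<Rightarrow> (real ^ 'n) set \<Rightarrow> (real ^ 'n \<Rightarrow> nat \<Rightarrow> real) set" where
  "Ws2 N s A = {w. vmeasurable_on N A w \<and> Ws2_norm N s A w < \<infinity>}"

definition Linf_norm :: "nat \<Rightarrow> (real ^ 'n \<Rightarrow> nat \<Rightarrow> real) \<Rightarrow> ennreal" where
  "Linf_norm N w = esssup lebesgue (\<lambda>x. ennreal (vnorm N (w x)))"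

definition Linf :: "nat \<Rightarrow> (real ^ 'n \<Rightarrow> nat \<Rightarrow> real) set" where
  "Linf N = {w. vmeasurable_on N UNIV w \<and> Linf_norm N w < \<infinity>}"

text \<open>The space \<open>L\<^sup>1\<close> with weight exponent \<open>2 s\<close>, and the tail of \<open>w\<close> outside \<open>ball x \<rho>\<close>.\<close>

definition L1_2s :: "nat \<Rightarrow> real \<Rightarrow> (real ^ 'n \<Rightarrow> nat \<Rightarrow> real) set" where
  "L1_2s N s = {w. vmeasurable_on N UNIV w
     \<and> (\<forall>K. compact K \<longrightarrow> (\<integral>\<^sup>+ x\<in>K. ennreal (vnorm N (w x)) \<partial>lebesgue) < \<infinity>)
     \<and> (\<integral>\<^sup>+ x. ennreal (vnorm N (w x) / (1 + norm x powr (real CARD('n) + 2 * s))) \<partial>lebesgue) < \<infinity>}"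

definition Tail ::
    "nat \<Rightarrow> real \<Rightarrow> (real ^ 'n \<Rightarrow> nat \<Rightarrow> real) \<Rightarrow> real ^ 'n \<Rightarrow> real \<Rightarrow> ennreal" where
  "Tail N s w x \<rho> = ennreal (\<rho> powr (2 * s)) *
     (\<integral>\<^sup>+ y\<in>- ball x \<rho>.
        ennreal (vnorm N (w y) / norm (y - x) powr (real CARD('n) + 2 * s)) \<partial>lebesgue)"

definition average :: "(real ^ 'n) set \<Rightarrow> (real ^ 'n \<Rightarrow> nat \<Rightarrow> real) \<Rightarrow> nat \<Rightarrow> real" where
  "average A w = (\<lambda>i. (LINT x:A|lebesgue. w x i) / measure lebesgue A)"

definition hoelder_seminorm ::
    "nat \<Rightarrow> real \<Rightarrow> (real ^ 'n) set \<Rightarrow> (real ^ 'n \<Rightarrow> nat \<Rightarrow> real) \<Rightarrow> ennreal" where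
  "hoelder_seminorm N t A \<phi> =
     (SUP (x, y) \<in> {(x, y). x \<in> A \<and> y \<in> A \<and> x \<noteq> y}.
        ennreal (vnorm N (\<phi> x - \<phi> y) / norm (x - y) powr t))"

definition C0t :: "nat \<Rightarrow> real \<Rightarrow> (real ^ 'n \<Rightarrow> nat \<Rightarrow> real) set" where
  "C0t N t = {\<phi>. (\<exists>M. \<forall>x. vnorm N (\<phi> x) \<le> M) \<and> hoelder_seminorm N t UNIV \<phi> < \<infinity>}"

definition Xs2 ::
    "nat \<Rightarrow> real \<Rightarrow> (real ^ 'n \<Rightarrow> nat \<Rightarrow> real) \<Rightarrow> (real ^ 'n) set \<Rightarrow> (real ^ 'n) set
      \<Rightarrow> (real ^ 'n \<Rightarrow> nat \<Rightarrow> real) set" where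
  "Xs2 N s v B B' = {w \<in> Ws2 N s B' \<inter> L1_2s N s.
     AE x in lebesgue. x \<notin> B \<longrightarrow> (\<forall>i<N. w x i = v x i)}"

definition nonlocal_form ::
    "nat \<Rightarrow> real \<Rightarrow> (nat \<Rightarrow> nat \<Rightarrow> real) \<Rightarrow> (real ^ 'n \<Rightarrow> nat \<Rightarrow> real)
      \<Rightarrow> (real ^ 'n \<Rightarrow> nat \<Rightarrow> real) \<Rightarrow> real" where
  "nonlocal_form N s a w \<phi> =
     (LINT z|lebesgue.
        vinner N (mat_app N a (w (fst z) - w (snd z))) (\<phi> (fst z) - \<phi> (snd z))
        / norm (fst z - snd z) powr (real CARD('n) + 2 * s))"

text \<open>For \<open>h\<close> and \<open>\<phi>\<close> as below, and \<open>B\<close> compactly contained in \<open>B'\<close>, the integrand of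
  \<open>nonlocal_form\<close> is integrable, so the Bochner integral carries no default value.\<close>

definition dirichlet_solution ::
    "nat \<Rightarrow> real \<Rightarrow> (nat \<Rightarrow> nat \<Rightarrow> real) \<Rightarrow> (real ^ 'n \<Rightarrow> nat \<Rightarrow> real) \<Rightarrow> (real ^ 'n \<Rightarrow> nat \<Rightarrow> real)
      \<Rightarrow> (real ^ 'n) set \<Rightarrow> (real ^ 'n) set \<Rightarrow> (real ^ 'n \<Rightarrow> nat \<Rightarrow> real) \<Rightarrow> bool" where
  "dirichlet_solution N s a g v B B' h \<longleftrightarrow>
     h \<in> Xs2 N s v B B' \<and>
     (\<forall>\<phi> \<in> Xs2 N s (\<lambda>_ _. 0) B B'.
        nonlocal_form N s a h \<phi> = (LINT x:B|lebesgue. vinner N (g x) (\<phi> x)))"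

end

theory Submission
  imports Defs
begin

text \<open>
  The function \<open>w = h - v\<close> vanishes outside \<open>B\<close>. By ellipticity and the equation for \<open>h\<close>, the number
  \<open>[w]\<^sup>2 / \<Lambda>\<close> is at most minus the defect \<open>D(w)\<close>, where \<open>D(\<phi>)\<close> is the equation of \<open>v\<close> tested
  with \<open>\<phi>\<close>. No higher regularity of \<open>w\<close> is needed: let \<open>\<phi>\<close> arise from \<open>w\<close> by an inward dilation
  and a convolution, both at scale \<open>\<rho>\<close>. Then \<open>\<phi>\<close> is bounded in \<open>W\<^bsup>s,2\<^esup>\<close> by \<open>w\<close>, differs from \<open>w\<close> by
  \<open>O(\<rho>\<^bsup>s\<^esup>)\<close> in \<open>L\<^sup>2\<close>, and has Lipschitz constant \<open>O(\<rho>\<^bsup>-n-1\<^esup>)\<close>. The first two properties and the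
  extra differentiability \<open>\<delta>\<^sub>0\<close> of \<open>v\<close> give \<open>D(w - \<phi>) = O(\<rho>\<^bsup>m\<^esup>)\<close> with \<open>m = min(s, \<delta>\<^sub>0) / 2\<close>; the third
  one and the hypothesis on \<open>v\<close> bound \<open>D(\<phi>)\<close>. As \<open>2p/(p-2)\<close> is arbitrarily large for \<open>p\<close> near \<open>2\<close>,
  the choice of \<open>\<rho>\<close> as a multiple of \<open>\<epsilon>\<^bsup>2/m\<^esup>\<close> makes both terms small compared with \<open>\<epsilon>\<^sup>2\<close>.
\<close>

section \<open>Integrals of the fractional kernel\<close>

text \<open>The hypothesis on \<open>v\<close> speaks only of Hoelder functions vanishing outside
  \<open>B\<close>, so \<open>h - v\<close> itself is not admissible, and a plain convolution of it
  would spill over the sphere; hence the dilation. The exponent \<open>m\<close> comes from cutting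
  the double integral at distance \<open>\<rho> powr (1/2)\<close>. Below it, the extra
  differentiability of \<open>v\<close> gains \<open>\<rho> powr (\<delta> / 2)\<close>. Beyond it,
  the kernel costs \<open>\<rho> powr (- s)\<close> against the squared \<open>L^2\<close> error
  \<open>\<rho> powr (2 * s)\<close>, and the root of the product is
  \<open>\<rho> powr (s / 2)\<close>. With \<open>\<rho> powr m\<close> proportional to the square
  of \<epsilon>, the Hoelder constant is paid for by the exponent
  \<open>2 * (n + 1) / m + 2\<close>, which involves \<open>n\<close>, \<open>s\<close> and the
  extra differentiability alone; this fixes \<open>p\<close> before \<open>c0\<close> is known. A
  Poincare inequality is used twice: with radius 2, for bounds that do not see the gap between the
  balls, and with the radius of the larger ball, which produces \<open>1 / sqrt d\<close>.\<close>

lemma nn_integral_affine: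
  fixes f :: "'a::euclidean_space \<Rightarrow> ennreal"
  assumes [measurable]: "f \<in> borel_measurable borel" and c: "c \<noteq> 0"
  shows "(\<integral>\<^sup>+x. f x \<partial>lborel) = ennreal (\<bar>c\<bar> ^ DIM('a)) * (\<integral>\<^sup>+x. f (t + c *\<^sub>R x) \<partial>lborel)"
  by (subst lborel_affine[OF c, of t])
     (simp add: nn_integral_density nn_integral_distr nn_integral_cmult)

lemma integral_affine:
  fixes f :: "'a::euclidean_space \<Rightarrow> real"
  assumes [measurable]: "f \<in> borel_measurable borel" and c: "c \<noteq> 0"
  shows "(\<integral>x. f x \<partial>lborel) = \<bar>c\<bar> ^ DIM('a) * (\<integral>x. f (t + c *\<^sub>R x) \<partial>lborel)"
  by (subst lborel_affine[OF c, of t])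
     (simp add: integral_density integral_distr)

lemma integrable_affine:
  fixes f :: "'a::euclidean_space \<Rightarrow> real"
  assumes [measurable]: "f \<in> borel_measurable borel" and c: "c \<noteq> 0" and f: "integrable lborel f"
  shows "integrable lborel (\<lambda>x. f (t + c *\<^sub>R x))"
proof -
  have "(\<integral>\<^sup>+x. ennreal (norm (f x)) \<partial>lborel) < \<infinity>"
    using f by (simp add: integrable_iff_bounded)
  then have "(\<integral>\<^sup>+x. ennreal (norm (f (t + c *\<^sub>R x))) \<partial>lborel) < \<infinity>"
    using c by (subst (asm) nn_integral_affine[OF _ c, of _ t])
      (auto simp: ennreal_mult_less_top ennreal_zero_less_mult_iff)
  then show ?thesis by (simp add: integrable_iff_bounded)
qed

text \<open>Expansion of the variance of \<open>g\<close> under the density \<open>q\<close>. If the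
  right side is infinite, any value of the Bochner integral is harmless, its default included; if it
  is finite, \<open>\<bar>g x\<bar> \<le> 1 + (g x)\<^sup>2\<close> makes \<open>q x * g x\<close>
  integrable.\<close>

lemma jensen_square:
  fixes q g :: "'a \<Rightarrow> real"
  assumes [measurable]: "q \<in> borel_measurable M" "g \<in> borel_measurable M"
    and q: "\<And>x. 0 \<le> q x" and iq: "integrable M q" and q1: "(\<integral>x. q x \<partial>M) = 1"
  shows "ennreal ((\<integral>x. q x * g x \<partial>M)\<^sup>2) \<le> (\<integral>\<^sup>+x. ennreal (q x * (g x)\<^sup>2) \<partial>M)"
proof (cases "(\<integral>\<^sup>+x. ennreal (q x * (g x)\<^sup>2) \<partial>M) < \<infinity>")
  case True
  have i2: "integrable M (\<lambda>x. q x * (g x)\<^sup>2)"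
    using True q by (intro integrableI_nonneg) auto
  have i1: "integrable M (\<lambda>x. q x * g x)"
  proof (rule Bochner_Integration.integrable_bound)
    show "integrable M (\<lambda>x. q x + q x * (g x)\<^sup>2)" using iq i2 by simp
    have "\<bar>g x\<bar> \<le> 1 + (g x)\<^sup>2" for x
      using power2_diff[of "\<bar>g x\<bar>" 1] zero_le_power2[of "\<bar>g x\<bar> - 1"] abs_ge_zero[of "g x"] by simp
    then have "q x * \<bar>g x\<bar> \<le> q x + q x * (g x)\<^sup>2" for x
      using mult_left_mono[OF _ q, of "\<bar>g x\<bar>" "1 + (g x)\<^sup>2" x] by (simp add: algebra_simps)
    then show "AE x in M. norm (q x * g x) \<le> norm (q x + q x * (g x)\<^sup>2)"
      using q by (auto simp: abs_mult)
  qed simp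
  define m where "m = (\<integral>x. q x * g x \<partial>M)"
  have "0 \<le> (\<integral>x. q x * (g x - m)\<^sup>2 \<partial>M)"
    using q by (intro integral_nonneg_AE) auto
  also have "\<dots> = (\<integral>x. q x * (g x)\<^sup>2 - 2 * m * (q x * g x) + m\<^sup>2 * q x \<partial>M)"
    by (intro Bochner_Integration.integral_cong) (auto simp: power2_eq_square algebra_simps)
  also have "\<dots> = (\<integral>x. q x * (g x)\<^sup>2 \<partial>M) - m\<^sup>2"
    using i1 i2 iq q1 by (simp add: m_def[symmetric] power2_eq_square)
  finally have "m\<^sup>2 \<le> (\<integral>x. q x * (g x)\<^sup>2 \<partial>M)" by simp
  then show ?thesis
    using i2 q by (subst nn_integral_eq_integral) (auto simp: m_def intro!: ennreal_leI)
qed (simp add: less_top[symmetric])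

definition far_const :: "'a::euclidean_space itself \<Rightarrow> real \<Rightarrow> real" where
  "far_const _ s = unit_ball_vol (DIM('a)) * 2 ^ DIM('a) * (1 / (1 - 2 powr (- 2 * s)))"

lemma far_const_nonneg: "0 < s \<Longrightarrow> 0 \<le> far_const TYPE('a::euclidean_space) s"
proof -
  assume "0 < s"
  then have "2 powr (- 2 * s) < 2 powr (0::real)" by (intro powr_less_mono) auto
  then show ?thesis by (simp add: far_const_def)
qed

text \<open>Dyadic shells of inner radius \<open>R k = \<theta> * 2 ^ k\<close>: on each the kernel
  is at most \<open>R k powr - e\<close>, and the shell lies in a ball of volume proportional to
  \<open>R k ^ n\<close>. What remains is a geometric series of ratio
  \<open>2 powr (- 2 * s)\<close>, whose sum is \<open>far_const\<close>.\<close>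

lemma nn_integral_kernel_far:
  fixes x :: "'a::euclidean_space"
  assumes s: "0 < s" and \<theta>: "0 < \<theta>"
  shows "(\<integral>\<^sup>+y. ennreal (1 / norm (y - x) powr (real DIM('a) + 2 * s))
            * indicator {y. \<theta> \<le> norm (y - x)} y \<partial>lborel)
         \<le> ennreal (far_const TYPE('a) s * \<theta> powr (- 2 * s))"
proof -
  define n where "n = DIM('a)"
  define e where "e = real n + 2 * s"
  define R where "R k = \<theta> * 2 ^ k" for k :: nat
  have R: "0 < R k" for k using \<theta> by (simp add: R_def)
  have e: "0 < e" using s by (simp add: e_def)
  \<comment> \<open>Whole balls replace the shells in the majorant; the overlap costs only a
    constant factor.\<close>
  have pt: "ennreal (1 / norm (y - x) powr e) * indicator {y. \<theta> \<le> norm (y - x)} y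
     \<le> (\<Sum>k. ennreal (R k powr - e) * indicator (ball x (R (Suc k))) y)" for y
  proof (cases "\<theta> \<le> norm (y - x)")
    case True
    define d where "d = norm (y - x)"
    have d: "\<theta> \<le> d" using True by (simp add: d_def)
    obtain m where m: "d < R m"
    proof -
      obtain m where "d / \<theta> < 2 ^ m" using real_arch_pow[of 2 "d / \<theta>"] by auto
      then show ?thesis using that[of m] \<theta> by (simp add: R_def field_simps)
    qed
    define k where "k = (LEAST m. d < R m)"
    have k1: "d < R k" unfolding k_def by (rule LeastI[of _ m]) (rule m)
    \<comment> \<open>Since \<open>R 0 = \<theta> \<le> d\<close>, the least index with
      \<open>d < R k\<close> has a predecessor \<open>j\<close>, and minimality gives
      \<open>R j \<le> d\<close>.\<close>
    have "k \<noteq> 0" using k1 d by (intro notI) (simp add: R_def)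
    then obtain j where j: "k = Suc j" by (cases k) auto
    have "\<not> d < R j" using not_less_Least[of j "\<lambda>m. d < R m"] j by (simp add: k_def)
    then have Rj: "R j \<le> d" by simp
    have "1 / d powr e = d powr - e" by (simp add: powr_minus_divide)
    also have "\<dots> \<le> R j powr - e"
      using Rj R[of j] e by (intro powr_mono2') auto
    finally have "ennreal (1 / d powr e) \<le> ennreal (R j powr - e) * indicator (ball x (R (Suc j))) y"
      using k1 j by (simp add: d_def dist_norm norm_minus_commute ennreal_leI)
    also have "\<dots> \<le> (\<Sum>k. ennreal (R k powr - e) * indicator (ball x (R (Suc k))) y)"
      using sum_le_suminf[of "\<lambda>k. ennreal (R k powr - e) * indicator (ball x (R (Suc k))) y" "{j}"]
      by (simp del: sum_mult_indicator)
    finally show ?thesis using True by (simp add: d_def)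
  qed simp
  have tm: "(\<integral>\<^sup>+y. ennreal (R k powr - e) * indicator (ball x (R (Suc k))) y \<partial>lborel)
     = ennreal (unit_ball_vol n * 2 ^ n * \<theta> powr (- 2 * s) * (2 powr (- 2 * s)) ^ k)" for k
  proof -
    have "(\<integral>\<^sup>+y. ennreal (R k powr - e) * indicator (ball x (R (Suc k))) y \<partial>lborel)
      = ennreal (R k powr - e) * emeasure lborel (ball x (R (Suc k)))"
      by (simp add: nn_integral_cmult_indicator)
    also have "\<dots> = ennreal (R k powr - e * (unit_ball_vol n * R (Suc k) ^ n))"
      using R[of "Suc k"] by (subst emeasure_ball) (auto simp: ennreal_mult n_def)
    also have "R (Suc k) ^ n = 2 ^ n * R k powr real n"
      using R[of k] by (simp add: R_def powr_realpow power_mult_distrib)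
    also have "R k powr - e * (unit_ball_vol n * (2 ^ n * R k powr real n))
        = unit_ball_vol n * 2 ^ n * R k powr (- 2 * s)"
      by (simp add: e_def powr_add[symmetric] mult_ac)
    also have "R k powr (- 2 * s) = \<theta> powr (- 2 * s) * (2 powr (- 2 * s)) ^ k"
      using \<theta> by (simp add: R_def powr_mult powr_power powr_powr flip: powr_realpow) (simp add: mult_ac)
    finally show ?thesis by (simp add: mult_ac)
  qed
  have lt1: "2 powr (- 2 * s) < (1::real)" using s powr_less_mono[of "- 2 * s" 0 2] by simp
  define c where "c = unit_ball_vol n * 2 ^ n * \<theta> powr (- 2 * s)"
  define b where "b = 2 powr (- 2 * s)"
  have sm: "(\<lambda>k. c * b ^ k) sums (c * (1 / (1 - b)))"
    using lt1 by (intro sums_mult geometric_sums) (auto simp: b_def)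
  have nn: "0 \<le> c * b ^ k" for k by (simp add: c_def b_def)
  have "(\<integral>\<^sup>+y. ennreal (1 / norm (y - x) powr e) * indicator {y. \<theta> \<le> norm (y - x)} y \<partial>lborel)
     \<le> (\<integral>\<^sup>+y. (\<Sum>k. ennreal (R k powr - e) * indicator (ball x (R (Suc k))) y) \<partial>lborel)"
    by (intro nn_integral_mono pt)
  also have "\<dots> = (\<Sum>k. (\<integral>\<^sup>+y. ennreal (R k powr - e) * indicator (ball x (R (Suc k))) y \<partial>lborel))"
    by (rule nn_integral_suminf) (rule borel_measurable_times_ennreal, simp, rule borel_measurable_indicator, simp)
  also have "\<dots> = (\<Sum>k. ennreal (c * b ^ k))"
    unfolding tm c_def b_def ..
  also have "\<dots> = ennreal (c * (1 / (1 - b)))"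
    by (rule suminf_ennreal_eq[OF nn sm])
  finally show ?thesis by (simp add: e_def n_def far_const_def c_def b_def mult_ac)
qed

lemma nn_integral_lborel_fst:
  fixes F :: "'a::euclidean_space \<times> 'b::euclidean_space \<Rightarrow> ennreal"
  assumes "F \<in> borel_measurable borel"
  shows "(\<integral>\<^sup>+z. F z \<partial>lborel) = (\<integral>\<^sup>+x. \<integral>\<^sup>+y. F (x, y) \<partial>lborel \<partial>lborel)"
proof -
  have "F \<in> borel_measurable (lborel \<Otimes>\<^sub>M lborel)" using assms by (simp add: lborel_prod)
  from lborel.nn_integral_fst[OF this] show ?thesis by (simp add: lborel_prod)
qed

lemma nn_integral_lborel_snd:
  fixes F :: "'a::euclidean_space \<times> 'b::euclidean_space \<Rightarrow> ennreal"
  assumes "F \<in> borel_measurable borel"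
  shows "(\<integral>\<^sup>+z. F z \<partial>lborel) = (\<integral>\<^sup>+y. \<integral>\<^sup>+x. F (x, y) \<partial>lborel \<partial>lborel)"
proof -
  have "case_prod (\<lambda>x y. F (x, y)) \<in> borel_measurable (lborel \<Otimes>\<^sub>M lborel)"
    using assms by (simp add: lborel_prod)
  from lborel_pair.nn_integral_snd[OF this] show ?thesis by (simp add: lborel_prod)
qed

section \<open>Scalar Gagliardo energies: the far part and a Poincare inequality\<close>

definition gagl :: "'a::euclidean_space set \<Rightarrow> real \<Rightarrow> ('a \<Rightarrow> real) \<Rightarrow> ennreal" where
  "gagl A s f = (\<integral>\<^sup>+z\<in>A \<times> A. ennreal ((f (fst z) - f (snd z))\<^sup>2
      / norm (fst z - snd z) powr (real DIM('a) + 2 * s)) \<partial>lborel)"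

text \<open>The squared difference is at most twice the sum of the squares, and each square is
  integrated first in the variable that it does not contain. Two summands with a factor 2 make the
  4.\<close>

lemma gagl_far_le:
  fixes f :: "'a::euclidean_space \<Rightarrow> real"
  assumes [measurable]: "f \<in> borel_measurable borel" and s: "0 < s" and \<theta>: "0 < \<theta>"
  shows "(\<integral>\<^sup>+z. ennreal ((f (fst z) - f (snd z))\<^sup>2
        / norm (fst z - snd z) powr (real DIM('a) + 2 * s))
        * indicator {z. \<theta> \<le> norm (fst z - snd z)} z \<partial>lborel)
     \<le> ennreal (4 * far_const TYPE('a) s * \<theta> powr (- 2 * s)) * (\<integral>\<^sup>+x. ennreal ((f x)\<^sup>2) \<partial>lborel)"
proof -
  define e where "e = real DIM('a) + 2 * s"
  define T where "T = far_const TYPE('a) s * \<theta> powr (- 2 * s)"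
  define I where "I = (\<integral>\<^sup>+x. ennreal ((f x)\<^sup>2) \<partial>lborel)"
  have T0: "0 \<le> T" using far_const_nonneg[OF s, where 'a='a] by (simp add: T_def)
  define G where "G a z = ennreal (2 * (f a)\<^sup>2) * (ennreal (1 / norm (fst z - snd z) powr e)
        * indicator {z. \<theta> \<le> norm (fst z - snd z)} z)" for a and z :: "'a \<times> 'a"
  have [measurable]: "(\<lambda>z. G (fst z) z) \<in> borel_measurable borel"
    "(\<lambda>z. G (snd z) z) \<in> borel_measurable borel"
    unfolding G_def borel_prod[symmetric] by measurable
  have 1: "(\<integral>\<^sup>+y. ennreal (1 / norm (x - y) powr e) * indicator {y. \<theta> \<le> norm (x - y)} y \<partial>lborel)
       \<le> ennreal T" for x :: 'a
    using nn_integral_kernel_far[OF s \<theta>, of x] by (simp add: e_def T_def norm_minus_commute)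
  have inner: "(\<integral>\<^sup>+y. ennreal (2 * (f x)\<^sup>2) * (ennreal (1 / norm (x - y) powr e) * indicator {y. \<theta> \<le> norm (x - y)} y) \<partial>lborel)
       \<le> ennreal (2 * T) * ennreal ((f x)\<^sup>2)" for x
  proof -
    have "(\<integral>\<^sup>+y. ennreal (2 * (f x)\<^sup>2) * (ennreal (1 / norm (x - y) powr e) * indicator {y. \<theta> \<le> norm (x - y)} y) \<partial>lborel)
      = ennreal (2 * (f x)\<^sup>2) * (\<integral>\<^sup>+y. ennreal (1 / norm (x - y) powr e) * indicator {y. \<theta> \<le> norm (x - y)} y \<partial>lborel)"
      by (rule nn_integral_cmult) measurable
    also have "\<dots> \<le> ennreal (2 * (f x)\<^sup>2) * ennreal T" by (intro mult_left_mono 1) simp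
    also have "\<dots> = ennreal (2 * T) * ennreal ((f x)\<^sup>2)"
      using T0 by (simp add: ennreal_mult[symmetric] mult_ac)
    finally show ?thesis .
  qed
  have a: "(\<integral>\<^sup>+z. G (fst z) z \<partial>lborel) \<le> ennreal (2 * T) * I"
  proof -
    have "(\<integral>\<^sup>+z. G (fst z) z \<partial>lborel) = (\<integral>\<^sup>+x. \<integral>\<^sup>+y. G x (x, y) \<partial>lborel \<partial>lborel)"
      by (subst nn_integral_lborel_fst) auto
    also have "\<dots> \<le> (\<integral>\<^sup>+x. ennreal (2 * T) * ennreal ((f x)\<^sup>2) \<partial>lborel)"
      using inner by (intro nn_integral_mono) (auto simp: G_def indicator_def norm_minus_commute)
    finally show ?thesis by (simp add: nn_integral_cmult I_def)
  qed
  have b: "(\<integral>\<^sup>+z. G (snd z) z \<partial>lborel) \<le> ennreal (2 * T) * I"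
  proof -
    have "(\<integral>\<^sup>+z. G (snd z) z \<partial>lborel) = (\<integral>\<^sup>+x. \<integral>\<^sup>+y. G x (y, x) \<partial>lborel \<partial>lborel)"
      by (subst nn_integral_lborel_snd) auto
    also have "\<dots> \<le> (\<integral>\<^sup>+x. ennreal (2 * T) * ennreal ((f x)\<^sup>2) \<partial>lborel)"
      using inner by (intro nn_integral_mono) (auto simp: G_def indicator_def norm_minus_commute)
    finally show ?thesis by (simp add: nn_integral_cmult I_def)
  qed
  have pt: "ennreal ((f (fst z) - f (snd z))\<^sup>2 / norm (fst z - snd z) powr e)
        * indicator {z. \<theta> \<le> norm (fst z - snd z)} z \<le> G (fst z) z + G (snd z) z" for z :: "'a \<times> 'a"
  proof -
    have "(f (fst z) - f (snd z))\<^sup>2 \<le> 2 * (f (fst z))\<^sup>2 + 2 * (f (snd z))\<^sup>2"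
      using zero_le_power2[of "f (fst z) + f (snd z)"] by (simp add: power2_eq_square algebra_simps)
    then have "(f (fst z) - f (snd z))\<^sup>2 / norm (fst z - snd z) powr e
        \<le> (2 * (f (fst z))\<^sup>2 + 2 * (f (snd z))\<^sup>2) / norm (fst z - snd z) powr e"
      by (rule divide_right_mono) simp
    then have "ennreal ((f (fst z) - f (snd z))\<^sup>2 / norm (fst z - snd z) powr e)
      \<le> ennreal (2 * (f (fst z))\<^sup>2) * ennreal (1 / norm (fst z - snd z) powr e)
       + ennreal (2 * (f (snd z))\<^sup>2) * ennreal (1 / norm (fst z - snd z) powr e)"
      by (simp add: ennreal_mult[symmetric] ennreal_plus[symmetric] add_divide_distrib ennreal_leI del: ennreal_plus)
    then show ?thesis by (auto simp: G_def indicator_def)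
  qed
  have "(\<integral>\<^sup>+z. ennreal ((f (fst z) - f (snd z))\<^sup>2 / norm (fst z - snd z) powr e)
        * indicator {z. \<theta> \<le> norm (fst z - snd z)} z \<partial>lborel)
     \<le> (\<integral>\<^sup>+z. G (fst z) z + G (snd z) z \<partial>lborel)" by (intro nn_integral_mono pt)
  also have "\<dots> = (\<integral>\<^sup>+z. G (fst z) z \<partial>lborel) + (\<integral>\<^sup>+z. G (snd z) z \<partial>lborel)"
    by (intro nn_integral_add) auto
  also have "\<dots> \<le> ennreal (2 * T) * I + ennreal (2 * T) * I" by (intro add_mono a b)
  also have "\<dots> = ennreal (4 * T) * I"
    using T0 by (simp add: distrib_right[symmetric] ennreal_plus[symmetric] del: ennreal_plus)
  finally show ?thesis by (simp add: e_def T_def I_def mult_ac)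
qed

text \<open>The 4 bounds the distance between two points of a ball of radius at most 2; the other
  factors invert the lower bound for the volume of an annulus of unit width.\<close>

definition poincare_const :: "'a::euclidean_space itself \<Rightarrow> real \<Rightarrow> real" where
  "poincare_const _ s = 4 powr (real DIM('a) + 2 * s) * 32 ^ (DIM('a) - 1) / unit_ball_vol (DIM('a))"

lemma poincare_const_pos: "0 < poincare_const TYPE('a::euclidean_space) s"
  by (simp add: poincare_const_def unit_ball_vol_pos)

text \<open>\<open>R ^ n - r ^ n\<close> is at least \<open>(R - r) * R ^ (n - 1)\<close>, and
  \<open>R\<close> exceeds \<open>1/32\<close>. The linear dependence on the width is the origin of
  the factor \<open>1 / sqrt d\<close> in the final \<open>L^2\<close> bound.\<close>

lemma emeasure_annulus_ge:
  fixes x :: "'a::euclidean_space"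
  assumes r: "1/32 < r" "r < R"
  shows "ennreal ((R - r) * unit_ball_vol (DIM('a)) / 32 ^ (DIM('a) - 1))
     \<le> emeasure lborel (ball x R - ball x r)"
proof -
  obtain m where m: "DIM('a) = Suc m" using DIM_positive[where 'a='a] by (cases "DIM('a)") auto
  have "(R - r) / 32 ^ m = (R - r) * (1/32) ^ m" by (simp add: power_one_over)
  also have "\<dots> \<le> (R - r) * R ^ m" using r by (intro mult_left_mono power_mono) auto
  also have "\<dots> = R ^ Suc m - r * R ^ m" by (simp add: algebra_simps)
  also have "\<dots> \<le> R ^ Suc m - r ^ Suc m"
    using r by (auto intro!: mult_left_mono power_mono)
  finally have "(R - r) / 32 ^ m * unit_ball_vol (DIM('a)) \<le> (R ^ Suc m - r ^ Suc m) * unit_ball_vol (DIM('a))"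
    by (intro mult_right_mono) auto
  moreover have "emeasure lborel (ball x R - ball x r) = emeasure lborel (ball x R) - emeasure lborel (ball x r)"
    using r by (intro emeasure_Diff) (auto simp: emeasure_ball ennreal_mult_eq_top_iff)
  moreover have "\<dots> = ennreal ((R ^ Suc m - r ^ Suc m) * unit_ball_vol (DIM('a)))"
    using r by (simp add: emeasure_ball m ennreal_minus algebra_simps)
  ultimately show ?thesis by (simp add: m ennreal_leI mult_ac)
qed

text \<open>Each value \<open>f x\<close> is compared with the zeros of \<open>f\<close> on the
  annulus, which lie at distance at most 4. The range of \<open>R\<close> extends to 2 because
  \<open>R = 2\<close> leaves a gap of more than 1 whenever \<open>r < 1\<close>, and so a bound on
  the mass that is uniform in the configuration of the balls.\<close>

lemma poincare:
  fixes f :: "'a::euclidean_space \<Rightarrow> real"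
  assumes [measurable]: "f \<in> borel_measurable borel" and s: "0 < s"
    and r: "1/32 < r" "r < R" "R \<le> 2" and f0: "\<And>x. x \<notin> ball x0 r \<Longrightarrow> f x = 0"
  shows "ennreal (R - r) * (\<integral>\<^sup>+x. ennreal ((f x)\<^sup>2) \<partial>lborel)
     \<le> ennreal (poincare_const TYPE('a) s) * gagl (ball x0 R) s f"
proof -
  define e where "e = real DIM('a) + 2 * s"
  have e: "0 < e" using s by (simp add: e_def add_pos_pos)
  define m where "m = (R - r) * unit_ball_vol (DIM('a)) / 32 ^ (DIM('a) - 1)"
  have m0: "0 < m" using r by (simp add: m_def unit_ball_vol_pos)
  define D :: real where "D = 4 powr e"
  have D: "0 < D" by (simp add: D_def)
  have pt: "ennreal ((f x)\<^sup>2 / D) * indicator (ball x0 R - ball x0 r) y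
      \<le> ennreal ((f x - f y)\<^sup>2 / norm (x - y) powr e) * indicator (ball x0 R \<times> ball x0 R) (x, y)" for x y
  proof (cases "x \<in> ball x0 r \<and> y \<in> ball x0 R - ball x0 r")
    case True
    have "f y = 0" using True by (intro f0) auto
    have "norm (x - y) \<le> dist x x0 + dist x0 y" by (metis dist_norm dist_triangle)
    also have "\<dots> \<le> 4" using True r by (auto simp: dist_commute)
    finally have le: "norm (x - y) \<le> 4" .
    have "x \<noteq> y" using True by auto
    then have pos: "0 < norm (x - y)" by simp
    have "norm (x - y) powr e \<le> D" unfolding D_def using le e by (intro powr_mono2) auto
    then have "(f x)\<^sup>2 / D \<le> (f x - f y)\<^sup>2 / norm (x - y) powr e"
      using pos D \<open>f y = 0\<close> by (auto intro!: divide_left_mono)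
    then show ?thesis using True r by (auto simp: ennreal_leI)
  next
    case False
    then show ?thesis using f0[of x] by (cases "x \<in> ball x0 r") auto
  qed
  have "ennreal m * (\<integral>\<^sup>+x. ennreal ((f x)\<^sup>2 / D) \<partial>lborel)
     = (\<integral>\<^sup>+x. ennreal m * ennreal ((f x)\<^sup>2 / D) \<partial>lborel)"
    by (rule nn_integral_cmult[symmetric]) measurable
  also have "\<dots> \<le> (\<integral>\<^sup>+x. \<integral>\<^sup>+y. ennreal ((f x)\<^sup>2 / D) * indicator (ball x0 R - ball x0 r) y \<partial>lborel \<partial>lborel)"
  proof (rule nn_integral_mono)
    fix x
    have "ennreal m * ennreal ((f x)\<^sup>2 / D) \<le> emeasure lborel (ball x0 R - ball x0 r) * ennreal ((f x)\<^sup>2 / D)"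
      unfolding m_def using r by (intro mult_right_mono emeasure_annulus_ge) auto
    then show "ennreal m * ennreal ((f x)\<^sup>2 / D) \<le> (\<integral>\<^sup>+y. ennreal ((f x)\<^sup>2 / D) * indicator (ball x0 R - ball x0 r) y \<partial>lborel)"
      by (simp add: nn_integral_cmult_indicator mult.commute)
  qed
  also have "\<dots> \<le> (\<integral>\<^sup>+x. \<integral>\<^sup>+y. ennreal ((f x - f y)\<^sup>2 / norm (x - y) powr e) * indicator (ball x0 R \<times> ball x0 R) (x, y) \<partial>lborel \<partial>lborel)"
    by (intro nn_integral_mono pt)
  also have "\<dots> = gagl (ball x0 R) s f"
    unfolding gagl_def e_def[symmetric]
    by (subst nn_integral_lborel_fst) (auto simp: borel_prod[symmetric])
  finally have *: "ennreal m * (\<integral>\<^sup>+x. ennreal ((f x)\<^sup>2 / D) \<partial>lborel) \<le> gagl (ball x0 R) s f" .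
  have "ennreal (R - r) * (\<integral>\<^sup>+x. ennreal ((f x)\<^sup>2) \<partial>lborel)
    = ennreal (R - r) * (\<integral>\<^sup>+x. ennreal D * ennreal ((f x)\<^sup>2 / D) \<partial>lborel)"
    using D by (simp add: ennreal_mult[symmetric])
  also have "\<dots> = ennreal (R - r) * ennreal D * (\<integral>\<^sup>+x. ennreal ((f x)\<^sup>2 / D) \<partial>lborel)"
    by (simp add: nn_integral_cmult mult.assoc)
  also have "ennreal (R - r) * ennreal D = ennreal (poincare_const TYPE('a) s) * ennreal m"
  proof -
    have "unit_ball_vol (real DIM('a)) \<noteq> 0" by (metis less_irrefl of_nat_0_le_iff unit_ball_vol_pos)
    then have "(R - r) * D = poincare_const TYPE('a) s * m"
      by (simp add: poincare_const_def m_def D_def e_def)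
    then show ?thesis
      using D r m0 poincare_const_pos[where 'a='a and s=s]
      by (metis ennreal_mult' less_imp_le diff_gt_0_iff_gt)
  qed
  finally show ?thesis using mult_left_mono[OF *] by (simp add: mult.assoc)
qed

section \<open>Lipschitz approximation\<close>

text \<open>The tent \<open>max 0 (1 - norm x)\<close> divided by its integral. It has height 1 and
  Lipschitz constant 1, so the reciprocal of the integral bounds both the values and the slope of
  \<open>q\<close>.\<close>

lemma cone_kernel:
  "\<exists>(q :: 'a::euclidean_space \<Rightarrow> real) L. 0 < L \<and> q \<in> borel_measurable borel
     \<and> (\<forall>x. 0 \<le> q x \<and> q x \<le> L) \<and> (\<forall>x y. \<bar>q x - q y\<bar> \<le> L * norm (x - y))
     \<and> (\<forall>x. 1 \<le> norm x \<longrightarrow> q x = 0) \<and> integrable lborel q \<and> (\<integral>x. q x \<partial>lborel) = 1"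
proof -
  define k :: "'a \<Rightarrow> real" where "k x = max 0 (1 - norm x)" for x
  have [measurable]: "k \<in> borel_measurable borel" unfolding k_def by measurable
  have ik: "integrable lborel k"
  proof (rule Bochner_Integration.integrable_bound)
    show "integrable lborel (indicator (cball 0 1) :: 'a \<Rightarrow> real)"
      using emeasure_lborel_cball_finite[of "0::'a" 1] by (intro integrable_real_indicator) simp_all
    show "AE x in lborel. norm (k x) \<le> norm (indicator (cball 0 1) x :: real)"
      by (auto simp: k_def indicator_def)
  qed simp
  define c where "c = (\<integral>x. k x \<partial>lborel)"
  \<comment> \<open>The tent is at least \<open>1/2\<close> on the ball of radius
    \<open>1/2\<close>, so its integral is positive.\<close>
  have "0 < measure lborel (ball (0::'a) (1/2)) * (1/2)"
    by (simp add: content_ball_pos)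
  also have "\<dots> = (\<integral>x. indicator (ball (0::'a) (1/2)) x * (1/2) \<partial>lborel)" by simp
  also have "\<dots> \<le> c" unfolding c_def
  proof (rule integral_mono[OF _ ik])
    show "integrable lborel (\<lambda>x. indicator (ball (0::'a) (1/2)) x * (1/2) :: real)"
      using emeasure_lborel_ball_finite[of "0::'a" "1/2"]
      by (intro integrable_mult_left integrable_real_indicator) simp_all
  qed (auto simp: k_def indicator_def)
  finally have c: "0 < c" .
  define q where "q x = k x / c" for x
  have "q \<in> borel_measurable borel" unfolding q_def by measurable
  moreover have "0 \<le> q x \<and> q x \<le> 1 / c" for x
    using c by (auto simp: q_def k_def intro!: divide_right_mono)
  moreover have "\<bar>q x - q y\<bar> \<le> 1 / c * norm (x - y)" for x y
  proof -
    have "\<bar>k x - k y\<bar> \<le> \<bar>norm x - norm y\<bar>" by (auto simp: k_def)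
    also have "\<dots> \<le> norm (x - y)" by (rule norm_triangle_ineq3)
    finally have "\<bar>k x - k y\<bar> / c \<le> norm (x - y) / c" using c by (intro divide_right_mono) auto
    then show ?thesis using c by (simp add: q_def diff_divide_distrib[symmetric])
  qed
  moreover have "1 \<le> norm x \<longrightarrow> q x = 0" for x by (simp add: q_def k_def)
  moreover have "integrable lborel q" unfolding q_def using ik by simp
  moreover have "(\<integral>x. q x \<partial>lborel) = 1" unfolding q_def using c by (simp add: c_def)
  moreover have "0 < 1 / c" using c by simp
  ultimately show ?thesis by (intro exI[of _ q] exI[of _ "1/c"]) blast
qed

text \<open>For \<open>x\<close> in the ball, the difference \<open>f x - \<phi> x\<close> averages
  \<open>f x - f y\<close> over points \<open>y\<close> within \<open>2 * \<rho>\<close> of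
  \<open>x\<close>, where the kernel is bounded below; Jensen's inequality then compares the squared
  error with the energy. For the energy of \<open>\<phi>\<close>, Jensen and Tonelli reduce to one
  shift at a time, and a single shift is an affine change of variables. The constant precedes all
  data since it enters \<open>c_h\<close>.\<close>

lemma lipschitz_approximation:
  "\<exists>L>0. \<forall>(x0 :: 'a::euclidean_space) r \<rho> s f.
     0 < s \<longrightarrow> s \<le> 1 \<longrightarrow> 0 < \<rho> \<longrightarrow> \<rho> \<le> r \<longrightarrow> f \<in> borel_measurable borel \<longrightarrow> integrable lborel f \<longrightarrow>
     (\<forall>x. x \<notin> ball x0 r \<longrightarrow> f x = 0) \<longrightarrow>
     (\<exists>\<phi> \<in> borel_measurable borel. (\<forall>x. x \<notin> ball x0 r \<longrightarrow> \<phi> x = (0::real))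
       \<and> (\<forall>x. \<bar>\<phi> x\<bar> \<le> L / \<rho> ^ DIM('a) * (\<integral>x. \<bar>f x\<bar> \<partial>lborel))
       \<and> (\<forall>x y. \<bar>\<phi> x - \<phi> y\<bar> \<le> 2 * L / \<rho> ^ Suc (DIM('a)) * (\<integral>x. \<bar>f x\<bar> \<partial>lborel) * norm (x - y))
       \<and> (\<integral>\<^sup>+x. ennreal ((f x - \<phi> x)\<^sup>2) \<partial>lborel) \<le> ennreal (L * \<rho> powr (2 * s)) * gagl UNIV s f
       \<and> gagl UNIV s \<phi> \<le> 4 * gagl UNIV s f)"
proof -
  obtain q :: "'a \<Rightarrow> real" and K where K: "0 < K" and [measurable]: "q \<in> borel_measurable borel"
    and q0: "\<And>x. 0 \<le> q x" and qK: "\<And>x. q x \<le> K"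
    and qlip: "\<And>x y. \<bar>q x - q y\<bar> \<le> K * norm (x - y)"
    and qout: "\<And>x. 1 \<le> norm x \<Longrightarrow> q x = 0" and iq: "integrable lborel q"
    and q1: "(\<integral>x. q x \<partial>lborel) = 1"
    using cone_kernel[where 'a='a] by metis
  define n where "n = DIM('a)"
  \<comment> \<open>The power of 2 is what remains of \<open>(2 * \<rho>) powr (n + 2 * s)\<close>
    for \<open>s \<le> 1\<close>.\<close>
  define L where "L = K * 2 powr (real n + 2)"
  have KL: "K \<le> L" using K by (simp add: L_def ge_one_powr_ge_zero)
  have L: "0 < L" using K KL by simp
  show ?thesis
  proof (intro exI[of _ L] conjI allI impI L)
    fix x0 :: 'a and r \<rho> s :: real and f :: "'a \<Rightarrow> real"
    assume s: "0 < s" "s \<le> 1" and \<rho>: "0 < \<rho>" "\<rho> \<le> r" and fm[measurable]: "f \<in> borel_measurable borel"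
      and fi: "integrable lborel f" and f0: "\<forall>x. x \<notin> ball x0 r \<longrightarrow> f x = 0"
    define e where "e = real n + 2 * s"
    have e0: "0 < e" using s by (simp add: e_def add_nonneg_pos)
    have r: "0 < r" using \<rho> by simp
    \<comment> \<open>The dilation by \<open>\<mu>\<close> moves the support inwards, so that the convolution at scale \<open>\<rho>\<close> stays in the ball.\<close>
    define \<mu> where "\<mu> = 1 + \<rho> / r"
    have \<mu>: "1 < \<mu>" "\<mu> \<le> 2" using \<rho> by (auto simp: \<mu>_def)
    define T where "T x = x0 + \<mu> *\<^sub>R (x - x0)" for x
    have [measurable]: "T \<in> borel_measurable borel" unfolding T_def by measurable
    define \<phi> where "\<phi> x = (\<integral>z. q z * f (T x + \<rho> *\<^sub>R z) \<partial>lborel)" for x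
    define A where "A = (\<integral>x. \<bar>f x\<bar> \<partial>lborel)"
    have A0: "0 \<le> A" by (simp add: A_def)
    have iqf: "integrable lborel (\<lambda>z. q z * f (t + \<rho> *\<^sub>R z))" for t
    proof (rule Bochner_Integration.integrable_bound)
      show "integrable lborel (\<lambda>z. K * f (t + \<rho> *\<^sub>R z))"
        using integrable_affine[OF fm _ fi] \<rho> by simp
      show "AE z in lborel. norm (q z * f (t + \<rho> *\<^sub>R z)) \<le> norm (K * f (t + \<rho> *\<^sub>R z))"
        using q0 qK K by (auto simp: abs_mult intro!: mult_right_mono)
    qed measurable
    \<comment> \<open>As \<open>\<mu> * r = r + \<rho>\<close>, the dilation puts a point outside
      the ball at distance at least \<open>r + \<rho>\<close> from the centre, and a shift by less
      than \<open>\<rho>\<close> cannot bring it back inside.\<close>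
    have out: "T x + \<rho> *\<^sub>R z \<notin> ball x0 r" if "x \<notin> ball x0 r" "norm z < 1" for x z
    proof -
      have "r + \<rho> = \<mu> * r" using r by (simp add: \<mu>_def field_simps)
      also have "\<dots> \<le> \<mu> * norm (x - x0)" using that \<mu> by (auto simp: dist_norm norm_minus_commute)
      also have "\<dots> = norm (\<mu> *\<^sub>R (x - x0))" using \<mu> by simp
      also have "\<dots> \<le> norm (T x + \<rho> *\<^sub>R z - x0) + norm (\<rho> *\<^sub>R z)"
        using norm_triangle_ineq4[of "T x + \<rho> *\<^sub>R z - x0" "\<rho> *\<^sub>R z"] by (simp add: T_def)
      also have "norm (\<rho> *\<^sub>R z) \<le> \<rho>" using that \<rho> by simp
      finally show ?thesis by (simp add: dist_norm norm_minus_commute)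
    qed
    have \<phi>0: "\<phi> x = 0" if "x \<notin> ball x0 r" for x
    proof -
      have "q z * f (T x + \<rho> *\<^sub>R z) = 0" for z
        using qout[of z] out[OF that, of z] f0 by (cases "norm z < 1") auto
      then have "(\<lambda>z. q z * f (T x + \<rho> *\<^sub>R z)) = (\<lambda>_. 0)" by (rule ext)
      then show ?thesis by (simp only: \<phi>_def) simp
    qed
    \<comment> \<open>The substitution moves \<open>x\<close> out of \<open>f\<close> and into the
      kernel, so that the bounds on \<open>\<phi>\<close> and on its slope use only the kernel and
      the integral of \<open>\<bar>f\<bar>\<close>, at the price of powers of
      \<open>1 / \<rho>\<close>.\<close>
    have \<phi>1: "\<phi> x = (\<integral>y. q ((y - T x) /\<^sub>R \<rho>) * f y \<partial>lborel) / \<rho> ^ n" for x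
      using \<rho> by (subst integral_affine[where t="T x" and c=\<rho>]) (auto simp: \<phi>_def n_def)
    have iqf1: "integrable lborel (\<lambda>y. q ((y - t) /\<^sub>R \<rho>) * f y)" for t
    proof (rule Bochner_Integration.integrable_bound)
      show "integrable lborel (\<lambda>y. K * f y)" using fi by simp
      show "AE y in lborel. norm (q ((y - t) /\<^sub>R \<rho>) * f y) \<le> norm (K * f y)"
        using q0 qK K by (auto simp: abs_mult intro!: mult_right_mono)
    qed measurable
    have bound: "\<bar>\<phi> x\<bar> \<le> L / \<rho> ^ n * A" for x
    proof -
      have "\<bar>\<integral>y. q ((y - T x) /\<^sub>R \<rho>) * f y \<partial>lborel\<bar> \<le> (\<integral>y. K * \<bar>f y\<bar> \<partial>lborel)"
      proof (intro integral_abs_bound[THEN order_trans] integral_mono)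
        show "integrable lborel (\<lambda>y. \<bar>q ((y - T x) /\<^sub>R \<rho>) * f y\<bar>)" by (intro integrable_abs iqf1)
        show "\<bar>q ((y - T x) /\<^sub>R \<rho>) * f y\<bar> \<le> K * \<bar>f y\<bar>" for y
          using q0 qK by (simp add: abs_mult mult_right_mono)
      qed (use fi in simp)
      also have "\<dots> = K * A" by (simp add: A_def)
      also have "\<dots> \<le> L * A" using KL A0 by (rule mult_right_mono)
      finally show ?thesis using \<rho> by (simp add: \<phi>1 abs_divide divide_right_mono)
    qed
    have lip: "\<bar>\<phi> x - \<phi> y\<bar> \<le> 2 * L / \<rho> ^ Suc n * A * norm (x - y)" for x y
    proof -
      have "\<bar>(\<integral>z. q ((z - T x) /\<^sub>R \<rho>) * f z \<partial>lborel) - (\<integral>z. q ((z - T y) /\<^sub>R \<rho>) * f z \<partial>lborel)\<bar>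
         = \<bar>\<integral>z. (q ((z - T x) /\<^sub>R \<rho>) - q ((z - T y) /\<^sub>R \<rho>)) * f z \<partial>lborel\<bar>"
        using iqf1 by (simp add: left_diff_distrib)
      also have "\<dots> \<le> (\<integral>z. (2 * K / \<rho> * norm (x - y)) * \<bar>f z\<bar> \<partial>lborel)"
      proof (intro integral_abs_bound[THEN order_trans] integral_mono)
        show "integrable lborel (\<lambda>z. \<bar>(q ((z - T x) /\<^sub>R \<rho>) - q ((z - T y) /\<^sub>R \<rho>)) * f z\<bar>)"
          using iqf1 by (auto simp: left_diff_distrib intro!: integrable_abs Bochner_Integration.integrable_diff)
        fix z
        have "\<bar>q ((z - T x) /\<^sub>R \<rho>) - q ((z - T y) /\<^sub>R \<rho>)\<bar> \<le> K * norm ((z - T x) /\<^sub>R \<rho> - (z - T y) /\<^sub>R \<rho>)"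
          by (rule qlip)
        also have "(z - T x) /\<^sub>R \<rho> - (z - T y) /\<^sub>R \<rho> = (\<mu> / \<rho>) *\<^sub>R (y - x)"
          by (simp add: T_def algebra_simps divide_inverse)
        also have "K * norm ((\<mu> / \<rho>) *\<^sub>R (y - x)) = K * \<mu> / \<rho> * norm (x - y)"
          using \<mu> \<rho> by (simp add: norm_minus_commute)
        also have "\<dots> \<le> 2 * K / \<rho> * norm (x - y)"
          using \<mu> \<rho> K by (intro mult_right_mono divide_right_mono) auto
        finally show "\<bar>(q ((z - T x) /\<^sub>R \<rho>) - q ((z - T y) /\<^sub>R \<rho>)) * f z\<bar> \<le> 2 * K / \<rho> * norm (x - y) * \<bar>f z\<bar>"
          unfolding abs_mult by (rule mult_right_mono) simp
      qed (use fi in simp)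
      also have "\<dots> = 2 * K / \<rho> * norm (x - y) * A" by (simp add: A_def)
      also have "\<dots> \<le> 2 * L / \<rho> * norm (x - y) * A"
        using KL A0 \<rho> by (intro mult_right_mono divide_right_mono) auto
      finally have "\<bar>(\<integral>z. q ((z - T x) /\<^sub>R \<rho>) * f z \<partial>lborel) - (\<integral>z. q ((z - T y) /\<^sub>R \<rho>) * f z \<partial>lborel)\<bar> / \<rho> ^ n
          \<le> 2 * L / \<rho> * norm (x - y) * A / \<rho> ^ n"
        using \<rho> by (intro divide_right_mono) auto
      moreover have "\<bar>\<phi> x - \<phi> y\<bar> = \<bar>(\<integral>z. q ((z - T x) /\<^sub>R \<rho>) * f z \<partial>lborel) - (\<integral>z. q ((z - T y) /\<^sub>R \<rho>) * f z \<partial>lborel)\<bar> / \<rho> ^ n"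
        using \<rho> unfolding \<phi>1 diff_divide_distrib[symmetric] abs_divide by simp
      moreover have "2 * L / \<rho> * norm (x - y) * A / \<rho> ^ n = 2 * L / \<rho> ^ Suc n * A * norm (x - y)"
        by simp
      ultimately show ?thesis by metis
    qed
    have "continuous_on UNIV \<phi>"
    proof (rule lipschitz_on_continuous_on)
      show "(2 * L / \<rho> ^ Suc n * A)-lipschitz_on UNIV \<phi>"
        using lip L A0 \<rho> by (intro lipschitz_onI) (auto simp: dist_norm)
    qed
    then have \<phi>m[measurable]: "\<phi> \<in> borel_measurable borel" by (rule borel_measurable_continuous_onI)
    define D where "D z = ennreal ((f (fst z) - f (snd z))\<^sup>2 / norm (fst z - snd z) powr e)" for z :: "'a \<times> 'a"
    have [measurable]: "D \<in> borel_measurable borel"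
      unfolding D_def borel_prod[symmetric] by measurable
    have gD: "gagl UNIV s f = (\<integral>\<^sup>+z. D z \<partial>lborel)"
      by (simp add: gagl_def D_def e_def n_def)
    have err: "(\<integral>\<^sup>+x. ennreal ((f x - \<phi> x)\<^sup>2) \<partial>lborel) \<le> ennreal (L * \<rho> powr (2 * s)) * gagl UNIV s f"
    proof -
      define C where "C = L * \<rho> powr (2 * s) * \<rho> ^ n"
      have C0: "0 \<le> C" using L \<rho> by (simp add: C_def)
      \<comment> \<open>The factor \<open>\<rho> ^ n\<close> is the Jacobian that turns the average
        over shifts \<open>z\<close> into an integral over points \<open>y\<close>.\<close>
      have pt: "ennreal ((f x - \<phi> x)\<^sup>2) * ennreal (\<rho> ^ n) \<le> ennreal C * (\<integral>\<^sup>+y. D (x, y) \<partial>lborel)" for x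
      proof (cases "x \<in> ball x0 r")
        case True
        have "f x - \<phi> x = (\<integral>z. q z * (f x - f (T x + \<rho> *\<^sub>R z)) \<partial>lborel)"
          using iqf[of "T x"] iq q1 by (simp add: right_diff_distrib \<phi>_def)
        then have "ennreal ((f x - \<phi> x)\<^sup>2) \<le> (\<integral>\<^sup>+z. ennreal (q z * (f x - f (T x + \<rho> *\<^sub>R z))\<^sup>2) \<partial>lborel)"
          using jensen_square[OF _ _ q0 iq q1] by simp
        then have "ennreal ((f x - \<phi> x)\<^sup>2) * ennreal (\<rho> ^ n)
           \<le> ennreal (\<bar>\<rho>\<bar> ^ DIM('a)) * (\<integral>\<^sup>+z. ennreal (q z * (f x - f (T x + \<rho> *\<^sub>R z))\<^sup>2) \<partial>lborel)"
          using \<rho> by (simp add: n_def mult.commute mult_left_mono)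
        also have "\<dots> = (\<integral>\<^sup>+y. ennreal (q ((y - T x) /\<^sub>R \<rho>) * (f x - f y)\<^sup>2) \<partial>lborel)"
          using \<rho> nn_integral_affine[of "\<lambda>y. ennreal (q ((y - T x) /\<^sub>R \<rho>) * (f x - f y)\<^sup>2)" \<rho> "T x"] by simp
        also have "\<dots> \<le> (\<integral>\<^sup>+y. ennreal C * D (x, y) \<partial>lborel)"
        proof (rule nn_integral_mono)
          fix y
          have "q ((y - T x) /\<^sub>R \<rho>) * (f x - f y)\<^sup>2 \<le> C * ((f x - f y)\<^sup>2 / norm (x - y) powr e)"
          proof (cases "norm ((y - T x) /\<^sub>R \<rho>) < 1 \<and> x \<noteq> y")
            case t: True
            have t1: "norm (y - T x) \<le> \<rho>"
            proof -
              have "norm (y - T x) = \<rho> * norm ((y - T x) /\<^sub>R \<rho>)" using \<rho> by simp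
              also have "\<dots> \<le> \<rho> * 1" using t \<rho> by (intro mult_left_mono) auto
              finally show ?thesis by simp
            qed
            \<comment> \<open>The dilation displaces a point of the ball by at most
              \<open>\<rho>\<close>, no more than the convolution does; together they give the
              distance \<open>2 * \<rho>\<close>.\<close>
            have t2: "norm (T x - x) \<le> \<rho>"
            proof -
              have "T x - x = (\<rho> / r) *\<^sub>R (x - x0)" by (simp add: T_def \<mu>_def algebra_simps)
              then have "norm (T x - x) = \<rho> / r * norm (x - x0)" using \<rho> by simp
              also have "\<dots> \<le> \<rho> / r * r"
                using True \<rho> by (intro mult_left_mono) (auto simp: dist_norm norm_minus_commute)
              finally show ?thesis using r by simp
            qed
            have "norm (x - y) \<le> norm (y - T x) + norm (T x - x)"
              using norm_triangle_ineq[of "y - T x" "T x - x"] by (simp add: norm_minus_commute)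
            then have xy: "norm (x - y) \<le> 2 * \<rho>" using t1 t2 by simp
            have "norm (x - y) powr e \<le> (2 * \<rho>) powr e" using xy e0 by (intro powr_mono2) auto
            also have "\<dots> = 2 powr e * \<rho> powr (2 * s) * \<rho> ^ n"
              using \<rho> by (simp add: powr_mult e_def powr_add powr_realpow)
            also have "2 powr e \<le> 2 powr (real n + 2)" using s by (intro powr_mono) (auto simp: e_def)
            finally have "norm (x - y) powr e \<le> 2 powr (real n + 2) * \<rho> powr (2 * s) * \<rho> ^ n"
              using \<rho> by (simp add: mult_right_mono)
            then have "K * norm (x - y) powr e \<le> C"
              using K by (simp add: C_def L_def mult.assoc)
            moreover have "0 < norm (x - y) powr e" using t by simp
            ultimately have "K \<le> C / norm (x - y) powr e" by (simp add: field_simps)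
            then have "q ((y - T x) /\<^sub>R \<rho>) \<le> C / norm (x - y) powr e" using qK order_trans by blast
            then have "q ((y - T x) /\<^sub>R \<rho>) * (f x - f y)\<^sup>2 \<le> C / norm (x - y) powr e * (f x - f y)\<^sup>2"
              by (rule mult_right_mono) simp
            then show ?thesis by simp
          next
            case False
            then show ?thesis using qout[of "(y - T x) /\<^sub>R \<rho>"] C0 by (cases "x = y") auto
          qed
          then show "ennreal (q ((y - T x) /\<^sub>R \<rho>) * (f x - f y)\<^sup>2) \<le> ennreal C * D (x, y)"
            using C0 by (simp add: D_def ennreal_mult[symmetric] ennreal_leI)
        qed
        also have "\<dots> = ennreal C * (\<integral>\<^sup>+y. D (x, y) \<partial>lborel)" by (rule nn_integral_cmult) simp
        finally show ?thesis .
      next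
        case False
        then show ?thesis using \<phi>0 f0 by simp
      qed
      have m: "(\<lambda>x. \<integral>\<^sup>+y. D (x, y) \<partial>lborel) \<in> borel_measurable borel"
        using lborel.borel_measurable_nn_integral[of "\<lambda>x y. D (x, y)" borel]
        by (simp add: borel_prod[symmetric])
      have "(\<integral>\<^sup>+x. ennreal ((f x - \<phi> x)\<^sup>2) \<partial>lborel) * ennreal (\<rho> ^ n)
         = (\<integral>\<^sup>+x. ennreal ((f x - \<phi> x)\<^sup>2) * ennreal (\<rho> ^ n) \<partial>lborel)"
        by (rule nn_integral_multc[symmetric]) simp
      also have "\<dots> \<le> (\<integral>\<^sup>+x. ennreal C * (\<integral>\<^sup>+y. D (x, y) \<partial>lborel) \<partial>lborel)"
        by (intro nn_integral_mono pt)
      also have "\<dots> = ennreal C * gagl UNIV s f"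
        unfolding gD using m by (subst nn_integral_lborel_fst) (auto simp: nn_integral_cmult)
      also have "\<dots> = (ennreal (L * \<rho> powr (2 * s)) * gagl UNIV s f) * ennreal (\<rho> ^ n)"
        using L \<rho> by (simp add: C_def ennreal_mult mult_ac)
      finally show ?thesis using \<rho>
        by (simp add: ennreal_mult_le_mult_iff mult.commute[of _ "ennreal (\<rho> ^ n)"])
    qed
    have en: "gagl UNIV s \<phi> \<le> 4 * gagl UNIV s f"
    proof -
      \<comment> \<open>The contribution of one shift \<open>z\<close> to the energy at the pair
        \<open>w\<close>, weighted by \<open>q z\<close>; Tonelli allows the integration over
        \<open>w\<close> to come first.\<close>
      define J where "J w z = ennreal (q z) * ennreal ((f (T (fst w) + \<rho> *\<^sub>R z) - f (T (snd w) + \<rho> *\<^sub>R z))\<^sup>2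
           / norm (fst w - snd w) powr e)" for w :: "'a \<times> 'a" and z
      have [measurable]: "(\<lambda>p. J (fst p) (snd p)) \<in> borel_measurable borel"
        unfolding J_def borel_prod[symmetric] by measurable
      have pt: "ennreal ((\<phi> (fst w) - \<phi> (snd w))\<^sup>2 / norm (fst w - snd w) powr e) \<le> (\<integral>\<^sup>+z. J w z \<partial>lborel)" for w
      proof -
        define k where "k = 1 / norm (fst w - snd w) powr e"
        have k: "0 \<le> k" by (simp add: k_def)
        have "\<phi> (fst w) - \<phi> (snd w) = (\<integral>z. q z * (f (T (fst w) + \<rho> *\<^sub>R z) - f (T (snd w) + \<rho> *\<^sub>R z)) \<partial>lborel)"
          using iqf by (simp add: right_diff_distrib \<phi>_def)
        then have "ennreal ((\<phi> (fst w) - \<phi> (snd w))\<^sup>2)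
           \<le> (\<integral>\<^sup>+z. ennreal (q z * (f (T (fst w) + \<rho> *\<^sub>R z) - f (T (snd w) + \<rho> *\<^sub>R z))\<^sup>2) \<partial>lborel)"
          using jensen_square[OF _ _ q0 iq q1] by simp
        then have "ennreal k * ennreal ((\<phi> (fst w) - \<phi> (snd w))\<^sup>2)
           \<le> ennreal k * (\<integral>\<^sup>+z. ennreal (q z * (f (T (fst w) + \<rho> *\<^sub>R z) - f (T (snd w) + \<rho> *\<^sub>R z))\<^sup>2) \<partial>lborel)"
          by (rule mult_left_mono) simp
        also have "\<dots> = (\<integral>\<^sup>+z. ennreal k * ennreal (q z * (f (T (fst w) + \<rho> *\<^sub>R z) - f (T (snd w) + \<rho> *\<^sub>R z))\<^sup>2) \<partial>lborel)"
          by (rule nn_integral_cmult[symmetric]) simp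
        also have "\<dots> = (\<integral>\<^sup>+z. J w z \<partial>lborel)"
          using q0 k by (intro nn_integral_cong) (simp add: J_def ennreal_mult[symmetric] k_def)
        finally show ?thesis using k by (simp add: ennreal_mult[symmetric] k_def)
      qed
      have inner: "(\<integral>\<^sup>+w. J w z \<partial>lborel) \<le> ennreal (q z) * (4 * gagl UNIV s f)" for z
      proof -
        define t where "t = x0 - \<mu> *\<^sub>R x0 + \<rho> *\<^sub>R z"
        have Tt: "T x + \<rho> *\<^sub>R z = t + \<mu> *\<^sub>R x" for x by (simp add: T_def t_def algebra_simps)
        \<comment> \<open>Both points of the pair undergo the same affine map, so the pair is
          translated by \<open>(t, t)\<close> and dilated by \<open>\<mu>\<close> in the product
          space. The kernel scales by \<open>\<mu> powr e\<close>, the Jacobian is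
          \<open>\<mu> ^ (n + n)\<close>.\<close>
        have Jw: "J w z = ennreal (q z) * (ennreal (\<mu> powr e) * D ((t, t) + \<mu> *\<^sub>R w))" for w
        proof -
          have "norm (fst ((t, t) + \<mu> *\<^sub>R w) - snd ((t, t) + \<mu> *\<^sub>R w)) = \<mu> * norm (fst w - snd w)"
            using \<mu> by (simp add: scaleR_diff_right[symmetric])
          then have "norm (fst ((t, t) + \<mu> *\<^sub>R w) - snd ((t, t) + \<mu> *\<^sub>R w)) powr e = \<mu> powr e * norm (fst w - snd w) powr e"
            using \<mu> by (simp add: powr_mult)
          then show ?thesis using \<mu> unfolding J_def D_def Tt
            by (simp add: ennreal_mult[symmetric])
        qed
        have "(\<integral>\<^sup>+w. J w z \<partial>lborel) = ennreal (q z) * (ennreal (\<mu> powr e) * (\<integral>\<^sup>+w. D ((t, t) + \<mu> *\<^sub>R w) \<partial>lborel))"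
        proof -
          have m: "(\<lambda>w. D ((t, t) + \<mu> *\<^sub>R w)) \<in> borel_measurable lborel" by measurable
          show ?thesis unfolding Jw
            by (subst nn_integral_cmult) (use m in \<open>simp_all add: nn_integral_cmult\<close>)
        qed
        also have "\<dots> \<le> ennreal (q z) * (4 * (ennreal (\<bar>\<mu>\<bar> ^ DIM('a \<times> 'a)) * (\<integral>\<^sup>+w. D ((t, t) + \<mu> *\<^sub>R w) \<partial>lborel)))"
        proof (intro mult_left_mono)
          \<comment> \<open>Comparison of the scaling of the kernel with the Jacobian:
            \<open>\<mu> powr (2 * s)\<close> is at most 4 as \<open>\<mu> \<le> 2\<close> and
            \<open>s \<le> 1\<close>. This is the 4 of the energy bound.\<close>
          have "\<mu> powr e = \<mu> powr (2 * s) * \<mu> ^ n" using \<mu> by (simp add: e_def powr_add powr_realpow)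
          also have "\<dots> \<le> 4 * \<mu> ^ (n + n)"
          proof (intro mult_mono)
            have "\<mu> powr (2 * s) \<le> 2 powr (2 * s)" using \<mu> s by (intro powr_mono2) auto
            also have "\<dots> \<le> 2 powr 2" using s by (intro powr_mono) auto
            finally show "\<mu> powr (2 * s) \<le> 4" by simp
            show "\<mu> ^ n \<le> \<mu> ^ (n + n)" using \<mu> by (intro power_increasing) auto
          qed (use \<mu> in auto)
          finally have "ennreal (\<mu> powr e) \<le> 4 * ennreal (\<bar>\<mu>\<bar> ^ DIM('a \<times> 'a))"
            using \<mu> by (simp add: n_def ennreal_leI ennreal_mult'[symmetric] flip: ennreal_numeral)
          then show "ennreal (\<mu> powr e) * (\<integral>\<^sup>+w. D ((t, t) + \<mu> *\<^sub>R w) \<partial>lborel)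
             \<le> 4 * (ennreal (\<bar>\<mu>\<bar> ^ DIM('a \<times> 'a)) * (\<integral>\<^sup>+w. D ((t, t) + \<mu> *\<^sub>R w) \<partial>lborel))"
            unfolding mult.assoc[symmetric] by (rule mult_right_mono) simp
        qed simp
        also have "ennreal (\<bar>\<mu>\<bar> ^ DIM('a \<times> 'a)) * (\<integral>\<^sup>+w. D ((t, t) + \<mu> *\<^sub>R w) \<partial>lborel) = gagl UNIV s f"
          unfolding gD using \<mu> by (intro nn_integral_affine[symmetric]) auto
        finally show ?thesis .
      qed
      have "gagl UNIV s \<phi> = (\<integral>\<^sup>+w. ennreal ((\<phi> (fst w) - \<phi> (snd w))\<^sup>2 / norm (fst w - snd w) powr e) \<partial>lborel)"
        by (simp add: gagl_def e_def n_def)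
      also have "\<dots> \<le> (\<integral>\<^sup>+w. \<integral>\<^sup>+z. J w z \<partial>lborel \<partial>lborel)" by (intro nn_integral_mono pt)
      also have "\<dots> = (\<integral>\<^sup>+p. J (fst p) (snd p) \<partial>lborel)"
        by (subst nn_integral_lborel_fst) auto
      also have "\<dots> = (\<integral>\<^sup>+z. \<integral>\<^sup>+w. J w z \<partial>lborel \<partial>lborel)"
        by (subst nn_integral_lborel_snd) auto
      also have "\<dots> \<le> (\<integral>\<^sup>+z. ennreal (q z) * (4 * gagl UNIV s f) \<partial>lborel)" by (intro nn_integral_mono inner)
      also have "\<dots> = (\<integral>\<^sup>+z. ennreal (q z) \<partial>lborel) * (4 * gagl UNIV s f)" by (rule nn_integral_multc) simp
      also have "(\<integral>\<^sup>+z. ennreal (q z) \<partial>lborel) = 1"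
        using q0 iq q1 by (subst nn_integral_eq_integral) auto
      finally show ?thesis by simp
    qed
    show "\<exists>\<phi> \<in> borel_measurable borel. (\<forall>x. x \<notin> ball x0 r \<longrightarrow> \<phi> x = (0::real))
       \<and> (\<forall>x. \<bar>\<phi> x\<bar> \<le> L / \<rho> ^ DIM('a) * (\<integral>x. \<bar>f x\<bar> \<partial>lborel))
       \<and> (\<forall>x y. \<bar>\<phi> x - \<phi> y\<bar> \<le> 2 * L / \<rho> ^ Suc (DIM('a)) * (\<integral>x. \<bar>f x\<bar> \<partial>lborel) * norm (x - y))
       \<and> (\<integral>\<^sup>+x. ennreal ((f x - \<phi> x)\<^sup>2) \<partial>lborel) \<le> ennreal (L * \<rho> powr (2 * s)) * gagl UNIV s f
       \<and> gagl UNIV s \<phi> \<le> 4 * gagl UNIV s f"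
      using \<phi>m \<phi>0 bound lip err en unfolding n_def A_def by blast
  qed
qed

section \<open>Vector-valued functions\<close>

lemma vnorm_nonneg [simp]: "0 \<le> vnorm N \<xi>"
  by (simp add: vnorm_def)

lemma vnorm_power2: "(vnorm N \<xi>)\<^sup>2 = (\<Sum>i<N. (\<xi> i)\<^sup>2)"
  by (simp add: vnorm_def L2_set_def sum_nonneg)

lemma vnorm_cong: "(\<And>i. i < N \<Longrightarrow> \<xi> i = \<eta> i) \<Longrightarrow> vnorm N \<xi> = vnorm N \<eta>"
  unfolding vnorm_def by (intro L2_set_cong) auto

lemma vnorm_le_sum: "vnorm N \<xi> \<le> (\<Sum>i<N. \<bar>\<xi> i\<bar>)"
  unfolding vnorm_def by (rule L2_set_le_sum_abs)

lemma vnorm_triangle: "vnorm N (\<lambda>i. \<xi> i + \<eta> i) \<le> vnorm N \<xi> + vnorm N \<eta>"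
  unfolding vnorm_def by (rule L2_set_triangle_ineq)

lemma abs_vinner_le: "\<bar>vinner N \<xi> \<eta>\<bar> \<le> vnorm N \<xi> * vnorm N \<eta>"
proof -
  have "\<bar>vinner N \<xi> \<eta>\<bar> \<le> (\<Sum>i<N. \<bar>\<xi> i\<bar> * \<bar>\<eta> i\<bar>)"
    unfolding vinner_def by (rule order_trans[OF sum_abs]) (simp add: abs_mult)
  also have "\<dots> \<le> vnorm N \<xi> * vnorm N \<eta>" unfolding vnorm_def by (rule L2_set_mult_ineq)
  finally show ?thesis .
qed

lemma mat_norm_nonneg: "0 \<le> mat_norm N a"
  by (simp add: mat_norm_def sum_nonneg)

lemma vnorm_mat_app_le: "vnorm N (mat_app N a \<xi>) \<le> mat_norm N a * vnorm N \<xi>"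
proof (rule power2_le_imp_le)
  have "(vnorm N (mat_app N a \<xi>))\<^sup>2 = (\<Sum>i<N. (vinner N (a i) \<xi>)\<^sup>2)"
    by (simp add: vnorm_power2 mat_app_def vinner_def)
  also have "\<dots> \<le> (\<Sum>i<N. (vnorm N (a i) * vnorm N \<xi>)\<^sup>2)"
    by (intro sum_mono abs_le_square_iff[THEN iffD1]) (simp add: abs_vinner_le)
  also have "\<dots> = (\<Sum>i<N. (vnorm N (a i))\<^sup>2) * (vnorm N \<xi>)\<^sup>2"
    by (simp add: power_mult_distrib sum_distrib_right)
  also have "(\<Sum>i<N. (vnorm N (a i))\<^sup>2) = (mat_norm N a)\<^sup>2"
    by (simp add: vnorm_power2 mat_norm_def sum_nonneg)
  finally show "(vnorm N (mat_app N a \<xi>))\<^sup>2 \<le> (mat_norm N a * vnorm N \<xi>)\<^sup>2"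
    by (simp add: power_mult_distrib)
qed (simp add: mat_norm_nonneg)

lemma young: "0 < \<tau> \<Longrightarrow> a * b \<le> (\<tau> * a\<^sup>2 + b\<^sup>2 / \<tau>) / 2" for a b \<tau> :: real
proof -
  assume t: "0 < \<tau>"
  have "2 * \<tau> * a * b \<le> \<tau>\<^sup>2 * a\<^sup>2 + b\<^sup>2"
    using zero_le_power2[of "\<tau> * a - b"] by (simp add: power2_eq_square algebra_simps)
  then show ?thesis using t by (simp add: field_simps power2_eq_square)
qed

section \<open>Energy, mass and bilinear density of vector functions\<close>

definition gdens :: "nat \<Rightarrow> real \<Rightarrow> (real ^ 'n \<Rightarrow> nat \<Rightarrow> real) \<Rightarrow> (real ^ 'n) \<times> (real ^ 'n) \<Rightarrow> real" where
  "gdens N s U z = (vnorm N (U (fst z) - U (snd z)))\<^sup>2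
     / norm (fst z - snd z) powr (real CARD('n) + 2 * s)"

definition bil :: "nat \<Rightarrow> real \<Rightarrow> (nat \<Rightarrow> nat \<Rightarrow> real) \<Rightarrow> (real ^ 'n \<Rightarrow> nat \<Rightarrow> real)
      \<Rightarrow> (real ^ 'n \<Rightarrow> nat \<Rightarrow> real) \<Rightarrow> (real ^ 'n) \<times> (real ^ 'n) \<Rightarrow> real" where
  "bil N s a V U z = vinner N (mat_app N a (V (fst z) - V (snd z))) (U (fst z) - U (snd z))
     / norm (fst z - snd z) powr (real CARD('n) + 2 * s)"

definition vborel :: "nat \<Rightarrow> (real ^ 'n \<Rightarrow> nat \<Rightarrow> real) \<Rightarrow> bool" where
  "vborel N U \<longleftrightarrow> (\<forall>i<N. (\<lambda>x. U x i) \<in> borel_measurable borel)"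

text \<open>The square of the Gagliardo seminorm: without the root it is additive over components,
  and over \<open>lborel\<close> Tonelli's theorem applies to Borel functions.\<close>

definition energy :: "nat \<Rightarrow> real \<Rightarrow> (real ^ 'n) set \<Rightarrow> (real ^ 'n \<Rightarrow> nat \<Rightarrow> real) \<Rightarrow> ennreal" where
  "energy N s A U = (\<integral>\<^sup>+z\<in>A \<times> A. ennreal (gdens N s U z) \<partial>lborel)"

definition mass :: "nat \<Rightarrow> (real ^ 'n \<Rightarrow> nat \<Rightarrow> real) \<Rightarrow> ennreal" where
  "mass N U = (\<integral>\<^sup>+x. ennreal ((vnorm N (U x))\<^sup>2) \<partial>lborel)"

lemma vborelD: "vborel N U \<Longrightarrow> i < N \<Longrightarrow> (\<lambda>x. U x i) \<in> borel_measurable borel"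
  by (simp add: vborel_def)

lemma vborel_diff: "vborel N U \<Longrightarrow> vborel N V \<Longrightarrow> vborel N (U - V)"
  by (auto simp: vborel_def intro!: borel_measurable_diff)

lemma measurable_vnorm:
  assumes "vborel N U" shows "(\<lambda>x. vnorm N (U x)) \<in> borel_measurable borel"
  unfolding vnorm_def L2_set_def
  by (intro borel_measurable_sqrt[THEN measurable_compose_rev] borel_measurable_sum
      borel_measurable_power vborelD[OF assms]) auto

lemma measurable_vinner:
  assumes "vborel N U" "vborel N V" shows "(\<lambda>x. vinner N (U x) (V x)) \<in> borel_measurable borel"
  unfolding vinner_def
  by (intro borel_measurable_sum borel_measurable_times vborelD[OF assms(1)] vborelD[OF assms(2)]) auto

lemma measurable_component_fst:
  assumes "vborel N U" "i < N"
  shows "(\<lambda>z. U (fst z) i) \<in> borel_measurable (borel :: ((real ^ 'n) \<times> (real ^ 'n)) measure)"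
    "(\<lambda>z. U (snd z) i) \<in> borel_measurable (borel :: ((real ^ 'n) \<times> (real ^ 'n)) measure)"
  using vborelD[OF assms] unfolding borel_prod[symmetric]
  by measurable

lemma measurable_kernel:
  "(\<lambda>z. norm (fst z - snd z) powr e) \<in> borel_measurable (borel :: ((real ^ 'n) \<times> (real ^ 'n)) measure)"
  unfolding borel_prod[symmetric] by measurable

lemma measurable_gdens:
  assumes "vborel N U" shows "gdens N s U \<in> borel_measurable borel"
  unfolding gdens_def[abs_def] vnorm_power2
  by (intro borel_measurable_divide measurable_kernel borel_measurable_sum borel_measurable_power)
    (auto intro!: borel_measurable_diff measurable_component_fst[OF assms])

lemma measurable_bil:
  assumes "vborel N V" "vborel N U" shows "bil N s a V U \<in> borel_measurable borel"
  unfolding bil_def[abs_def] vinner_def mat_app_def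
  by (intro borel_measurable_divide measurable_kernel borel_measurable_sum borel_measurable_times)
    (auto intro!: borel_measurable_diff measurable_component_fst[OF assms(1)] measurable_component_fst[OF assms(2)])

lemma gdens_nonneg [simp]: "0 \<le> gdens N s U z"
  by (simp add: gdens_def)

lemma energy_sum:
  fixes U :: "real ^ 'n \<Rightarrow> nat \<Rightarrow> real"
  assumes U: "vborel N U" and A: "A \<in> sets borel"
  shows "energy N s A U = (\<Sum>i<N. gagl A s (\<lambda>x. U x i))"
proof -
  have [measurable]: "A \<times> A \<in> sets (borel :: ((real ^ 'n) \<times> (real ^ 'n)) measure)"
    using A by (simp add: borel_prod[symmetric])
  have "energy N s A U = (\<integral>\<^sup>+z. (\<Sum>i<N. ennreal ((U (fst z) i - U (snd z) i)\<^sup>2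
      / norm (fst z - snd z) powr (real DIM(real ^ 'n) + 2 * s)) * indicator (A \<times> A) z) \<partial>lborel)"
    unfolding energy_def gdens_def vnorm_power2
    by (intro nn_integral_cong) (simp add: sum_divide_distrib sum_distrib_right[symmetric] sum_ennreal)
  also have "\<dots> = (\<Sum>i<N. gagl A s (\<lambda>x. U x i))"
    unfolding gagl_def
    by (intro nn_integral_sum borel_measurable_times_ennreal measurable_compose[OF _ measurable_ennreal]
      borel_measurable_divide)
      (auto intro!: measurable_kernel borel_measurable_power borel_measurable_diff measurable_component_fst[OF U])
  finally show ?thesis .
qed

lemma mass_sum:
  assumes U: "vborel N U"
  shows "mass N U = (\<Sum>i<N. \<integral>\<^sup>+x. ennreal ((U x i)\<^sup>2) \<partial>lborel)"
proof -
  have "mass N U = (\<integral>\<^sup>+x. (\<Sum>i<N. ennreal ((U x i)\<^sup>2)) \<partial>lborel)"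
    unfolding mass_def vnorm_power2 by (simp add: sum_ennreal)
  also have "\<dots> = (\<Sum>i<N. \<integral>\<^sup>+x. ennreal ((U x i)\<^sup>2) \<partial>lborel)"
    by (intro nn_integral_sum measurable_compose[OF _ measurable_ennreal])
       (auto intro!: borel_measurable_power vborelD[OF U])
  finally show ?thesis .
qed

text \<open>Both sides are sums over components, so the scalar constant survives unchanged. Its
  independence of \<open>N\<close> is what allows \<open>c'\<close> to depend on \<open>n\<close>
  and \<open>s\<close> only.\<close>

lemma vector_poincare:
  fixes U :: "real ^ 'n \<Rightarrow> nat \<Rightarrow> real"
  assumes U: "vborel N U" and s: "0 < s" and r: "1/32 < r" "r < R" "R \<le> 2"
    and U0: "\<And>x i. x \<notin> ball x0 r \<Longrightarrow> i < N \<Longrightarrow> U x i = 0"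
  shows "ennreal (R - r) * mass N U
     \<le> ennreal (poincare_const TYPE(real ^ 'n) s) * energy N s (ball x0 R) U"
  unfolding mass_sum[OF U] energy_sum[OF U borel_open[OF open_ball]] sum_distrib_left
  using U0 by (intro sum_mono poincare vborelD[OF U] s r) auto

lemma energy_far_le:
  fixes U :: "real ^ 'n \<Rightarrow> nat \<Rightarrow> real"
  assumes U: "vborel N U" and s: "0 < s" and \<theta>: "0 < \<theta>"
  shows "(\<integral>\<^sup>+z. ennreal (gdens N s U z) * indicator {z. \<theta> \<le> norm (fst z - snd z)} z \<partial>lborel)
     \<le> ennreal (4 * far_const TYPE(real ^ 'n) s * \<theta> powr (- 2 * s)) * mass N U"
proof -
  have [measurable]: "{z. \<theta> \<le> norm (fst z - snd z)} \<in> sets (borel :: ((real ^ 'n) \<times> (real ^ 'n)) measure)"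
    by (intro borel_closed closed_Collect_le continuous_intros)
  have "(\<integral>\<^sup>+z. ennreal (gdens N s U z) * indicator {z. \<theta> \<le> norm (fst z - snd z)} z \<partial>lborel)
     = (\<integral>\<^sup>+z. (\<Sum>i<N. ennreal ((U (fst z) i - U (snd z) i)\<^sup>2
      / norm (fst z - snd z) powr (real DIM(real ^ 'n) + 2 * s)) * indicator {z. \<theta> \<le> norm (fst z - snd z)} z) \<partial>lborel)"
    unfolding gdens_def vnorm_power2
    by (intro nn_integral_cong) (simp add: sum_divide_distrib sum_distrib_right[symmetric] sum_ennreal)
  also have "\<dots> = (\<Sum>i<N. \<integral>\<^sup>+z. ennreal ((U (fst z) i - U (snd z) i)\<^sup>2
      / norm (fst z - snd z) powr (real DIM(real ^ 'n) + 2 * s)) * indicator {z. \<theta> \<le> norm (fst z - snd z)} z \<partial>lborel)"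
    by (intro nn_integral_sum borel_measurable_times_ennreal measurable_compose[OF _ measurable_ennreal]
      borel_measurable_divide)
      (auto intro!: measurable_kernel borel_measurable_power borel_measurable_diff measurable_component_fst[OF U])
  also have "\<dots> \<le> (\<Sum>i<N. ennreal (4 * far_const TYPE(real ^ 'n) s * \<theta> powr (- 2 * s)) * (\<integral>\<^sup>+x. ennreal ((U x i)\<^sup>2) \<partial>lborel))"
    by (intro sum_mono gagl_far_le vborelD[OF U] s \<theta>) auto
  finally show ?thesis by (simp add: mass_sum[OF U] sum_distrib_left)
qed

lemma integrable_dominated:
  fixes F g :: "'a \<Rightarrow> real"
  assumes "F \<in> borel_measurable M" and "AE x in M. \<bar>F x\<bar> \<le> g x"
    and "(\<integral>\<^sup>+x. ennreal (g x) \<partial>M) \<le> ennreal c" and "0 \<le> c"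
  shows "integrable M F" "\<bar>\<integral>x. F x \<partial>M\<bar> \<le> c"
proof -
  have le: "(\<integral>\<^sup>+x. ennreal (norm (F x)) \<partial>M) \<le> ennreal c"
    using assms(2,3) by (intro order_trans[OF nn_integral_mono_AE assms(3)]) (auto intro: ennreal_leI)
  then show i: "integrable M F"
    using assms(1) by (auto simp: integrable_iff_bounded intro: le_less_trans)
  have "ennreal (norm (\<integral>x. F x \<partial>M)) \<le> ennreal c"
    using integral_norm_bound_ennreal[OF i] le by (rule order_trans)
  then show "\<bar>\<integral>x. F x \<partial>M\<bar> \<le> c" using assms(4) by (simp add: ennreal_le_iff)
qed

section \<open>Estimates of the nonlocal form\<close>

text \<open>Cauchy-Schwarz twice, then Young's inequality. The weight \<open>\<tau>\<close> stays
  free: it serves for absorption, for balancing powers of \<open>\<rho>\<close>, and once it even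
  varies with the point \<open>z\<close>.\<close>

lemma abs_bil_le:
  fixes V U :: "real ^ 'n \<Rightarrow> nat \<Rightarrow> real"
  assumes a: "mat_norm N a \<le> \<Lambda>" and \<tau>: "0 < \<tau>"
  shows "\<bar>bil N s a V U z\<bar> \<le> \<Lambda> / 2 * (\<tau> * gdens N s V z + gdens N s U z / \<tau>)"
proof -
  define k where "k = norm (fst z - snd z) powr (real CARD('n) + 2 * s)"
  define p where "p = vnorm N (V (fst z) - V (snd z))"
  define w where "w = vnorm N (U (fst z) - U (snd z))"
  have k: "0 \<le> k" by (simp add: k_def)
  have \<Lambda>: "0 \<le> \<Lambda>" using a mat_norm_nonneg[of N a] by simp
  have "\<bar>vinner N (mat_app N a (V (fst z) - V (snd z))) (U (fst z) - U (snd z))\<bar>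
      \<le> vnorm N (mat_app N a (V (fst z) - V (snd z))) * w"
    unfolding w_def by (rule abs_vinner_le)
  also have "\<dots> \<le> (mat_norm N a * p) * w"
    unfolding p_def w_def by (intro mult_right_mono vnorm_mat_app_le) simp
  also have "\<dots> \<le> (\<Lambda> * p) * w"
    using a by (intro mult_right_mono) (auto simp: p_def w_def)
  also have "\<dots> \<le> \<Lambda> * ((\<tau> * p\<^sup>2 + w\<^sup>2 / \<tau>) / 2)"
    using young[OF \<tau>, of p w] \<Lambda> by (simp add: mult.assoc mult_left_mono)
  finally have "\<bar>vinner N (mat_app N a (V (fst z) - V (snd z))) (U (fst z) - U (snd z))\<bar> / k
     \<le> \<Lambda> * ((\<tau> * p\<^sup>2 + w\<^sup>2 / \<tau>) / 2) / k"
    using k by (rule divide_right_mono)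
  also have "\<dots> = \<Lambda> / 2 * (\<tau> * (p\<^sup>2 / k) + (w\<^sup>2 / k) / \<tau>)"
    by (simp add: add_divide_distrib distrib_left mult_ac)
  finally show ?thesis
    using k by (simp add: bil_def gdens_def abs_divide flip: k_def p_def w_def)
qed

lemma bil_estimate:
  fixes V U :: "real ^ 'n \<Rightarrow> nat \<Rightarrow> real"
  assumes V: "vborel N V" and U: "vborel N U" and a: "mat_norm N a \<le> \<Lambda>" and \<tau>: "0 < \<tau>"
    and v: "energy N s UNIV V \<le> ennreal v" "0 \<le> v" and u: "energy N s UNIV U \<le> ennreal u" "0 \<le> u"
  shows "integrable lborel (bil N s a V U)"
    "\<bar>\<integral>z. bil N s a V U z \<partial>lborel\<bar> \<le> \<Lambda> / 2 * (\<tau> * v + u / \<tau>)"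
proof -
  have \<Lambda>: "0 \<le> \<Lambda>" using a mat_norm_nonneg[of N a] by simp
  define c where "c = \<Lambda> / 2 * (\<tau> * v + u / \<tau>)"
  have c0: "0 \<le> c" using \<Lambda> \<tau> v u by (simp add: c_def)
  have *: "(\<integral>\<^sup>+z. ennreal (\<Lambda> / 2 * (\<tau> * gdens N s V z + gdens N s U z / \<tau>)) \<partial>lborel) \<le> ennreal c"
  proof -
    have "(\<integral>\<^sup>+z. ennreal (\<Lambda> / 2 * (\<tau> * gdens N s V z + gdens N s U z / \<tau>)) \<partial>lborel)
      = (\<integral>\<^sup>+z. ennreal (\<Lambda> / 2 * \<tau>) * ennreal (gdens N s V z) + ennreal (\<Lambda> / 2 / \<tau>) * ennreal (gdens N s U z) \<partial>lborel)"
      using \<Lambda> \<tau> by (intro nn_integral_cong)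
        (simp add: ennreal_mult[symmetric] ennreal_plus[symmetric] distrib_left mult_ac del: ennreal_plus)
    also have "\<dots> = ennreal (\<Lambda> / 2 * \<tau>) * energy N s UNIV V + ennreal (\<Lambda> / 2 / \<tau>) * energy N s UNIV U"
      using measurable_gdens[OF V, of s] measurable_gdens[OF U, of s]
      by (simp add: nn_integral_add nn_integral_cmult energy_def)
    also have "\<dots> \<le> ennreal (\<Lambda> / 2 * \<tau>) * ennreal v + ennreal (\<Lambda> / 2 / \<tau>) * ennreal u"
      using v u by (intro add_mono mult_left_mono) auto
    also have "\<dots> = ennreal c"
      using \<Lambda> \<tau> u v by (simp add: c_def ennreal_mult[symmetric] ennreal_plus[symmetric] distrib_left mult_ac del: ennreal_plus)
    finally show ?thesis .
  qed
  have m: "bil N s a V U \<in> borel_measurable lborel" using measurable_bil[OF V U] by simp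
  note d = integrable_dominated[OF m AE_I2[OF abs_bil_le[OF a \<tau>]] * c0]
  show "integrable lborel (bil N s a V U)"
    "\<bar>\<integral>z. bil N s a V U z \<partial>lborel\<bar> \<le> \<Lambda> / 2 * (\<tau> * v + u / \<tau>)"
    using d unfolding c_def by blast+
qed

text \<open>Near the diagonal the extra regularity of \<open>V\<close> gives the factor \<open>\<theta> powr \<delta>\<close>; away from it only
  the mass of \<open>U\<close> enters.\<close>

lemma bil_estimate_split:
  fixes V U :: "real ^ 'n \<Rightarrow> nat \<Rightarrow> real"
  assumes V: "vborel N V" and U: "vborel N U" and a: "mat_norm N a \<le> \<Lambda>" and \<tau>: "0 < \<tau>"
    and s: "0 < s" and \<delta>: "0 < \<delta>" and \<theta>: "0 < \<theta>"
    and v: "energy N s UNIV V \<le> ennreal v" "0 \<le> v" and v1: "energy N (s + \<delta>) UNIV V \<le> ennreal v"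
    and u: "energy N s UNIV U \<le> ennreal u" "0 \<le> u" and l: "mass N U \<le> ennreal l" "0 \<le> l"
  shows "\<bar>\<integral>z. bil N s a V U z \<partial>lborel\<bar>
     \<le> \<Lambda> / 2 * (\<theta> powr \<delta> * (v + u) + (\<tau> * v + 4 * far_const TYPE(real ^ 'n) s * \<theta> powr (- 2 * s) * l / \<tau>))"
proof -
  have \<Lambda>: "0 \<le> \<Lambda>" using a mat_norm_nonneg[of N a] by simp
  define F where "F = {z :: (real ^ 'n) \<times> (real ^ 'n). \<theta> \<le> norm (fst z - snd z)}"
  have F[measurable]: "F \<in> sets borel"
    unfolding F_def by (intro borel_closed closed_Collect_le continuous_intros)
  define T where "T = 4 * far_const TYPE(real ^ 'n) s * \<theta> powr (- 2 * s)"
  have T0: "0 \<le> T" using far_const_nonneg[OF s, where 'a="real ^ 'n"] by (simp add: T_def)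
  define b where "b = \<theta> powr \<delta>"
  have b: "0 \<le> b" by (simp add: b_def)
  define c where "c = \<Lambda> / 2 * (b * (v + u) + (\<tau> * v + T * l / \<tau>))"
  have c0: "0 \<le> c" using \<Lambda> \<tau> v u b T0 l by (simp add: c_def)
  \<comment> \<open>One majorant for both regimes: the terms belonging to the other regime are
    nonnegative and may be kept.\<close>
  define g where "g z = \<Lambda> / 2 * (b * (gdens N (s + \<delta>) V z + gdens N s U z)
      + (\<tau> * gdens N s V z + gdens N s U z * indicator F z / \<tau>))" for z
  have le: "\<bar>bil N s a V U z\<bar> \<le> g z" for z
  proof (cases "z \<in> F")
    case True
    have "\<bar>bil N s a V U z\<bar> \<le> \<Lambda> / 2 * (\<tau> * gdens N s V z + gdens N s U z / \<tau>)"
      by (rule abs_bil_le[OF a \<tau>])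
    also have "\<dots> \<le> g z" unfolding g_def using True \<Lambda> b by (intro mult_left_mono) auto
    finally show ?thesis .
  next
    case False
    show ?thesis
    proof (cases "fst z = snd z")
      case True
      then have "bil N s a V U z = 0" by (simp add: bil_def)
      then show ?thesis using \<Lambda> b \<tau> by (simp add: g_def)
    next
      case ne: False
      define d where "d = norm (fst z - snd z)"
      have d: "0 < d" "d < \<theta>" using ne False by (auto simp: d_def F_def)
      \<comment> \<open>The order \<open>s + \<delta>\<close> puts \<open>2 * \<delta>\<close> into
        the exponent of the kernel; half of this gain is given to each argument of the form.\<close>
      have gd: "gdens N (s + \<delta>) V z * d powr \<delta> * d powr \<delta> = gdens N s V z"
      proof -
        have "d powr (real CARD('n) + 2 * (s + \<delta>)) = d powr (real CARD('n) + 2 * s) * d powr \<delta> * d powr \<delta>"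
          by (simp add: powr_add[symmetric] algebra_simps)
        then show ?thesis using d by (simp add: gdens_def flip: d_def)
      qed
      have dd: "0 < d powr \<delta>" using d by simp
      \<comment> \<open>Young's weight is chosen pointwise as \<open>1 / d powr \<delta>\<close>, so
        that both densities come with the same factor \<open>d powr \<delta>\<close>, which is small
        near the diagonal.\<close>
      have "\<bar>bil N s a V U z\<bar> \<le> \<Lambda> / 2 * ((1 / d powr \<delta>) * gdens N s V z + gdens N s U z / (1 / d powr \<delta>))"
        using dd by (intro abs_bil_le[OF a]) simp
      also have "\<dots> = \<Lambda> / 2 * (d powr \<delta> * (gdens N (s + \<delta>) V z + gdens N s U z))"
        unfolding gd[symmetric] using dd by (simp add: field_simps)
      also have "\<dots> \<le> \<Lambda> / 2 * (b * (gdens N (s + \<delta>) V z + gdens N s U z))"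
        unfolding b_def using d \<delta> \<Lambda> by (intro mult_left_mono mult_right_mono powr_mono2) auto
      also have "\<dots> \<le> g z" unfolding g_def using \<Lambda> \<tau> by (intro mult_left_mono) auto
      finally show ?thesis .
    qed
  qed
  have *: "(\<integral>\<^sup>+z. ennreal (g z) \<partial>lborel) \<le> ennreal c"
  proof -
    have "ennreal (g z) = ennreal (\<Lambda> / 2 * b) * ennreal (gdens N (s + \<delta>) V z) + ennreal (\<Lambda> / 2 * b) * ennreal (gdens N s U z)
       + ennreal (\<Lambda> / 2 * \<tau>) * ennreal (gdens N s V z) + ennreal (\<Lambda> / 2 / \<tau>) * (ennreal (gdens N s U z) * indicator F z)" for z
      using \<Lambda> \<tau> b unfolding g_def
      by (auto simp: ennreal_mult[symmetric] ennreal_plus[symmetric] indicator_def algebra_simps simp del: ennreal_plus)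
    then have "(\<integral>\<^sup>+z. ennreal (g z) \<partial>lborel)
      = ennreal (\<Lambda> / 2 * b) * energy N (s + \<delta>) UNIV V + ennreal (\<Lambda> / 2 * b) * energy N s UNIV U
       + ennreal (\<Lambda> / 2 * \<tau>) * energy N s UNIV V
       + ennreal (\<Lambda> / 2 / \<tau>) * (\<integral>\<^sup>+z. ennreal (gdens N s U z) * indicator F z \<partial>lborel)"
      using measurable_gdens[OF V, of s] measurable_gdens[OF V, of "s + \<delta>"] measurable_gdens[OF U, of s]
      by (simp add: nn_integral_add nn_integral_cmult energy_def)
    also have "(\<integral>\<^sup>+z. ennreal (gdens N s U z) * indicator F z \<partial>lborel) \<le> ennreal T * mass N U"
      unfolding F_def T_def by (rule energy_far_le[OF U s \<theta>])
    also have "ennreal T * mass N U \<le> ennreal T * ennreal l" using l by (intro mult_left_mono) auto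
    also have "ennreal (\<Lambda> / 2 * b) * energy N (s + \<delta>) UNIV V + ennreal (\<Lambda> / 2 * b) * energy N s UNIV U
       + ennreal (\<Lambda> / 2 * \<tau>) * energy N s UNIV V + ennreal (\<Lambda> / 2 / \<tau>) * (ennreal T * ennreal l)
       \<le> ennreal (\<Lambda> / 2 * b) * ennreal v + ennreal (\<Lambda> / 2 * b) * ennreal u
       + ennreal (\<Lambda> / 2 * \<tau>) * ennreal v + ennreal (\<Lambda> / 2 / \<tau>) * (ennreal T * ennreal l)"
      using v v1 u by (intro add_mono mult_left_mono) auto
    also have "\<dots> = ennreal c"
      using \<Lambda> \<tau> u v b T0 l unfolding c_def
      by (simp add: ennreal_mult[symmetric] ennreal_plus[symmetric] algebra_simps del: ennreal_plus)
    finally show ?thesis by (simp add: add_left_mono mult_left_mono)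
  qed
  have m: "bil N s a V U \<in> borel_measurable lborel" using measurable_bil[OF V U] by simp
  show ?thesis
    using integrable_dominated(2)[OF m AE_I2[OF le] * c0] unfolding c_def b_def T_def .
qed

text \<open>Cauchy-Schwarz and Young on the ball, outside which the integrand vanishes; its volume
  is at most that of the unit ball.\<close>

lemma source_estimate:
  fixes G U :: "real ^ 'n \<Rightarrow> nat \<Rightarrow> real"
  assumes G: "vborel N G" and U: "vborel N U" and \<tau>: "0 < \<tau>" and r: "r \<le> 1" "0 < r"
    and U0: "\<And>x i. x \<notin> ball x0 r \<Longrightarrow> i < N \<Longrightarrow> U x i = 0"
    and c: "AE x in lborel. vnorm N (G x) \<le> c" "0 \<le> c" and l: "mass N U \<le> ennreal l" "0 \<le> l"
  shows "integrable lborel (\<lambda>x. vinner N (G x) (U x))"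
    "\<bar>\<integral>x. vinner N (G x) (U x) \<partial>lborel\<bar> \<le> (\<tau> * (c\<^sup>2 * unit_ball_vol (real CARD('n))) + l / \<tau>) / 2"
proof -
  define \<omega> where "\<omega> = unit_ball_vol (real CARD('n))"
  have \<omega>: "0 \<le> \<omega>" by (simp add: \<omega>_def)
  define C where "C = (\<tau> * (c\<^sup>2 * \<omega>) + l / \<tau>) / 2"
  have C0: "0 \<le> C" using \<tau> \<omega> l by (simp add: C_def)
  define g where "g x = (\<tau> * (c\<^sup>2 * indicator (ball x0 r) x) + (vnorm N (U x))\<^sup>2 / \<tau>) / 2" for x
  have le: "AE x in lborel. \<bar>vinner N (G x) (U x)\<bar> \<le> g x"
    using c(1)
  proof eventually_elim
    case (elim x)
    show ?case
    proof (cases "x \<in> ball x0 r")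
      case True
      have "\<bar>vinner N (G x) (U x)\<bar> \<le> vnorm N (G x) * vnorm N (U x)" by (rule abs_vinner_le)
      also have "\<dots> \<le> c * vnorm N (U x)" using elim by (intro mult_right_mono) auto
      also have "\<dots> \<le> g x" using young[OF \<tau>, of c "vnorm N (U x)"] True by (simp add: g_def)
      finally show ?thesis .
    next
      case False
      then have "vinner N (G x) (U x) = 0" using U0 by (simp add: vinner_def)
      then show ?thesis using \<tau> by (simp add: g_def)
    qed
  qed
  have vol: "emeasure lborel (ball x0 r) \<le> ennreal \<omega>"
  proof -
    have "emeasure lborel (ball x0 r) = ennreal (\<omega> * r ^ CARD('n))" using r by (simp add: emeasure_ball \<omega>_def)
    also have "\<dots> \<le> ennreal \<omega>" using r \<omega> by (intro ennreal_leI mult_left_le power_le_one) auto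
    finally show ?thesis .
  qed
  have *: "(\<integral>\<^sup>+x. ennreal (g x) \<partial>lborel) \<le> ennreal C"
  proof -
    have gx: "ennreal (g x) = ennreal (\<tau> * c\<^sup>2 / 2) * indicator (ball x0 r) x + ennreal (1 / \<tau> / 2) * ennreal ((vnorm N (U x))\<^sup>2)" for x
      using \<tau> by (auto simp: g_def ennreal_mult[symmetric] ennreal_plus[symmetric] indicator_def add_divide_distrib simp del: ennreal_plus)
    have "(\<integral>\<^sup>+x. ennreal (g x) \<partial>lborel) = ennreal (\<tau> * c\<^sup>2 / 2) * emeasure lborel (ball x0 r) + ennreal (1 / \<tau> / 2) * mass N U"
    proof -
      have m1: "(\<lambda>x. ennreal ((vnorm N (U x))\<^sup>2)) \<in> borel_measurable lborel"
        using measurable_vnorm[OF U] by simp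
      have m2: "(\<lambda>x. indicator (ball x0 r) x :: ennreal) \<in> borel_measurable lborel"
        by (rule borel_measurable_indicator) simp
      have "(\<integral>\<^sup>+x. ennreal (\<tau> * c\<^sup>2 / 2) * indicator (ball x0 r) x + ennreal (1 / \<tau> / 2) * ennreal ((vnorm N (U x))\<^sup>2) \<partial>lborel)
        = (\<integral>\<^sup>+x. ennreal (\<tau> * c\<^sup>2 / 2) * indicator (ball x0 r) x \<partial>lborel) + (\<integral>\<^sup>+x. ennreal (1 / \<tau> / 2) * ennreal ((vnorm N (U x))\<^sup>2) \<partial>lborel)"
        by (intro nn_integral_add borel_measurable_times_ennreal borel_measurable_const m1 m2)
      also have "(\<integral>\<^sup>+x. ennreal (1 / \<tau> / 2) * ennreal ((vnorm N (U x))\<^sup>2) \<partial>lborel) = ennreal (1 / \<tau> / 2) * mass N U"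
        unfolding mass_def by (intro nn_integral_cmult m1)
      also have "(\<integral>\<^sup>+x. ennreal (\<tau> * c\<^sup>2 / 2) * indicator (ball x0 r) x \<partial>lborel) = ennreal (\<tau> * c\<^sup>2 / 2) * emeasure lborel (ball x0 r)"
        by (intro nn_integral_cmult_indicator) simp
      finally show ?thesis unfolding gx .
    qed
    also have "\<dots> \<le> ennreal (\<tau> * c\<^sup>2 / 2) * ennreal \<omega> + ennreal (1 / \<tau> / 2) * ennreal l"
      using vol l by (intro add_mono mult_left_mono) auto
    also have "\<dots> = ennreal C"
      using \<tau> \<omega> l by (simp add: C_def ennreal_mult[symmetric] ennreal_plus[symmetric] add_divide_distrib mult_ac del: ennreal_plus)
    finally show ?thesis .
  qed
  have m: "(\<lambda>x. vinner N (G x) (U x)) \<in> borel_measurable lborel" using measurable_vinner[OF G U] by simp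
  note d = integrable_dominated[OF m le * C0]
  show "integrable lborel (\<lambda>x. vinner N (G x) (U x))"
    "\<bar>\<integral>x. vinner N (G x) (U x) \<partial>lborel\<bar> \<le> (\<tau> * (c\<^sup>2 * unit_ball_vol (real CARD('n))) + l / \<tau>) / 2"
    using d by (auto simp: C_def \<omega>_def)
qed

text \<open>Ellipticity, integrated pointwise. Finite energy makes the form integrable, so the
  Bochner integral on the right is not a default value.\<close>

lemma energy_le_bil:
  fixes W :: "real ^ 'n \<Rightarrow> nat \<Rightarrow> real"
  assumes W: "vborel N W" and ell: "\<And>\<xi>. (vnorm N \<xi>)\<^sup>2 / \<Lambda> \<le> vinner N (mat_app N a \<xi>) \<xi>"
    and \<Lambda>: "0 < \<Lambda>" and a: "mat_norm N a \<le> \<Lambda>" and fin: "energy N s UNIV W < \<infinity>"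
  shows "energy N s UNIV W \<le> ennreal (\<Lambda> * (\<integral>z. bil N s a W W z \<partial>lborel))"
proof -
  obtain u where u: "energy N s UNIV W = ennreal u" "0 \<le> u"
    using fin by (cases "energy N s UNIV W") auto
  have i: "integrable lborel (bil N s a W W)"
    using bil_estimate(1)[OF W W a zero_less_one, of s u u] u by simp
  have le: "gdens N s W z \<le> \<Lambda> * bil N s a W W z" for z
  proof -
    define k where "k = norm (fst z - snd z) powr (real CARD('n) + 2 * s)"
    define \<xi> where "\<xi> = W (fst z) - W (snd z)"
    have "(vnorm N \<xi>)\<^sup>2 \<le> \<Lambda> * vinner N (mat_app N a \<xi>) \<xi>"
      using ell[of \<xi>] \<Lambda> by (simp add: pos_divide_le_eq mult.commute)
    then have "(vnorm N \<xi>)\<^sup>2 / k \<le> \<Lambda> * vinner N (mat_app N a \<xi>) \<xi> / k"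
      by (rule divide_right_mono) (simp add: k_def)
    then show ?thesis by (simp add: gdens_def bil_def k_def \<xi>_def)
  qed
  have "energy N s UNIV W \<le> (\<integral>\<^sup>+z. ennreal (\<Lambda> * bil N s a W W z) \<partial>lborel)"
    unfolding energy_def using le by (auto intro!: nn_integral_mono ennreal_leI)
  also have "\<dots> = ennreal (\<integral>z. \<Lambda> * bil N s a W W z \<partial>lborel)"
    using i by (intro nn_integral_eq_integral AE_I2 order_trans[OF gdens_nonneg le]) simp
  finally show ?thesis by simp
qed

definition energy_const :: "(real ^ 'n) itself \<Rightarrow> real \<Rightarrow> real \<Rightarrow> real \<Rightarrow> real" where
  "energy_const _ s \<Lambda> c = \<Lambda>\<^sup>2 * poincare_const TYPE(real ^ 'n) s * (c\<^sup>2 * unit_ball_vol (real CARD('n))) * 2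
      + 2 * \<Lambda> ^ 4 * c\<^sup>2"

text \<open>The equation is tested with \<open>W\<close> itself. Ellipticity bounds the energy
  \<open>u\<close> of \<open>W\<close> by the source and the form of \<open>V\<close>, and the Young
  weights are tuned so that half of \<open>u\<close> returns on the right and is absorbed;
  \<open>energy_const\<close> is twice the remainder.\<close>

lemma energy_estimate:
  fixes V W G :: "real ^ 'n \<Rightarrow> nat \<Rightarrow> real"
  assumes V: "vborel N V" and W: "vborel N W" and G: "vborel N G"
    and ell: "\<And>\<xi>. (vnorm N \<xi>)\<^sup>2 / \<Lambda> \<le> vinner N (mat_app N a \<xi>) \<xi>"
    and \<Lambda>: "1 \<le> \<Lambda>" and a: "mat_norm N a \<le> \<Lambda>" and fin: "energy N s UNIV W < \<infinity>" and s: "0 < s"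
    and r: "1/32 < r" "r < 1" and W0: "\<And>x i. x \<notin> ball x0 r \<Longrightarrow> i < N \<Longrightarrow> W x i = 0"
    and c: "AE x in lborel. vnorm N (G x) \<le> c" "0 \<le> c" and v: "energy N s UNIV V \<le> ennreal (c\<^sup>2)"
    and id: "(\<integral>z. bil N s a V W z \<partial>lborel) + (\<integral>z. bil N s a W W z \<partial>lborel) = (\<integral>x. vinner N (G x) (W x) \<partial>lborel)"
  shows "energy N s UNIV W \<le> ennreal (energy_const TYPE(real ^ 'n) s \<Lambda> c)"
    "mass N W \<le> ennreal (poincare_const TYPE(real ^ 'n) s) * energy N s UNIV W"
proof -
  define P where "P = poincare_const TYPE(real ^ 'n) s"
  have P: "0 < P" unfolding P_def by (rule poincare_const_pos)
  define \<omega> where "\<omega> = unit_ball_vol (real CARD('n))"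
  \<comment> \<open>Radius 2 in the Poincare inequality: the gap \<open>2 - r\<close> exceeds 1, so
    the constant depends on dimension and order alone.\<close>
  have "mass N W \<le> ennreal (2 - r) * mass N W"
    using mult_right_mono[of 1 "ennreal (2 - r)" "mass N W"] r by simp
  also have "\<dots> \<le> ennreal P * energy N s (ball x0 2) W"
    unfolding P_def using r by (intro vector_poincare[OF W s _ _ _ W0]) auto
  also have "\<dots> \<le> ennreal P * energy N s UNIV W"
    by (intro mult_left_mono) (auto simp: energy_def indicator_def intro!: nn_integral_mono)
  finally show ms: "mass N W \<le> ennreal (poincare_const TYPE(real ^ 'n) s) * energy N s UNIV W"
    by (simp add: P_def)
  obtain u where u: "energy N s UNIV W = ennreal u" "0 \<le> u"
    using fin by (cases "energy N s UNIV W") auto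
  have l: "mass N W \<le> ennreal (P * u)" using ms u P by (simp add: P_def ennreal_mult)
  \<comment> \<open>The weight \<open>1 / (2 * \<Lambda>\<^sup>2)\<close> on the energy of
    \<open>W\<close> leaves \<open>u / (4 * \<Lambda>)\<close>, a quarter of \<open>u\<close> after
    multiplication by \<open>\<Lambda>\<close>.\<close>
  have "\<bar>\<integral>z. bil N s a V W z \<partial>lborel\<bar> \<le> \<Lambda> / 2 * (2 * \<Lambda>\<^sup>2 * c\<^sup>2 + u / (2 * \<Lambda>\<^sup>2))"
    using \<Lambda> u by (intro bil_estimate(2)[OF V W a _ v]) auto
  also have "\<dots> = \<Lambda> ^ 3 * c\<^sup>2 + u / (4 * \<Lambda>)"
    using \<Lambda> by (simp add: field_simps power2_eq_square power3_eq_cube)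
  finally have 1: "\<bar>\<integral>z. bil N s a V W z \<partial>lborel\<bar> \<le> \<Lambda> ^ 3 * c\<^sup>2 + u / (4 * \<Lambda>)" .
  \<comment> \<open>The weight \<open>2 * \<Lambda> * P\<close> cancels the Poincare constant and
    produces the second quarter.\<close>
  have "\<bar>\<integral>x. vinner N (G x) (W x) \<partial>lborel\<bar> \<le> (2 * \<Lambda> * P * (c\<^sup>2 * \<omega>) + P * u / (2 * \<Lambda> * P)) / 2"
    unfolding \<omega>_def using \<Lambda> P r u by (intro source_estimate(2)[OF G W _ _ _ W0 c l]) auto
  also have "\<dots> = \<Lambda> * P * (c\<^sup>2 * \<omega>) + u / (4 * \<Lambda>)" using \<Lambda> P by (simp add: field_simps)
  finally have 2: "\<bar>\<integral>x. vinner N (G x) (W x) \<partial>lborel\<bar> \<le> \<Lambda> * P * (c\<^sup>2 * \<omega>) + u / (4 * \<Lambda>)" .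
  have A: "ennreal u \<le> ennreal (\<Lambda> * (\<integral>z. bil N s a W W z \<partial>lborel))"
    using energy_le_bil[OF W ell _ a fin] \<Lambda> u by simp
  have "(\<integral>z. bil N s a W W z \<partial>lborel) \<le> \<Lambda> * P * (c\<^sup>2 * \<omega>) + \<Lambda> ^ 3 * c\<^sup>2 + u / (2 * \<Lambda>)"
  proof -
    have "u / (4 * \<Lambda>) + u / (4 * \<Lambda>) = u / (2 * \<Lambda>)" by simp
    then show ?thesis using 1 2 id by linarith
  qed
  then have "\<Lambda> * (\<integral>z. bil N s a W W z \<partial>lborel) \<le> \<Lambda> * (\<Lambda> * P * (c\<^sup>2 * \<omega>) + \<Lambda> ^ 3 * c\<^sup>2 + u / (2 * \<Lambda>))"
    using \<Lambda> by (intro mult_left_mono) auto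
  also have "\<dots> = \<Lambda>\<^sup>2 * P * (c\<^sup>2 * \<omega>) + \<Lambda> ^ 4 * c\<^sup>2 + u / 2"
    using \<Lambda> by (simp add: field_simps power2_eq_square power3_eq_cube power4_eq_xxxx)
  finally have "ennreal u \<le> ennreal (\<Lambda>\<^sup>2 * P * (c\<^sup>2 * \<omega>) + \<Lambda> ^ 4 * c\<^sup>2 + u / 2)"
    using A by (meson ennreal_leI order_trans)
  then have "u \<le> \<Lambda>\<^sup>2 * P * (c\<^sup>2 * \<omega>) + \<Lambda> ^ 4 * c\<^sup>2 + u / 2"
    using \<Lambda> P u by (subst (asm) ennreal_le_iff) (auto simp: \<omega>_def intro!: add_nonneg_nonneg mult_nonneg_nonneg)
  then have "u \<le> energy_const TYPE(real ^ 'n) s \<Lambda> c"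
    by (simp add: energy_const_def P_def \<omega>_def)
  then show "energy N s UNIV W \<le> ennreal (energy_const TYPE(real ^ 'n) s \<Lambda> c)"
    unfolding u by (rule ennreal_leI)
qed

section \<open>Approximation of vector functions and the defect estimate\<close>

lemma vnorm_add_power2_le:
  assumes "\<And>i. i < N \<Longrightarrow> \<xi> i = \<eta> i + \<zeta> i \<or> \<xi> i = \<eta> i - \<zeta> i"
  shows "(vnorm N \<xi>)\<^sup>2 \<le> 2 * (vnorm N \<eta>)\<^sup>2 + 2 * (vnorm N \<zeta>)\<^sup>2"
proof -
  have "(x + y)\<^sup>2 \<le> 2 * x\<^sup>2 + 2 * y\<^sup>2" "(x - y)\<^sup>2 \<le> 2 * x\<^sup>2 + 2 * y\<^sup>2" for x y :: real
    using zero_le_power2[of "x - y"] zero_le_power2[of "x + y"] by (simp_all add: power2_eq_square algebra_simps)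
  then have "(\<xi> i)\<^sup>2 \<le> 2 * (\<eta> i)\<^sup>2 + 2 * (\<zeta> i)\<^sup>2" if "i < N" for i
    using assms[OF that] by metis
  then have "(\<Sum>i<N. (\<xi> i)\<^sup>2) \<le> (\<Sum>i<N. 2 * (\<eta> i)\<^sup>2 + 2 * (\<zeta> i)\<^sup>2)" by (intro sum_mono) auto
  then show ?thesis by (simp add: vnorm_power2 sum.distrib sum_distrib_left)
qed

text \<open>Serves for sums and for differences alike. The sign is the same at all points, so that
  increments of \<open>X\<close> are again sums or differences of increments.\<close>

lemma energy_add_le:
  fixes X U V :: "real ^ 'n \<Rightarrow> nat \<Rightarrow> real"
  assumes "vborel N U" "vborel N V" and A: "A \<in> sets borel"
    and "(\<forall>x. \<forall>i<N. X x i = U x i + V x i) \<or> (\<forall>x. \<forall>i<N. X x i = U x i - V x i)"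
  shows "energy N s A X \<le> 2 * energy N s A U + 2 * energy N s A V"
proof -
  have le: "ennreal (gdens N s X z) \<le> 2 * ennreal (gdens N s U z) + 2 * ennreal (gdens N s V z)" for z
  proof -
    have "(vnorm N (X (fst z) - X (snd z)))\<^sup>2
       \<le> 2 * (vnorm N (U (fst z) - U (snd z)))\<^sup>2 + 2 * (vnorm N (V (fst z) - V (snd z)))\<^sup>2"
      using assms(4) by (intro vnorm_add_power2_le) auto
    then have "gdens N s X z \<le> (2 * (vnorm N (U (fst z) - U (snd z)))\<^sup>2 + 2 * (vnorm N (V (fst z) - V (snd z)))\<^sup>2)
        / norm (fst z - snd z) powr (real CARD('n) + 2 * s)"
      unfolding gdens_def by (rule divide_right_mono) simp
    then have "gdens N s X z \<le> 2 * gdens N s U z + 2 * gdens N s V z"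
      by (simp add: gdens_def add_divide_distrib)
    then have "ennreal (gdens N s X z) \<le> ennreal (2 * gdens N s U z + 2 * gdens N s V z)" by (rule ennreal_leI)
    then show ?thesis by (simp add: ennreal_mult)
  qed
  have Am: "A \<times> A \<in> sets (borel :: ((real ^ 'n) \<times> (real ^ 'n)) measure)"
    using A by (simp add: borel_prod[symmetric])
  have m: "(\<lambda>z. ennreal (gdens N s Y z) * indicator (A \<times> A) z) \<in> borel_measurable lborel" if "vborel N Y" for Y :: "real ^ 'n \<Rightarrow> nat \<Rightarrow> real"
    using measurable_gdens[OF that, of s] Am
    by (intro borel_measurable_times_ennreal borel_measurable_indicator) auto
  have "energy N s A X \<le> (\<integral>\<^sup>+z. 2 * (ennreal (gdens N s U z) * indicator (A \<times> A) z)
      + 2 * (ennreal (gdens N s V z) * indicator (A \<times> A) z) \<partial>lborel)"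
    unfolding energy_def using le by (intro nn_integral_mono) (auto simp: indicator_def)
  also have "\<dots> = 2 * energy N s A U + 2 * energy N s A V"
    using m[OF assms(1)] m[OF assms(2)] by (simp add: energy_def nn_integral_add nn_integral_cmult)
  finally show ?thesis .
qed

text \<open>Componentwise use of the scalar approximation. The \<open>L^1\<close> norm of a
  component is controlled by the volume of the ball plus the mass bound \<open>A\<close>, and
  bounded Lipschitz functions are Hoelder of every order in \<open>[0, 1]\<close>. The factor
  \<open>N\<close> stems from estimating the Euclidean norm by the sum of the components.\<close>

lemma vector_approximation:
  "\<exists>L>0. \<forall>N (x0 :: real ^ 'n) r \<rho> s t A U.
     0 < s \<longrightarrow> s \<le> 1 \<longrightarrow> 0 < \<rho> \<longrightarrow> \<rho> \<le> r \<longrightarrow> r \<le> 1 \<longrightarrow> 0 \<le> t \<longrightarrow> t \<le> 1 \<longrightarrow> vborel N U \<longrightarrow>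
     (\<forall>x i. x \<notin> ball x0 r \<longrightarrow> i < N \<longrightarrow> U x i = 0) \<longrightarrow> mass N U \<le> ennreal A \<longrightarrow> 0 \<le> A \<longrightarrow>
     (\<exists>\<Phi>. vborel N \<Phi> \<and> (\<forall>x i. x \<notin> ball x0 r \<longrightarrow> i < N \<longrightarrow> \<Phi> x i = 0) \<and> (\<exists>M. \<forall>x. vnorm N (\<Phi> x) \<le> M)
       \<and> (\<forall>x y. vnorm N (\<Phi> x - \<Phi> y)
            \<le> real N * (L * (unit_ball_vol (real CARD('n)) + A) / \<rho> ^ Suc CARD('n)) * norm (x - y) powr t)
       \<and> mass N (U - \<Phi>) \<le> ennreal (L * \<rho> powr (2 * s)) * energy N s UNIV U
       \<and> energy N s UNIV \<Phi> \<le> 4 * energy N s UNIV U)"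
proof -
  from lipschitz_approximation[where 'a="real ^ 'n", unfolded DIM_cart DIM_real mult_1_right]
  show ?thesis
  proof (elim exE conjE, goal_cases)
    case (1 L0)
    note L0 = 1(1) and ap = 1(2)[rule_format]
    \<comment> \<open>Covers the 2 in the scalar Lipschitz constant, and makes the bound
      \<open>B\<close> below twice the supremum of each component.\<close>
    define L where "L = 2 * L0"
    have L: "0 < L" using L0 by (simp add: L_def)
    define \<omega> where "\<omega> = unit_ball_vol (real CARD('n))"
    have \<omega>: "0 \<le> \<omega>" by (simp add: \<omega>_def)
    show ?case
    proof (intro exI[of _ L] conjI allI impI L)
      fix N and x0 :: "real ^ 'n" and r \<rho> s t A :: real and U :: "real ^ 'n \<Rightarrow> nat \<Rightarrow> real"
      assume s: "0 < s" "s \<le> 1" and \<rho>: "0 < \<rho>" "\<rho> \<le> r" "r \<le> 1" and t: "0 \<le> t" "t \<le> 1"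
        and U: "vborel N U" and U0: "\<forall>x i. x \<notin> ball x0 r \<longrightarrow> i < N \<longrightarrow> U x i = 0"
        and A: "mass N U \<le> ennreal A" "0 \<le> A"
      have vol: "emeasure lborel (ball x0 r) \<le> ennreal \<omega>"
      proof -
        have "emeasure lborel (ball x0 r) = ennreal (\<omega> * r ^ CARD('n))" using \<rho> by (simp add: emeasure_ball \<omega>_def)
        also have "\<dots> \<le> ennreal \<omega>" using \<rho> \<omega> by (intro ennreal_leI mult_left_le power_le_one) auto
        finally show ?thesis .
      qed
      have int: "integrable lborel (\<lambda>x. U x i)" "(\<integral>x. \<bar>U x i\<bar> \<partial>lborel) \<le> \<omega> + A" if i: "i < N" for i
      proof -
        have m[measurable]: "(\<lambda>x. U x i) \<in> borel_measurable borel" by (rule vborelD[OF U i])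
        define g where "g x = indicator (ball x0 r) x + (U x i)\<^sup>2" for x
        have le: "\<bar>U x i\<bar> \<le> g x" for x
        proof (cases "x \<in> ball x0 r")
          case True
          have "0 \<le> (\<bar>U x i\<bar> - 1)\<^sup>2" by simp
          also have "\<dots> = (U x i)\<^sup>2 - 2 * \<bar>U x i\<bar> + 1" by (simp add: power2_diff)
          finally show ?thesis using True abs_ge_zero[of "U x i"] by (simp add: g_def del: abs_ge_zero)
        next
          case False
          then show ?thesis using U0 i by (simp add: g_def)
        qed
        have "(\<integral>\<^sup>+x. ennreal (g x) \<partial>lborel) = (\<integral>\<^sup>+x. indicator (ball x0 r) x + ennreal ((U x i)\<^sup>2) \<partial>lborel)"
          by (intro nn_integral_cong) (auto simp: g_def indicator_def)
        also have "\<dots> = emeasure lborel (ball x0 r) + (\<integral>\<^sup>+x. ennreal ((U x i)\<^sup>2) \<partial>lborel)"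
          by (subst nn_integral_add) (simp_all add: borel_measurable_indicator)
        also have "(\<integral>\<^sup>+x. ennreal ((U x i)\<^sup>2) \<partial>lborel) \<le> mass N U"
          unfolding mass_sum[OF U] using i by (intro member_le_sum) auto
        also have "emeasure lborel (ball x0 r) + mass N U \<le> ennreal \<omega> + ennreal A" by (intro add_mono vol A)
        finally have *: "(\<integral>\<^sup>+x. ennreal (g x) \<partial>lborel) \<le> ennreal (\<omega> + A)"
          using \<omega> A by (simp add: add_left_mono)
        have 0: "0 \<le> \<omega> + A" using \<omega> A by simp
        have m': "(\<lambda>x. U x i) \<in> borel_measurable lborel" "(\<lambda>x. \<bar>U x i\<bar>) \<in> borel_measurable lborel" by simp_all
        show "integrable lborel (\<lambda>x. U x i)"
          by (rule integrable_dominated(1)[OF m'(1) AE_I2[OF le] * 0])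
        show "(\<integral>x. \<bar>U x i\<bar> \<partial>lborel) \<le> \<omega> + A"
          using integrable_dominated(2)[OF m'(2) _ * 0] le by simp
      qed
      define Q where "Q i \<phi> \<longleftrightarrow> \<phi> \<in> borel_measurable borel \<and> (\<forall>x. x \<notin> ball x0 r \<longrightarrow> \<phi> x = (0::real))
         \<and> (\<forall>x. \<bar>\<phi> x\<bar> \<le> L0 / \<rho> ^ CARD('n) * (\<integral>x. \<bar>U x i\<bar> \<partial>lborel))
         \<and> (\<forall>x y. \<bar>\<phi> x - \<phi> y\<bar> \<le> 2 * L0 / \<rho> ^ Suc CARD('n) * (\<integral>x. \<bar>U x i\<bar> \<partial>lborel) * norm (x - y))
         \<and> (\<integral>\<^sup>+x. ennreal ((U x i - \<phi> x)\<^sup>2) \<partial>lborel) \<le> ennreal (L0 * \<rho> powr (2 * s)) * gagl UNIV s (\<lambda>x. U x i)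
         \<and> gagl UNIV s \<phi> \<le> 4 * gagl UNIV s (\<lambda>x. U x i)" for i \<phi>
      have "\<exists>\<phi>. Q i \<phi>" if "i < N" for i
        using ap[OF s \<rho>(1,2) vborelD[OF U that] int(1)[OF that], of x0] U0 that unfolding Q_def Bex_def by simp
      then obtain \<psi> where Q: "\<And>i. i < N \<Longrightarrow> Q i (\<psi> i)" by metis
      have \<psi>m: "\<psi> i \<in> borel_measurable borel"
        and \<psi>0: "x \<notin> ball x0 r \<Longrightarrow> \<psi> i x = (0::real)"
        and \<psi>b: "\<bar>\<psi> i x\<bar> \<le> L0 / \<rho> ^ CARD('n) * (\<integral>x. \<bar>U x i\<bar> \<partial>lborel)"
        and \<psi>l: "\<bar>\<psi> i x - \<psi> i y\<bar> \<le> 2 * L0 / \<rho> ^ Suc CARD('n) * (\<integral>x. \<bar>U x i\<bar> \<partial>lborel) * norm (x - y)"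
        and \<psi>e: "(\<integral>\<^sup>+x. ennreal ((U x i - \<psi> i x)\<^sup>2) \<partial>lborel) \<le> ennreal (L0 * \<rho> powr (2 * s)) * gagl UNIV s (\<lambda>x. U x i)"
        and \<psi>g: "gagl UNIV s (\<psi> i) \<le> 4 * gagl UNIV s (\<lambda>x. U x i)" if "i < N" for i x y
        using Q[OF that] unfolding Q_def by simp_all
      define \<Phi> where "\<Phi> x i = \<psi> i x" for x i
      define B where "B = L * (\<omega> + A) / \<rho> ^ Suc CARD('n)"
      have \<Phi>m: "vborel N \<Phi>" using \<psi>m by (simp add: vborel_def \<Phi>_def)
      \<comment> \<open>As \<open>\<rho> \<le> 1\<close>, the bound on the values may be worsened to
        the power of the Lipschitz bound, so that one \<open>B\<close> serves for both.\<close>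
      have pow: "\<rho> ^ Suc CARD('n) \<le> \<rho> ^ CARD('n)" using \<rho> by (intro power_decreasing) auto
      have b: "2 * \<bar>\<Phi> x i\<bar> \<le> B" if i: "i < N" for x i
      proof -
        have "\<bar>\<Phi> x i\<bar> \<le> L0 / \<rho> ^ CARD('n) * (\<omega> + A)"
          unfolding \<Phi>_def using \<rho> L0 by (intro order_trans[OF \<psi>b[OF i]] mult_left_mono int i) auto
        also have "\<dots> \<le> L0 / \<rho> ^ Suc CARD('n) * (\<omega> + A)"
          using L0 \<rho> pow \<omega> A by (intro mult_right_mono divide_left_mono) auto
        finally show ?thesis by (simp add: B_def L_def)
      qed
      have l: "\<bar>\<Phi> x i - \<Phi> y i\<bar> \<le> B * norm (x - y)" if i: "i < N" for x y i
      proof -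
        have "\<bar>\<Phi> x i - \<Phi> y i\<bar> \<le> 2 * L0 / \<rho> ^ Suc CARD('n) * (\<omega> + A) * norm (x - y)"
          unfolding \<Phi>_def using \<rho> L0 by (intro order_trans[OF \<psi>l[OF i]] mult_left_mono mult_right_mono int i) auto
        then show ?thesis by (simp add: B_def L_def)
      qed
      have B0: "0 \<le> B" using L \<omega> A \<rho> by (simp add: B_def)
      \<comment> \<open>Up to distance 1 the Lipschitz bound is stronger than the Hoelder bound;
        beyond it, twice the supremum suffices.\<close>
      have h: "\<bar>\<Phi> x i - \<Phi> y i\<bar> \<le> B * norm (x - y) powr t" if i: "i < N" for x y i
      proof (cases "norm (x - y) \<le> 1")
        case True
        show ?thesis
        proof (cases "x = y")
          case False
          have "norm (x - y) powr 1 \<le> norm (x - y) powr t"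
            using True t by (intro powr_mono') auto
          then have "B * norm (x - y) \<le> B * norm (x - y) powr t" using B0 False by (intro mult_left_mono) auto
          then show ?thesis using l[OF i, of x y] by simp
        qed simp
      next
        case False
        have "\<bar>\<Phi> x i - \<Phi> y i\<bar> \<le> B" using b[OF i, of x] b[OF i, of y] by linarith
        also have "\<dots> \<le> B * norm (x - y) powr t"
          using False t B0 by (intro mult_le_cancel_left1[THEN iffD2]) (auto simp: ge_one_powr_ge_zero)
        finally show ?thesis .
      qed
      have "vborel N \<Phi>" by (rule \<Phi>m)
      moreover have "\<forall>x i. x \<notin> ball x0 r \<longrightarrow> i < N \<longrightarrow> \<Phi> x i = 0" using \<psi>0 by (simp add: \<Phi>_def)
      moreover have "vnorm N (\<Phi> x) \<le> real N * B" for x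
      proof -
        have "(\<Sum>i<N. \<bar>\<Phi> x i\<bar>) \<le> (\<Sum>i<N. B)"
          using b[of _ x] B0 by (intro sum_mono) (smt (verit) lessThan_iff)
        then show ?thesis using vnorm_le_sum[of N "\<Phi> x"] by simp
      qed
      moreover have "vnorm N (\<Phi> x - \<Phi> y) \<le> real N * B * norm (x - y) powr t" for x y
      proof -
        have "(\<Sum>i<N. \<bar>(\<Phi> x - \<Phi> y) i\<bar>) \<le> (\<Sum>i<N. B * norm (x - y) powr t)"
          using h by (intro sum_mono) auto
        then show ?thesis using vnorm_le_sum[of N "\<Phi> x - \<Phi> y"] by simp
      qed
      moreover have "mass N (U - \<Phi>) \<le> ennreal (L * \<rho> powr (2 * s)) * energy N s UNIV U"
      proof -
        have "mass N (U - \<Phi>) \<le> (\<Sum>i<N. ennreal (L0 * \<rho> powr (2 * s)) * gagl UNIV s (\<lambda>x. U x i))"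
          unfolding mass_sum[OF vborel_diff[OF U \<Phi>m]] using \<psi>e by (intro sum_mono) (simp add: \<Phi>_def)
        also have "\<dots> = ennreal (L0 * \<rho> powr (2 * s)) * energy N s UNIV U"
          by (simp add: energy_sum[OF U] sum_distrib_left)
        also have "\<dots> \<le> ennreal (L * \<rho> powr (2 * s)) * energy N s UNIV U"
          using L0 by (intro mult_right_mono ennreal_leI) (auto simp: L_def)
        finally show ?thesis .
      qed
      moreover have "energy N s UNIV \<Phi> \<le> 4 * energy N s UNIV U"
        unfolding energy_sum[OF U borel_open[OF open_UNIV]] energy_sum[OF \<Phi>m borel_open[OF open_UNIV]] sum_distrib_left
        using \<psi>g by (intro sum_mono) (simp add: \<Phi>_def)
      ultimately show "\<exists>\<Phi>. vborel N \<Phi> \<and> (\<forall>x i. x \<notin> ball x0 r \<longrightarrow> i < N \<longrightarrow> \<Phi> x i = 0) \<and> (\<exists>M. \<forall>x. vnorm N (\<Phi> x) \<le> M)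
         \<and> (\<forall>x y. vnorm N (\<Phi> x - \<Phi> y)
              \<le> real N * (L * (unit_ball_vol (real CARD('n)) + A) / \<rho> ^ Suc CARD('n)) * norm (x - y) powr t)
         \<and> mass N (U - \<Phi>) \<le> ennreal (L * \<rho> powr (2 * s)) * energy N s UNIV U
         \<and> energy N s UNIV \<Phi> \<le> 4 * energy N s UNIV U"
        unfolding B_def \<omega>_def by blast
    qed
qed
qed

lemma bil_add_right:
  "bil N s a V (\<lambda>x i. U x i + W x i) z = bil N s a V U z + bil N s a V W z"
  by (simp add: bil_def vinner_def add_divide_distrib[symmetric] sum.distrib[symmetric] algebra_simps)

lemma vinner_add_right: "vinner N \<xi> (\<lambda>i. \<eta> i + \<zeta> i) = vinner N \<xi> \<eta> + vinner N \<xi> \<zeta>"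
  by (simp add: vinner_def sum.distrib distrib_left)

text \<open>The coefficient of \<open>\<rho> powr m\<close> in the defect of the remainder: the
  first line collects the source, the second the nonlocal form.\<close>

definition defect_const :: "(real ^ 'n) itself \<Rightarrow> real \<Rightarrow> real \<Rightarrow> real \<Rightarrow> real \<Rightarrow> real" where
  "defect_const _ s \<Lambda> c L = (let M = energy_const TYPE(real ^ 'n) s \<Lambda> c in
     (c\<^sup>2 * unit_ball_vol (real CARD('n)) + L * M) / 2
     + \<Lambda> / 2 * (c\<^sup>2 + 10 * M + (c\<^sup>2 + 4 * far_const TYPE(real ^ 'n) s * L * M)))"

text \<open>The smallness hypothesis enters through an abstract \<open>\<kappa>\<close> and explicit
  Hoelder constants \<open>H\<close>, and \<open>\<rho>\<close> is left free, so that the scale can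
  be adapted to \<epsilon> afterwards. The restriction \<open>\<rho> \<le> 1/32\<close> puts the
  scale below every admissible radius.\<close>

lemma near_solution_estimate:
  "\<exists>L>0. \<forall>N (V :: real ^ 'n \<Rightarrow> nat \<Rightarrow> real) W G \<Lambda> a s \<delta> c x0 r (\<rho> :: real) t \<kappa>.
    vborel N V \<longrightarrow> vborel N W \<longrightarrow> vborel N G \<longrightarrow>
    (\<forall>\<xi>. (vnorm N \<xi>)\<^sup>2 / \<Lambda> \<le> vinner N (mat_app N a \<xi>) \<xi>) \<longrightarrow> 1 \<le> \<Lambda> \<longrightarrow> mat_norm N a \<le> \<Lambda> \<longrightarrow>
    energy N s UNIV W < \<infinity> \<longrightarrow> 0 < s \<longrightarrow> s \<le> 1 \<longrightarrow> 0 < \<delta> \<longrightarrow> 0 \<le> t \<longrightarrow> t \<le> 1 \<longrightarrow> 1/32 < r \<longrightarrow> r < 1 \<longrightarrow>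
    (\<forall>x i. x \<notin> ball x0 r \<longrightarrow> i < N \<longrightarrow> W x i = 0) \<longrightarrow>
    (AE x in lborel. vnorm N (G x) \<le> c) \<longrightarrow> 0 \<le> c \<longrightarrow>
    energy N s UNIV V \<le> ennreal (c\<^sup>2) \<longrightarrow> energy N (s + \<delta>) UNIV V \<le> ennreal (c\<^sup>2) \<longrightarrow>
    (\<integral>z. bil N s a V W z \<partial>lborel) + (\<integral>z. bil N s a W W z \<partial>lborel)
      = (\<integral>x. vinner N (G x) (W x) \<partial>lborel) \<longrightarrow>
    0 < \<rho> \<longrightarrow> \<rho> \<le> 1/32 \<longrightarrow>
    (\<forall>\<Phi> H. vborel N \<Phi> \<longrightarrow> (\<forall>x i. x \<notin> ball x0 r \<longrightarrow> i < N \<longrightarrow> \<Phi> x i = 0) \<longrightarrow>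
       (\<exists>M. \<forall>x. vnorm N (\<Phi> x) \<le> M) \<longrightarrow> 0 \<le> H \<longrightarrow>
       (\<forall>x y. vnorm N (\<Phi> x - \<Phi> y) \<le> H * norm (x - y) powr t) \<longrightarrow>
       \<bar>(\<integral>z. bil N s a V \<Phi> z \<partial>lborel) - (\<integral>x. vinner N (G x) (\<Phi> x) \<partial>lborel)\<bar> \<le> \<kappa> * H) \<longrightarrow>
    energy N s UNIV W \<le> ennreal (\<Lambda> * (\<kappa> * (real N * (L * (unit_ball_vol (real CARD('n))
        + poincare_const TYPE(real ^ 'n) s * energy_const TYPE(real ^ 'n) s \<Lambda> c) / \<rho> ^ Suc CARD('n)))
      + defect_const TYPE(real ^ 'n) s \<Lambda> c L * \<rho> powr (min s \<delta> / 2)))"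
proof -
  from vector_approximation[where 'n='n] show ?thesis
  proof (elim exE conjE, goal_cases)
    case (1 L)
    note L = 1(1) and ap = 1(2)[rule_format]
    show ?case
    proof (intro exI[of _ L] conjI allI impI L)
      fix N and V W G :: "real ^ 'n \<Rightarrow> nat \<Rightarrow> real" and \<Lambda> a s \<delta> c x0 r and \<rho> :: real and t \<kappa>
      assume V: "vborel N V" and W: "vborel N W" and G: "vborel N G"
        and ell: "\<forall>\<xi>. (vnorm N \<xi>)\<^sup>2 / \<Lambda> \<le> vinner N (mat_app N a \<xi>) \<xi>" and \<Lambda>: "1 \<le> \<Lambda>" and a: "mat_norm N a \<le> \<Lambda>"
        and fin: "energy N s UNIV W < \<infinity>" and s: "0 < s" "s \<le> 1" and \<delta>: "0 < \<delta>" and t: "0 \<le> t" "t \<le> 1"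
        and r: "1/32 < r" "r < 1" and W0: "\<forall>x i. x \<notin> ball x0 r \<longrightarrow> i < N \<longrightarrow> W x i = 0"
        and c: "AE x in lborel. vnorm N (G x) \<le> c" "0 \<le> c"
        and v: "energy N s UNIV V \<le> ennreal (c\<^sup>2)" and v1: "energy N (s + \<delta>) UNIV V \<le> ennreal (c\<^sup>2)"
        and id: "(\<integral>z. bil N s a V W z \<partial>lborel) + (\<integral>z. bil N s a W W z \<partial>lborel) = (\<integral>x. vinner N (G x) (W x) \<partial>lborel)"
        and \<rho>: "0 < \<rho>" "\<rho> \<le> 1/32"
        and near: "\<forall>\<Phi> H. vborel N \<Phi> \<longrightarrow> (\<forall>x i. x \<notin> ball x0 r \<longrightarrow> i < N \<longrightarrow> \<Phi> x i = 0) \<longrightarrow>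
         (\<exists>M. \<forall>x. vnorm N (\<Phi> x) \<le> M) \<longrightarrow> 0 \<le> H \<longrightarrow>
         (\<forall>x y. vnorm N (\<Phi> x - \<Phi> y) \<le> H * norm (x - y) powr t) \<longrightarrow>
         \<bar>(\<integral>z. bil N s a V \<Phi> z \<partial>lborel) - (\<integral>x. vinner N (G x) (\<Phi> x) \<partial>lborel)\<bar> \<le> \<kappa> * H"
      define M where "M = energy_const TYPE(real ^ 'n) s \<Lambda> c"
      define P where "P = poincare_const TYPE(real ^ 'n) s"
      define \<omega> where "\<omega> = unit_ball_vol (real CARD('n))"
      define T where "T = far_const TYPE(real ^ 'n) s"
      have \<omega>: "0 \<le> \<omega>" by (simp add: \<omega>_def)
      have P: "0 < P" unfolding P_def by (rule poincare_const_pos)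
      have T: "0 \<le> T" unfolding T_def by (rule far_const_nonneg[OF s(1)])
      have M: "0 \<le> M" using \<Lambda> P \<omega> by (simp add: M_def energy_const_def P_def \<omega>_def)
      note ee = energy_estimate[OF V W G ell[rule_format] \<Lambda> a fin s(1) r W0[rule_format] c v id, folded M_def P_def]
      have EW: "energy N s UNIV W \<le> ennreal M" using ee by blast
      have mW: "mass N W \<le> ennreal (P * M)"
        using order_trans[OF ee(2) mult_left_mono[OF EW]] P M by (simp add: ennreal_mult)
      define H where "H = real N * (L * (\<omega> + P * M) / \<rho> ^ Suc CARD('n))"
      have H: "0 \<le> H" using L \<omega> P M \<rho> by (simp add: H_def)
      have "\<rho> \<le> r" "r \<le> 1" "0 \<le> P * M" using \<rho> r P M by auto
      from ap[OF s \<rho>(1) this(1,2) t W W0[rule_format] mW this(3), folded \<omega>_def, folded H_def]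
      obtain \<Phi> where \<Phi>: "vborel N \<Phi>" and \<Phi>0: "\<forall>x i. x \<notin> ball x0 r \<longrightarrow> i < N \<longrightarrow> \<Phi> x i = 0"
        and \<Phi>b: "\<exists>M. \<forall>x. vnorm N (\<Phi> x) \<le> M"
        and \<Phi>h: "\<forall>x y. vnorm N (\<Phi> x - \<Phi> y) \<le> H * norm (x - y) powr t"
        and \<Phi>m: "mass N (W - \<Phi>) \<le> ennreal (L * \<rho> powr (2 * s)) * energy N s UNIV W"
        and \<Phi>e: "energy N s UNIV \<Phi> \<le> 4 * energy N s UNIV W"
        by blast
      define U where "U = W - \<Phi>"
      have U: "vborel N U" unfolding U_def by (rule vborel_diff[OF W \<Phi>])
      have U0: "\<And>x i. x \<notin> ball x0 r \<Longrightarrow> i < N \<Longrightarrow> U x i = 0" using W0 \<Phi>0 by (simp add: U_def)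
      have WU: "W = (\<lambda>x i. \<Phi> x i + U x i)" by (simp add: U_def fun_eq_iff)
      have e\<Phi>: "energy N s UNIV \<Phi> \<le> ennreal (4 * M)"
        using order_trans[OF \<Phi>e mult_left_mono[OF EW]] M by (simp add: ennreal_mult)
      \<comment> \<open>The energy of the remainder is merely bounded, not small: 10 is twice
        \<open>1 + 4\<close>. All smallness has to come from its mass and from the regularity of
        \<open>V\<close>.\<close>
      have eU: "energy N s UNIV U \<le> ennreal (10 * M)"
      proof -
        have "energy N s UNIV U \<le> 2 * energy N s UNIV W + 2 * energy N s UNIV \<Phi>"
          by (intro energy_add_le W \<Phi>) (auto simp: U_def)
        also have "\<dots> \<le> 2 * ennreal M + 2 * ennreal (4 * M)" by (intro add_mono mult_left_mono EW e\<Phi>) auto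
        also have "\<dots> = ennreal (2 * M + 2 * (4 * M))" using M by (simp add: ennreal_mult flip: distrib_right)
        finally show ?thesis by simp
      qed
      define l where "l = L * \<rho> powr (2 * s) * M"
      have l0: "0 \<le> l" using L M by (simp add: l_def)
      have lU: "mass N U \<le> ennreal l"
        unfolding U_def using order_trans[OF \<Phi>m mult_left_mono[OF EW]] L M by (simp add: l_def ennreal_mult)
      \<comment> \<open>Finiteness is enough here: it justifies splitting the source integral into
        its two parts.\<close>
      have l\<Phi>: "mass N \<Phi> < \<infinity>"
      proof -
        have "mass N \<Phi> \<le> (\<integral>\<^sup>+x. 2 * ennreal ((vnorm N (W x))\<^sup>2) + 2 * ennreal ((vnorm N (U x))\<^sup>2) \<partial>lborel)"
          unfolding mass_def
        proof (rule nn_integral_mono)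
          fix x
          have "(vnorm N (\<Phi> x))\<^sup>2 \<le> 2 * (vnorm N (W x))\<^sup>2 + 2 * (vnorm N (U x))\<^sup>2"
            by (intro vnorm_add_power2_le) (simp add: U_def)
          then have "ennreal ((vnorm N (\<Phi> x))\<^sup>2) \<le> ennreal (2 * (vnorm N (W x))\<^sup>2 + 2 * (vnorm N (U x))\<^sup>2)"
            by (rule ennreal_leI)
          then show "ennreal ((vnorm N (\<Phi> x))\<^sup>2) \<le> 2 * ennreal ((vnorm N (W x))\<^sup>2) + 2 * ennreal ((vnorm N (U x))\<^sup>2)"
            by (simp add: ennreal_mult)
        qed
        also have "\<dots> = 2 * mass N W + 2 * mass N U"
          using measurable_vnorm[OF W] measurable_vnorm[OF U]
          by (simp add: nn_integral_add nn_integral_cmult mass_def)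
        also have "\<dots> < \<infinity>" using mW lU by (auto simp: ennreal_mult_less_top intro: le_less_trans)
        finally show ?thesis .
      qed
      then obtain l' where l': "mass N \<Phi> \<le> ennreal l'" "0 \<le> l'" by (cases "mass N \<Phi>") auto
      note iV = bil_estimate(1)[OF V _ a zero_less_one v zero_le_power2]
      have 1: "(\<integral>z. bil N s a V W z \<partial>lborel) = (\<integral>z. bil N s a V \<Phi> z \<partial>lborel) + (\<integral>z. bil N s a V U z \<partial>lborel)"
        unfolding WU bil_add_right using M
        by (intro Bochner_Integration.integral_add iV[OF \<Phi> e\<Phi>] iV[OF U eU]) auto
      have r': "r \<le> 1" "0 < r" using r by auto
      have 2: "(\<integral>x. vinner N (G x) (W x) \<partial>lborel) = (\<integral>x. vinner N (G x) (\<Phi> x) \<partial>lborel) + (\<integral>x. vinner N (G x) (U x) \<partial>lborel)"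
        unfolding WU vinner_add_right
        by (intro Bochner_Integration.integral_add
          source_estimate(1)[OF G \<Phi> zero_less_one r' \<Phi>0[rule_format] c l']
          source_estimate(1)[OF G U zero_less_one r' U0 c lU l0])
      have 3: "\<bar>(\<integral>z. bil N s a V \<Phi> z \<partial>lborel) - (\<integral>x. vinner N (G x) (\<Phi> x) \<partial>lborel)\<bar> \<le> \<kappa> * H"
        using near \<Phi> \<Phi>0 \<Phi>b H \<Phi>h by blast
      define m where "m = min s \<delta> / 2"
      have pm: "\<rho> powr b \<le> \<rho> powr m" if "m \<le> b" for b
        using \<rho> that by (intro powr_mono') auto
      \<comment> \<open>The weight \<open>\<rho> powr s\<close> balances the two terms, since the
        mass of \<open>U\<close> is of order \<open>\<rho> powr (2 * s)\<close>.\<close>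
      have 4: "\<bar>\<integral>x. vinner N (G x) (U x) \<partial>lborel\<bar> \<le> (c\<^sup>2 * \<omega> + L * M) / 2 * \<rho> powr m"
      proof -
        have "\<bar>\<integral>x. vinner N (G x) (U x) \<partial>lborel\<bar> \<le> (\<rho> powr s * (c\<^sup>2 * \<omega>) + l / \<rho> powr s) / 2"
          unfolding \<omega>_def using \<rho> by (intro source_estimate(2)[OF G U _ r' U0 c lU l0]) auto
        also have "l / \<rho> powr s = \<rho> powr s * (L * M)"
        proof -
          have "\<rho> powr (2 * s) = \<rho> powr s * \<rho> powr s" by (simp add: powr_add[symmetric])
          then show ?thesis using \<rho> by (simp add: l_def)
        qed
        also have "(\<rho> powr s * (c\<^sup>2 * \<omega>) + \<rho> powr s * (L * M)) / 2 = (c\<^sup>2 * \<omega> + L * M) / 2 * \<rho> powr s"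
          by (simp add: field_simps)
        also have "\<dots> \<le> (c\<^sup>2 * \<omega> + L * M) / 2 * \<rho> powr m"
          using \<omega> L M s \<delta> by (intro mult_left_mono pm) (auto simp: m_def)
        finally show ?thesis .
      qed
      have 5: "\<bar>\<integral>z. bil N s a V U z \<partial>lborel\<bar> \<le> \<Lambda> / 2 * (c\<^sup>2 + 10 * M + (c\<^sup>2 + 4 * T * L * M)) * \<rho> powr m"
      proof -
        \<comment> \<open>With the cut at \<open>\<rho> powr (1/2)\<close> the near part is of order
          \<open>\<rho> powr (\<delta> / 2)\<close>. The far part has kernel factor
          \<open>\<rho> powr (- s)\<close> and mass \<open>\<rho> powr (2 * s)\<close>; the weight
          \<open>\<rho> powr (s / 2)\<close> balances its two terms at that same order.\<close>
        define \<theta> where "\<theta> = \<rho> powr (1/2)"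
        define \<tau> where "\<tau> = \<rho> powr (s/2)"
        have \<theta>: "0 < \<theta>" and \<tau>: "0 < \<tau>" using \<rho> by (auto simp: \<theta>_def \<tau>_def)
        have M10: "0 \<le> 10 * M" using M by simp
        have "\<bar>\<integral>z. bil N s a V U z \<partial>lborel\<bar>
          \<le> \<Lambda> / 2 * (\<theta> powr \<delta> * (c\<^sup>2 + 10 * M) + (\<tau> * c\<^sup>2 + 4 * T * \<theta> powr (- 2 * s) * l / \<tau>))"
          unfolding T_def by (rule bil_estimate_split[OF V U a \<tau> s(1) \<delta> \<theta> v zero_le_power2 v1 eU M10 lU l0])
        also have "4 * T * \<theta> powr (- 2 * s) * l / \<tau> = \<rho> powr (s/2) * (4 * T * L * M)"
        proof -
          have t: "\<theta> powr (- 2 * s) = \<rho> powr (- s)" by (simp add: \<theta>_def powr_powr)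
          have p: "\<rho> powr (- s) * \<rho> powr (2 * s) / \<rho> powr (s/2) = \<rho> powr (s/2)"
            by (simp add: powr_add[symmetric] powr_diff[symmetric])
          have "4 * T * \<theta> powr (- 2 * s) * l / \<tau>
              = \<rho> powr (- s) * \<rho> powr (2 * s) / \<rho> powr (s/2) * (4 * T * L * M)"
            unfolding t l_def \<tau>_def by simp
          then show ?thesis unfolding p .
        qed
        also have "\<Lambda> / 2 * (\<theta> powr \<delta> * (c\<^sup>2 + 10 * M) + (\<tau> * c\<^sup>2 + \<rho> powr (s/2) * (4 * T * L * M)))
          \<le> \<Lambda> / 2 * (\<rho> powr m * (c\<^sup>2 + 10 * M) + (\<rho> powr m * c\<^sup>2 + \<rho> powr m * (4 * T * L * M)))"
        proof -
          have "\<theta> powr \<delta> = \<rho> powr (\<delta>/2)" by (simp add: \<theta>_def powr_powr)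
          then have "\<theta> powr \<delta> \<le> \<rho> powr m" using pm[of "\<delta>/2"] by (simp add: m_def)
          moreover have "\<rho> powr (s/2) \<le> \<rho> powr m" by (intro pm) (simp add: m_def)
          ultimately show ?thesis unfolding \<tau>_def
            using \<Lambda> M T L by (intro mult_left_mono add_mono mult_right_mono) auto
        qed
        also have "\<dots> = \<Lambda> / 2 * (c\<^sup>2 + 10 * M + (c\<^sup>2 + 4 * T * L * M)) * \<rho> powr m"
          by (simp add: algebra_simps)
        finally show ?thesis .
      qed
      have D: "defect_const TYPE(real ^ 'n) s \<Lambda> c L * \<rho> powr m = (c\<^sup>2 * \<omega> + L * M) / 2 * \<rho> powr m
         + \<Lambda> / 2 * (c\<^sup>2 + 10 * M + (c\<^sup>2 + 4 * T * L * M)) * \<rho> powr m"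
        by (simp add: defect_const_def M_def[symmetric] \<omega>_def[symmetric] T_def[symmetric] Let_def distrib_right)
      have "(\<integral>z. bil N s a W W z \<partial>lborel) \<le> \<kappa> * H + defect_const TYPE(real ^ 'n) s \<Lambda> c L * \<rho> powr m"
        unfolding D using id 1 2 3 4 5 by linarith
      then have "\<Lambda> * (\<integral>z. bil N s a W W z \<partial>lborel) \<le> \<Lambda> * (\<kappa> * H + defect_const TYPE(real ^ 'n) s \<Lambda> c L * \<rho> powr m)"
        using \<Lambda> by (intro mult_left_mono) auto
      moreover have "energy N s UNIV W \<le> ennreal (\<Lambda> * (\<integral>z. bil N s a W W z \<partial>lborel))"
        using \<Lambda> ell by (intro energy_le_bil[OF W _ _ a fin]) auto
      ultimately show "energy N s UNIV W \<le> ennreal (\<Lambda> * (\<kappa> * (real N * (L * (unit_ball_vol (real CARD('n))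
          + poincare_const TYPE(real ^ 'n) s * energy_const TYPE(real ^ 'n) s \<Lambda> c) / \<rho> ^ Suc CARD('n)))
        + defect_const TYPE(real ^ 'n) s \<Lambda> c L * \<rho> powr (min s \<delta> / 2)))"
        unfolding H_def M_def P_def \<omega>_def m_def by (meson ennreal_leI order_trans)
    qed
qed
qed

section \<open>Borel representatives\<close>

lemma ennreal_sqrt_le: "X \<le> ennreal (c\<^sup>2) \<Longrightarrow> 0 \<le> c \<Longrightarrow> ennreal_sqrt X \<le> ennreal c"
  by (cases X) (auto simp: ennreal_sqrt_def top_unique intro!: ennreal_leI real_le_lsqrt)

lemma ennreal_sqrt_leD: "ennreal_sqrt X \<le> ennreal c \<Longrightarrow> 0 \<le> c \<Longrightarrow> X \<le> ennreal (c\<^sup>2)"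
  by (cases X) (auto simp: ennreal_sqrt_def top_unique ennreal_le_iff intro!: ennreal_leI dest: sqrt_le_D)

lemma ennreal_sqrt_finite_iff: "ennreal_sqrt X < \<infinity> \<longleftrightarrow> X < \<infinity>"
  by (cases X) (auto simp: ennreal_sqrt_def)

lemma ennreal_sqrt_less: "X \<le> ennreal x \<Longrightarrow> 0 \<le> x \<Longrightarrow> x < c\<^sup>2 \<Longrightarrow> 0 < c \<Longrightarrow> ennreal_sqrt X < ennreal c"
proof -
  assume X: "X \<le> ennreal x" "0 \<le> x" "x < c\<^sup>2" "0 < c"
  have "ennreal_sqrt X \<le> ennreal (sqrt x)" using X by (intro ennreal_sqrt_le) auto
  also have "\<dots> < ennreal c" using X by (intro ennreal_lessI) (auto intro: real_less_lsqrt)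
  finally show ?thesis .
qed

definition vae :: "nat \<Rightarrow> (real ^ 'n \<Rightarrow> nat \<Rightarrow> real) \<Rightarrow> (real ^ 'n \<Rightarrow> nat \<Rightarrow> real) \<Rightarrow> bool" where
  "vae N v V \<longleftrightarrow> (AE x in lborel. \<forall>i<N. v x i = V x i)"

lemma borel_representative:
  assumes "vmeasurable_on N UNIV v"
  obtains V where "vborel N V" "vae N v V"
proof -
  have "\<exists>g\<in>borel_measurable lborel. AE x in lborel. v x i = g x" if "i < N" for i
    using assms that by (intro completion_ex_borel_measurable_real) (auto simp: vmeasurable_on_def)
  then obtain g where g: "\<And>i. i < N \<Longrightarrow> g i \<in> borel_measurable lborel \<and> (AE x in lborel. v x i = g i x)"
    by metis
  have "AE x in lborel. \<forall>i\<in>{..<N}. v x i = g i x"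
    using g by (intro AE_finite_allI) auto
  then show thesis
    using g by (intro that[of "\<lambda>x i. g i x"]) (auto simp: vborel_def vae_def)
qed

text \<open>An exceptional null set \<open>S\<close> becomes the cylinder
  \<open>S \<times> UNIV\<close>, of measure zero times infinity, hence zero. Almost everywhere
  equality of functions thus passes to the pairs in the double integrals.\<close>

lemma AE_lborel_fst:
  assumes "AE x in lborel. P (x :: 'a::euclidean_space)"
  shows "AE z in (lborel :: ('a \<times> 'b::euclidean_space) measure). P (fst z)"
proof -
  obtain S where S: "{x. \<not> P x} \<subseteq> S" "S \<in> sets lborel" "emeasure lborel S = 0"
    using assms by (auto elim!: AE_E)
  have "S \<times> (UNIV :: 'b set) \<in> null_sets lborel"
  proof (rule null_setsI)
    have s: "S \<times> (UNIV :: 'b set) \<in> sets (lborel \<Otimes>\<^sub>M lborel)" using S by (intro pair_measureI) auto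
    then show "S \<times> (UNIV :: 'b set) \<in> sets lborel" unfolding lborel_prod .
    show "emeasure lborel (S \<times> (UNIV :: 'b set)) = 0"
      unfolding lborel_prod[symmetric] using S by (subst lborel.emeasure_pair_measure_Times) auto
  qed
  then show ?thesis by (rule AE_I') (use S in auto)
qed

lemma AE_lborel_snd:
  assumes "AE x in lborel. P (x :: 'b::euclidean_space)"
  shows "AE z in (lborel :: ('a::euclidean_space \<times> 'b) measure). P (snd z)"
proof -
  obtain S where S: "{x. \<not> P x} \<subseteq> S" "S \<in> sets lborel" "emeasure lborel S = 0"
    using assms by (auto elim!: AE_E)
  have "(UNIV :: 'a set) \<times> S \<in> null_sets lborel"
  proof (rule null_setsI)
    have s: "(UNIV :: 'a set) \<times> S \<in> sets (lborel \<Otimes>\<^sub>M lborel)" using S by (intro pair_measureI) auto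
    then show "(UNIV :: 'a set) \<times> S \<in> sets lborel" unfolding lborel_prod .
    show "emeasure lborel ((UNIV :: 'a set) \<times> S) = 0"
      unfolding lborel_prod[symmetric] using S by (subst lborel.emeasure_pair_measure_Times) auto
  qed
  then show ?thesis by (rule AE_I') (use S in auto)
qed

lemma L2_norm_vae:
  "vae N v V \<Longrightarrow> L2_norm N A v = ennreal_sqrt (\<integral>\<^sup>+x\<in>A. ennreal ((vnorm N (V x))\<^sup>2) \<partial>lborel)"
  unfolding L2_norm_def nn_integral_completion vae_def
  by (intro arg_cong[of _ _ ennreal_sqrt] nn_integral_cong_AE)
     (auto elim!: eventually_mono simp: vnorm_power2)

lemma vae_pair:
  assumes "vae N v V"
  shows "AE z in lborel. \<forall>i<N. v (fst z) i = V (fst z) i \<and> v (snd z) i = V (snd z) i"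
  using AE_lborel_fst[OF assms[unfolded vae_def]] AE_lborel_snd[OF assms[unfolded vae_def]]
  by eventually_elim auto

lemma gagliardo_vae:
  assumes "vae N v V"
  shows "gagliardo_seminorm N s A v = ennreal_sqrt (energy N s A V)"
  unfolding gagliardo_seminorm_def nn_integral_completion energy_def gdens_def
  using vae_pair[OF assms]
  by (intro arg_cong[of _ _ ennreal_sqrt] nn_integral_cong_AE)
     (auto elim!: eventually_mono simp: vnorm_power2)

text \<open>Completeness of Lebesgue measure makes \<open>f\<close> measurable, as it agrees almost
  everywhere with a Borel function; its integral is then that of the representative.\<close>

lemma integral_lebesgue_vae:
  fixes f F :: "'a::euclidean_space \<Rightarrow> real"
  assumes F: "F \<in> borel_measurable borel" and eq: "AE x in lborel. f x = F x"
  shows "integral\<^sup>L lebesgue f = (\<integral>x. F x \<partial>lborel)"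
proof -
  have Fm: "F \<in> borel_measurable lborel" using F by simp
  have ae: "AE x in lebesgue. F x = f x" using eq by (auto intro: AE_completion elim: eventually_mono)
  have m: "F \<in> borel_measurable lebesgue" using Fm by (rule measurable_completion)
  have "f \<in> borel_measurable lebesgue"
    using m ae by (rule borel_measurable_AE)
  then have "integral\<^sup>L lebesgue f = integral\<^sup>L lebesgue F"
    using m ae by (intro integral_cong_AE) (auto elim: eventually_mono)
  also have "\<dots> = (\<integral>x. F x \<partial>lborel)" by (rule integral_completion[OF Fm])
  finally show ?thesis .
qed

lemma nonlocal_form_vae:
  assumes "vae N v V" "vae N u U" "vborel N V" "vborel N U"
  shows "nonlocal_form N s a v u = (\<integral>z. bil N s a V U z \<partial>lborel)"
  unfolding nonlocal_form_def
proof (rule integral_lebesgue_vae[OF measurable_bil[OF assms(3,4)]])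
  show "AE z in lborel. vinner N (mat_app N a (v (fst z) - v (snd z))) (u (fst z) - u (snd z))
      / norm (fst z - snd z) powr (real CARD('a) + 2 * s) = bil N s a V U z"
    using vae_pair[OF assms(1)] vae_pair[OF assms(2)]
    by eventually_elim (auto simp: bil_def vinner_def mat_app_def)
qed

lemma source_vae:
  assumes "vae N g G" "vae N u U" "vborel N G" "vborel N U"
    and U0: "\<And>x i. x \<notin> B \<Longrightarrow> i < N \<Longrightarrow> U x i = 0"
  shows "(LINT x:B|lebesgue. vinner N (g x) (u x)) = (\<integral>x. vinner N (G x) (U x) \<partial>lborel)"
  unfolding set_lebesgue_integral_def
proof (rule integral_lebesgue_vae[OF measurable_vinner[OF assms(3,4)]])
  show "AE x in lborel. indicat_real B x *\<^sub>R vinner N (g x) (u x) = vinner N (G x) (U x)"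
    using assms(1,2)[unfolded vae_def]
  proof eventually_elim
    case (elim x)
    then show ?case using U0[of x] by (cases "x \<in> B") (auto simp: vinner_def)
  qed
qed

text \<open>Take \<open>\<rho> powr m\<close> proportional to the square of \<epsilon>, which
  settles the second summand. Then \<open>1 / \<rho> ^ k\<close> grows like \<epsilon> to the power
  \<open>- 2 * k / m\<close>, so the exponent \<open>q\<close> leaves exactly a square of
  \<epsilon>, and \<open>c\<close> absorbs the constants. Only \<open>k\<close> and \<open>m\<close>
  enter \<open>q\<close>; \<open>C\<close> and \<open>K\<close> affect \<open>c\<close>
  alone.\<close>

lemma choice_of_scale:
  fixes \<Lambda> C K m :: real and k :: nat
  assumes \<Lambda>: "1 \<le> \<Lambda>" and C: "0 \<le> C" and K: "0 \<le> K" and m: "0 < m"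
  defines "q \<equiv> 2 * real k / m + 2"
  shows "\<exists>c\<ge>1. \<forall>\<epsilon>. 0 < \<epsilon> \<longrightarrow> \<epsilon> < 1 \<longrightarrow> (\<exists>\<rho>. 0 < \<rho> \<and> \<rho> \<le> 1/32
     \<and> 0 \<le> \<Lambda> * ((\<epsilon> / c) powr q * (C / \<rho> ^ k) + K * \<rho> powr m)
     \<and> \<Lambda> * ((\<epsilon> / c) powr q * (C / \<rho> ^ k) + K * \<rho> powr m) < \<epsilon>\<^sup>2)"
proof -
  \<comment> \<open>The first entry makes the second summand at most a quarter of
    \<open>\<epsilon>\<^sup>2\<close>, the other one forces
    \<open>\<rho> \<le> 1/32\<close>.\<close>
  define D where "D = max (4 * \<Lambda> * K) (32 powr m)"
  have D: "0 < D" "4 * \<Lambda> * K \<le> D" "32 powr m \<le> D" by (auto simp: D_def less_max_iff_disj)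
  define E where "E = \<Lambda> * C * D powr (real k / m)"
  have E: "0 \<le> E" using \<Lambda> C by (simp add: E_def)
  \<comment> \<open>As \<open>q \<ge> 1\<close> and \<open>c \<ge> 1\<close>, already
    \<open>c powr q \<ge> c \<ge> 4 * E\<close>, which leaves a quarter of
    \<open>\<epsilon>\<^sup>2\<close> for the first summand.\<close>
  define c where "c = max 1 (4 * E)"
  have c: "1 \<le> c" "4 * E \<le> c" by (auto simp: c_def)
  have q: "1 \<le> q" using m by (simp add: q_def)
  show ?thesis
  proof (rule exI[of _ c], intro conjI allI impI c(1))
    fix \<epsilon> :: real assume \<epsilon>: "0 < \<epsilon>" "\<epsilon> < 1"
    define y where "y = \<epsilon>\<^sup>2 / D"
    have y: "0 < y" using \<epsilon> D by (simp add: y_def)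
    define \<rho> where "\<rho> = y powr (1 / m)"
    have \<rho>: "0 < \<rho>" using y by (simp add: \<rho>_def)
    have \<rho>m: "\<rho> powr m = y" using m y by (simp add: \<rho>_def powr_powr)
    have "y \<le> 1 / D" unfolding y_def using \<epsilon> D by (intro divide_right_mono) (auto simp: power_le_one)
    also have "\<dots> \<le> 1 / 32 powr m" using D by (intro divide_left_mono) auto
    also have "\<dots> = (1/32) powr m" by (simp add: powr_divide)
    finally have "\<rho> powr m \<le> (1/32) powr m" by (simp add: \<rho>m)
    then have \<rho>32: "\<rho> \<le> 1/32" using m \<rho> powr_less_mono2[of m "1/32" \<rho>] by (meson not_less zero_le_divide_1_iff zero_le_numeral)
    have 1: "\<Lambda> * (K * \<rho> powr m) \<le> \<epsilon>\<^sup>2 / 4"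
    proof -
      have "4 * \<Lambda> * K * y \<le> D * y" using D y by (intro mult_right_mono) auto
      also have "D * y = \<epsilon>\<^sup>2" using D by (simp add: y_def)
      finally show ?thesis by (simp add: \<rho>m)
    qed
    have \<rho>k: "\<rho> ^ k = \<epsilon> powr (2 * real k / m) / D powr (real k / m)"
    proof -
      have "\<rho> ^ k = y powr (real k / m)" using \<rho> by (simp add: \<rho>_def powr_powr flip: powr_realpow)
      also have "\<dots> = (\<epsilon>\<^sup>2) powr (real k / m) / D powr (real k / m)"
        using \<epsilon> D by (simp add: y_def powr_divide)
      also have "(\<epsilon>\<^sup>2) powr (real k / m) = \<epsilon> powr (2 * real k / m)"
        using \<epsilon> by (simp add: powr_powr flip: powr_numeral)
      finally show ?thesis .
    qed
    have 2: "\<Lambda> * ((\<epsilon> / c) powr q * (C / \<rho> ^ k)) \<le> \<epsilon>\<^sup>2 / 4"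
    proof -
      have eq: "\<epsilon> powr q = \<epsilon> powr (2 * real k / m) * \<epsilon>\<^sup>2"
        using \<epsilon> by (simp add: q_def powr_add)
      have "\<Lambda> * ((\<epsilon> / c) powr q * (C / \<rho> ^ k)) = \<epsilon>\<^sup>2 * E / c powr q"
        using \<epsilon> c D unfolding \<rho>k E_def by (simp add: powr_divide eq)
      also have "\<dots> \<le> \<epsilon>\<^sup>2 * (c powr q / 4) / c powr q"
      proof -
        have "c powr 1 \<le> c powr q" using c q by (intro powr_mono) auto
        then have "E \<le> c powr q / 4" using c by simp
        then show ?thesis by (intro divide_right_mono mult_left_mono) auto
      qed
      also have "\<dots> = \<epsilon>\<^sup>2 / 4" using c by simp
      finally show ?thesis .
    qed
    have lt: "\<Lambda> * ((\<epsilon> / c) powr q * (C / \<rho> ^ k) + K * \<rho> powr m) < \<epsilon>\<^sup>2"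
    proof -
      have "0 < \<epsilon>\<^sup>2" using \<epsilon> by simp
      then show ?thesis unfolding distrib_left using 1 2 by linarith
    qed
    have "0 \<le> \<Lambda> * ((\<epsilon> / c) powr q * (C / \<rho> ^ k) + K * \<rho> powr m)"
      using \<Lambda> C K \<rho> by simp
    with \<rho> \<rho>32 lt show "\<exists>\<rho>. 0 < \<rho> \<and> \<rho> \<le> 1/32
       \<and> 0 \<le> \<Lambda> * ((\<epsilon> / c) powr q * (C / \<rho> ^ k) + K * \<rho> powr m)
       \<and> \<Lambda> * ((\<epsilon> / c) powr q * (C / \<rho> ^ k) + K * \<rho> powr m) < \<epsilon>\<^sup>2" by blast
  qed
qed

text \<open>Both claims are read off along one unit vector. The distance is bounded from above by
  the gap because the Poincare inequality supplies the factor \<open>R - r\<close>, which is then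
  replaced by the smaller \<open>d\<close>.\<close>

lemma ball_gap:
  fixes x :: "'a::euclidean_space"
  assumes r: "0 < r" "0 < R" and sub: "closure (ball x r) \<subseteq> ball x R"
  shows "r < R" "setdist (ball x r) (frontier (ball x R)) \<le> R - r"
proof -
  obtain u :: 'a where u: "norm u = 1" using vector_choose_size[of 1] by auto
  have p: "x + r *\<^sub>R u \<in> closure (ball x r)" using r u by (simp add: dist_norm)
  then have "x + r *\<^sub>R u \<in> ball x R" using sub by blast
  then show rR: "r < R" using r u by (simp add: dist_norm)
  have q: "x + R *\<^sub>R u \<in> frontier (ball x R)" using r u by (simp add: dist_norm)
  have "setdist (ball x r) (frontier (ball x R)) \<le> dist (x + r *\<^sub>R u) (x + R *\<^sub>R u)"
    using setdist_le_dist[OF p q] by (simp add: setdist_closure_1)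
  also have "\<dots> = norm ((r - R) *\<^sub>R u)" by (simp add: dist_norm scaleR_diff_left)
  also have "\<dots> = R - r" using rR u by simp
  finally show "setdist (ball x r) (frontier (ball x R)) \<le> R - r" .
qed

section \<open>Reduction of the hypotheses to Borel data\<close>

lemma vmeasurable_on_subset:
  "vmeasurable_on N UNIV w \<Longrightarrow> vmeasurable_on N A w"
  by (simp add: vmeasurable_on_def lebesgue_on_UNIV_eq measurable_restrict_space1)

text \<open>Membership in \<open>Xs2\<close> gives finite energy on the larger ball only. Any other
  pair at which the integrand does not vanish has one point in the small ball and one outside the
  large ball, at distance at least \<open>R - r\<close>, and is treated by
  \<open>energy_far_le\<close>. Only finiteness is concluded, so the gap enters no constant.\<close>

lemma energy_finite_of_ball:
  fixes W :: "real ^ 'n \<Rightarrow> nat \<Rightarrow> real"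
  assumes W: "vborel N W" and s: "0 < s" and rR: "r < R"
    and W0: "\<And>x i. x \<notin> ball x0 r \<Longrightarrow> i < N \<Longrightarrow> W x i = 0"
    and fin: "energy N s (ball x0 R) W < \<infinity>" "mass N W < \<infinity>"
  shows "energy N s UNIV W < \<infinity>"
proof -
  define F where "F = {z :: (real ^ 'n) \<times> (real ^ 'n). R - r \<le> norm (fst z - snd z)}"
  have F: "F \<in> sets borel"
    unfolding F_def by (intro borel_closed closed_Collect_le continuous_intros)
  have far: "R - r \<le> norm (x - y)" if "x \<in> ball x0 r" "y \<notin> ball x0 R" for x y
  proof -
    have "dist x0 y \<le> dist x0 x + dist x y" by (rule dist_triangle)
    then show ?thesis using that by (simp add: dist_norm)
  qed
  have pt: "ennreal (gdens N s W z) \<le> ennreal (gdens N s W z) * indicator (ball x0 R \<times> ball x0 R) z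
       + ennreal (gdens N s W z) * indicator F z" for z
  proof (cases "z \<in> ball x0 R \<times> ball x0 R \<or> z \<in> F")
    case False
    obtain x y where z: "z = (x, y)" by (cases z)
    have sub: "ball x0 r \<subseteq> ball x0 R" using rR by auto
    have "x \<notin> ball x0 r" "y \<notin> ball x0 r"
      using False far[of x y] far[of y x] sub by (auto simp: z F_def norm_minus_commute)
    then have "vnorm N (W x - W y) = 0" using W0 by (simp add: vnorm_def L2_set_def)
    then show ?thesis by (simp add: gdens_def z)
  qed (auto simp: indicator_def)
  have BR: "ball x0 R \<times> ball x0 R \<in> sets borel" by (intro borel_open open_Times open_ball)
  have gm: "(\<lambda>z. ennreal (gdens N s W z)) \<in> borel_measurable lborel" using measurable_gdens[OF W] by simp
  have "energy N s UNIV W \<le> (\<integral>\<^sup>+z. ennreal (gdens N s W z) * indicator (ball x0 R \<times> ball x0 R) z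
       + ennreal (gdens N s W z) * indicator F z \<partial>lborel)"
    unfolding energy_def using pt by (auto intro!: nn_integral_mono)
  also have "\<dots> = energy N s (ball x0 R) W + (\<integral>\<^sup>+z. ennreal (gdens N s W z) * indicator F z \<partial>lborel)"
    unfolding energy_def using F BR
    by (intro nn_integral_add borel_measurable_times_ennreal gm borel_measurable_indicator) auto
  also have "\<dots> \<le> energy N s (ball x0 R) W
      + ennreal (4 * far_const TYPE(real ^ 'n) s * (R - r) powr (- 2 * s)) * mass N W"
    unfolding F_def using rR by (intro add_left_mono energy_far_le[OF W s]) auto
  also have "\<dots> < \<infinity>" using fin by (auto simp: ennreal_mult_less_top)
  finally show ?thesis .
qed

lemma mass_on_le:
  assumes U: "vborel N U" and V: "vborel N V" and A: "A \<in> sets borel"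
    and X: "(\<forall>x\<in>A. \<forall>i<N. X x i = U x i + V x i) \<or> (\<forall>x\<in>A. \<forall>i<N. X x i = U x i - V x i)"
  shows "(\<integral>\<^sup>+x\<in>A. ennreal ((vnorm N (X x))\<^sup>2) \<partial>lborel)
     \<le> 2 * (\<integral>\<^sup>+x\<in>A. ennreal ((vnorm N (U x))\<^sup>2) \<partial>lborel) + 2 * (\<integral>\<^sup>+x\<in>A. ennreal ((vnorm N (V x))\<^sup>2) \<partial>lborel)"
proof -
  have m: "(\<lambda>x. ennreal ((vnorm N (Y x))\<^sup>2) * indicator A x) \<in> borel_measurable lborel" if "vborel N Y" for Y
    using measurable_vnorm[OF that] A
    by (intro borel_measurable_times_ennreal borel_measurable_indicator) auto
  have "(\<integral>\<^sup>+x\<in>A. ennreal ((vnorm N (X x))\<^sup>2) \<partial>lborel)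
     \<le> (\<integral>\<^sup>+x. 2 * (ennreal ((vnorm N (U x))\<^sup>2) * indicator A x) + 2 * (ennreal ((vnorm N (V x))\<^sup>2) * indicator A x) \<partial>lborel)"
  proof (rule nn_integral_mono)
    fix x
    show "ennreal ((vnorm N (X x))\<^sup>2) * indicator A x
      \<le> 2 * (ennreal ((vnorm N (U x))\<^sup>2) * indicator A x) + 2 * (ennreal ((vnorm N (V x))\<^sup>2) * indicator A x)"
    proof (cases "x \<in> A")
      case True
      have "(vnorm N (X x))\<^sup>2 \<le> 2 * (vnorm N (U x))\<^sup>2 + 2 * (vnorm N (V x))\<^sup>2"
        using X True by (intro vnorm_add_power2_le) auto
      then have "ennreal ((vnorm N (X x))\<^sup>2) \<le> ennreal (2 * (vnorm N (U x))\<^sup>2 + 2 * (vnorm N (V x))\<^sup>2)"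
        by (rule ennreal_leI)
      then show ?thesis using True by (simp add: ennreal_mult)
    qed simp
  qed
  also have "\<dots> = 2 * (\<integral>\<^sup>+x\<in>A. ennreal ((vnorm N (U x))\<^sup>2) \<partial>lborel) + 2 * (\<integral>\<^sup>+x\<in>A. ennreal ((vnorm N (V x))\<^sup>2) \<partial>lborel)"
    using m[OF U] m[OF V] by (simp add: nn_integral_add nn_integral_cmult)
  finally show ?thesis .
qed

lemma nn_integral_vnorm_finite:
  assumes W: "vborel N W" and W0: "\<And>x i. x \<notin> ball x0 r \<Longrightarrow> i < N \<Longrightarrow> W x i = 0" and m: "mass N W < \<infinity>"
  shows "(\<integral>\<^sup>+x. ennreal (vnorm N (W x)) \<partial>lborel) < \<infinity>"
proof -
  have le: "ennreal (vnorm N (W x)) \<le> indicator (ball x0 r) x + ennreal ((vnorm N (W x))\<^sup>2)" for x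
  proof (cases "x \<in> ball x0 r")
    case True
    have "0 \<le> (vnorm N (W x) - 1)\<^sup>2" by simp
    then have "2 * vnorm N (W x) \<le> 1 + (vnorm N (W x))\<^sup>2" by (simp add: power2_diff)
    then have "vnorm N (W x) \<le> 1 + (vnorm N (W x))\<^sup>2" using vnorm_nonneg[of N "W x"] by linarith
    then have "ennreal (vnorm N (W x)) \<le> ennreal (1 + (vnorm N (W x))\<^sup>2)" by (rule ennreal_leI)
    then show ?thesis using True by simp
  next
    case False
    then have "vnorm N (W x) = 0" using W0 by (simp add: vnorm_def L2_set_def)
    then show ?thesis by simp
  qed
  have "(\<integral>\<^sup>+x. ennreal (vnorm N (W x)) \<partial>lborel) \<le> (\<integral>\<^sup>+x. indicator (ball x0 r) x + ennreal ((vnorm N (W x))\<^sup>2) \<partial>lborel)"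
    using le by (intro nn_integral_mono)
  also have "\<dots> = emeasure lborel (ball x0 r) + mass N W"
    using measurable_vnorm[OF W] by (subst nn_integral_add) (auto simp: mass_def borel_measurable_indicator)
  also have "\<dots> < \<infinity>" using m emeasure_lborel_ball_finite[of x0 r] by simp
  finally show ?thesis .
qed

text \<open>Collects what the estimates need, with \<open>V\<close>, \<open>W\<close>,
  \<open>G\<close> representing \<open>v\<close>, \<open>h - v\<close>, \<open>g\<close>. The final
  identity is the equation for \<open>h\<close> tested with \<open>h - v\<close>, its form being
  split by \<open>h = V + W\<close> almost everywhere.\<close>

lemma borel_reduction:
  fixes v g h :: "real ^ 'n \<Rightarrow> nat \<Rightarrow> real"
  assumes s: "0 < s" and a: "mat_norm N a \<le> \<Lambda>" and r: "0 < r" "r < R" and c: "0 \<le> c"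
    and v: "v \<in> Ws2 N s UNIV" and g: "g \<in> Linf N"
    and bnd: "Ws2_norm N s UNIV v + Ws2_norm N (s + \<delta>) UNIV v + Tail N s v x0 R + Linf_norm N g \<le> ennreal c"
    and h: "dirichlet_solution N s a g v (ball x0 r) (ball x0 R) h"
  obtains V W G where "vborel N V" "vborel N W" "vborel N G"
    and "vae N v V" "vae N (h - v) W" "vae N g G" "vae N h (\<lambda>x i. V x i + W x i)"
    and "\<And>x i. x \<notin> ball x0 r \<Longrightarrow> i < N \<Longrightarrow> W x i = 0" and "AE x in lborel. vnorm N (G x) \<le> c"
    and "energy N s UNIV V \<le> ennreal (c\<^sup>2)" "energy N (s + \<delta>) UNIV V \<le> ennreal (c\<^sup>2)" "mass N V \<le> ennreal (c\<^sup>2)"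
    and "energy N s UNIV W < \<infinity>"
    and "(\<integral>z. bil N s a V W z \<partial>lborel) + (\<integral>z. bil N s a W W z \<partial>lborel) = (\<integral>x. vinner N (G x) (W x) \<partial>lborel)"
proof -
  define B where "B = ball x0 r"
  define B' where "B' = ball x0 R"
  have hX: "h \<in> Ws2 N s B'" "h \<in> L1_2s N s" "AE x in lebesgue. x \<notin> B \<longrightarrow> (\<forall>i<N. h x i = v x i)"
    using h by (auto simp: dirichlet_solution_def Xs2_def B_def B'_def)
  have vm: "vmeasurable_on N UNIV v" and hm: "vmeasurable_on N UNIV h" and gm: "vmeasurable_on N UNIV g"
    using v hX g by (auto simp: Ws2_def L1_2s_def Linf_def)
  obtain V where V: "vborel N V" "vae N v V" using borel_representative[OF vm] .
  obtain H where H: "vborel N H" "vae N h H" using borel_representative[OF hm] .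
  obtain G where G: "vborel N G" "vae N g G" using borel_representative[OF gm] .
  \<comment> \<open>The value zero outside \<open>B\<close> is imposed everywhere, not just almost
    everywhere, because the support conditions of the estimates are pointwise.\<close>
  define W where "W x i = (if x \<in> B then H x i - V x i else 0)" for x i
  have W: "vborel N W"
    unfolding vborel_def W_def B_def
  proof (intro allI impI)
    fix i assume "i < N"
    then show "(\<lambda>x. if x \<in> ball x0 r then H x i - V x i else 0) \<in> borel_measurable borel"
      using vborelD[OF V(1)] vborelD[OF H(1)] by (intro measurable_If_set borel_measurable_diff) auto
  qed
  have W0: "\<And>x i. x \<notin> B \<Longrightarrow> i < N \<Longrightarrow> W x i = 0" by (simp add: W_def)
  have "AE x in lborel. x \<notin> B \<longrightarrow> (\<forall>i<N. h x i = v x i)"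
    using hX(3) by (simp add: AE_completion_iff)
  with V(2) H(2) have "AE x in lborel. \<forall>i<N. (h - v) x i = W x i \<and> h x i = V x i + W x i"
    unfolding vae_def by eventually_elim (auto simp: W_def)
  then have wW: "vae N (h - v) W" and hW: "vae N h (\<lambda>x i. V x i + W x i)"
    unfolding vae_def by (auto elim: eventually_mono)
  define K where "K = (\<lambda>x i. V x i + W x i)"
  have K: "vborel N K"
    using vborelD[OF V(1)] vborelD[OF W] by (auto simp: vborel_def K_def intro!: borel_measurable_add)
  have b: "Ws2_norm N s UNIV v \<le> ennreal c" "Ws2_norm N (s + \<delta>) UNIV v \<le> ennreal c" "Linf_norm N g \<le> ennreal c"
  proof -
    show "Ws2_norm N s UNIV v \<le> ennreal c"
      by (rule order_trans[OF _ bnd]) (simp add: add.assoc)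
    show "Ws2_norm N (s + \<delta>) UNIV v \<le> ennreal c"
      by (rule order_trans[OF _ bnd]) (simp add: add.left_commute[of _ "Ws2_norm N (s + \<delta>) UNIV v"] add.assoc)
    show "Linf_norm N g \<le> ennreal c"
      by (rule order_trans[OF _ bnd]) simp
  qed
  have eV: "energy N s' UNIV V \<le> ennreal (c\<^sup>2)" "mass N V \<le> ennreal (c\<^sup>2)"
    if "Ws2_norm N s' UNIV v \<le> ennreal c" for s'
  proof -
    have "gagliardo_seminorm N s' UNIV v \<le> Ws2_norm N s' UNIV v" "L2_norm N UNIV v \<le> Ws2_norm N s' UNIV v"
      by (simp_all add: Ws2_norm_def)
    then have "ennreal_sqrt (energy N s' UNIV V) \<le> ennreal c" "ennreal_sqrt (mass N V) \<le> ennreal c"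
      using that unfolding gagliardo_vae[OF V(2)] L2_norm_vae[OF V(2)] by (auto simp: mass_def)
    then show "energy N s' UNIV V \<le> ennreal (c\<^sup>2)" "mass N V \<le> ennreal (c\<^sup>2)"
      using c by (auto intro: ennreal_sqrt_leD)
  qed
  have Gc: "AE x in lborel. vnorm N (G x) \<le> c"
  proof -
    have "AE x in lebesgue. ennreal (vnorm N (g x)) \<le> Linf_norm N g"
      unfolding Linf_norm_def by (rule esssup_AE)
    then have "AE x in lborel. ennreal (vnorm N (g x)) \<le> Linf_norm N g" by (simp add: AE_completion_iff)
    with G(2) show ?thesis unfolding vae_def
    proof eventually_elim
      case (elim x)
      have "vnorm N (G x) = vnorm N (g x)" using elim by (intro vnorm_cong) auto
      moreover have "ennreal (vnorm N (g x)) \<le> ennreal c" using elim b(3) by (meson order_trans)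
      ultimately show ?case using c by simp
    qed
  qed
  have hfin: "(\<integral>\<^sup>+x\<in>B'. ennreal ((vnorm N (K x))\<^sup>2) \<partial>lborel) < \<infinity>" "energy N s B' K < \<infinity>"
    using hX(1) unfolding Ws2_def Ws2_norm_def
    by (auto simp: L2_norm_vae[OF hW] gagliardo_vae[OF hW] K_def ennreal_sqrt_finite_iff[unfolded infinity_ennreal_def])
  have BB: "B' \<in> sets borel" by (simp add: B'_def)
  have BsB: "B \<subseteq> B'" using r by (auto simp: B_def B'_def)
  have mW: "mass N W < \<infinity>"
  proof -
    have "mass N W = (\<integral>\<^sup>+x\<in>B'. ennreal ((vnorm N (W x))\<^sup>2) \<partial>lborel)"
      unfolding mass_def
    proof (rule nn_integral_cong)
      fix x
      have "vnorm N (W x) = 0" if "x \<notin> B'"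
      proof -
        have "x \<notin> B" using BsB that by blast
        then show ?thesis using W0 by (simp add: vnorm_def L2_set_def)
      qed
      then show "ennreal ((vnorm N (W x))\<^sup>2) = ennreal ((vnorm N (W x))\<^sup>2) * indicator B' x"
        by (auto simp: indicator_def)
    qed
    also have "\<dots> \<le> 2 * (\<integral>\<^sup>+x\<in>B'. ennreal ((vnorm N (K x))\<^sup>2) \<partial>lborel) + 2 * (\<integral>\<^sup>+x\<in>B'. ennreal ((vnorm N (V x))\<^sup>2) \<partial>lborel)"
      by (intro mass_on_le K V BB) (simp add: K_def)
    also have "\<dots> \<le> 2 * (\<integral>\<^sup>+x\<in>B'. ennreal ((vnorm N (K x))\<^sup>2) \<partial>lborel) + 2 * mass N V"
      unfolding mass_def by (intro add_left_mono mult_left_mono nn_integral_mono) (auto simp: indicator_def)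
    also have "\<dots> < \<infinity>" using hfin eV(2)[OF b(1)] by (auto simp: ennreal_mult_less_top intro: le_less_trans)
    finally show ?thesis .
  qed
  have eW': "energy N s B' W < \<infinity>"
  proof -
    have "energy N s B' W \<le> 2 * energy N s B' K + 2 * energy N s B' V"
      by (intro energy_add_le K V BB) (simp add: K_def)
    also have "energy N s B' V \<le> energy N s UNIV V"
      unfolding energy_def by (intro nn_integral_mono) (auto simp: indicator_def)
    finally have "energy N s B' W \<le> 2 * energy N s B' K + 2 * energy N s UNIV V"
      by (simp add: add_left_mono mult_left_mono)
    also have "\<dots> < \<infinity>" using hfin eV(1)[OF b(1)] by (auto simp: ennreal_mult_less_top intro: le_less_trans)
    finally show ?thesis .
  qed
  have eW: "energy N s UNIV W < \<infinity>"
    using energy_finite_of_ball[OF W s r(2) W0[unfolded B_def] eW'[unfolded B'_def] mW] .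
  have wm: "vmeasurable_on N UNIV (h - v)"
    using hm vm by (auto simp: vmeasurable_on_def intro!: borel_measurable_diff)
  \<comment> \<open>Admissibility of the test function: on the larger ball its norms are those of
    \<open>W\<close>, and its weighted integrability follows from that of \<open>W\<close>, since
    the weight is at most 1.\<close>
  have wX: "h - v \<in> Xs2 N s (\<lambda>_ _. 0) B B'"
  proof -
    have "(\<integral>\<^sup>+x\<in>B'. ennreal ((vnorm N (W x))\<^sup>2) \<partial>lborel) \<le> mass N W"
      unfolding mass_def by (intro nn_integral_mono) (auto simp: indicator_def)
    then have "Ws2_norm N s B' (h - v) < \<infinity>"
      using mW eW' unfolding Ws2_norm_def L2_norm_vae[OF wW] gagliardo_vae[OF wW]
      by (auto simp: ennreal_sqrt_finite_iff[unfolded infinity_ennreal_def] intro: le_less_trans)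
    then have 1: "h - v \<in> Ws2 N s B'" using wm by (auto simp: Ws2_def intro: vmeasurable_on_subset)
    have i: "(\<integral>\<^sup>+x. ennreal (vnorm N ((h - v) x)) \<partial>lebesgue) < \<infinity>"
    proof -
      have "(\<integral>\<^sup>+x. ennreal (vnorm N ((h - v) x)) \<partial>lebesgue) = (\<integral>\<^sup>+x. ennreal (vnorm N (W x)) \<partial>lborel)"
        unfolding nn_integral_completion
      proof (rule nn_integral_cong_AE)
        show "AE x in lborel. ennreal (vnorm N ((h - v) x)) = ennreal (vnorm N (W x))"
          using wW unfolding vae_def
        proof eventually_elim
          case (elim x)
          then have "vnorm N ((h - v) x) = vnorm N (W x)" by (intro vnorm_cong) auto
          then show ?case by simp
        qed
      qed
      then show ?thesis using nn_integral_vnorm_finite[OF W W0[unfolded B_def] mW] by simp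
    qed
    have "(\<integral>\<^sup>+x\<in>C. ennreal (vnorm N ((h - v) x)) \<partial>lebesgue) < \<infinity>" for C
      by (rule le_less_trans[OF nn_integral_mono i]) (auto simp: indicator_def)
    moreover have "(\<integral>\<^sup>+x. ennreal (vnorm N ((h - v) x) / (1 + norm x powr (real CARD('n) + 2 * s))) \<partial>lebesgue) < \<infinity>"
    proof (rule le_less_trans[OF nn_integral_mono i])
      fix x
      have "vnorm N ((h - v) x) / (1 + norm x powr (real CARD('n) + 2 * s)) \<le> vnorm N ((h - v) x) / 1"
        by (intro divide_left_mono) (auto simp: add_pos_nonneg)
      then show "ennreal (vnorm N ((h - v) x) / (1 + norm x powr (real CARD('n) + 2 * s))) \<le> ennreal (vnorm N ((h - v) x))"
        by (intro ennreal_leI) simp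
    qed
    ultimately have 2: "h - v \<in> L1_2s N s" using wm by (simp add: L1_2s_def)
    have "AE x in lebesgue. x \<notin> B \<longrightarrow> (\<forall>i<N. (h - v) x i = 0)"
      using hX(3) by eventually_elim auto
    with 1 2 show ?thesis by (simp add: Xs2_def)
  qed
  have "nonlocal_form N s a h (h - v) = (LINT x:B|lebesgue. vinner N (g x) ((h - v) x))"
    using h wX by (simp add: dirichlet_solution_def B_def B'_def)
  then have id: "(\<integral>z. bil N s a K W z \<partial>lborel) = (\<integral>x. vinner N (G x) (W x) \<partial>lborel)"
    using nonlocal_form_vae[OF hW[folded K_def] wW K W] source_vae[OF G(2) wW G(1) W W0] by simp
  obtain u where u: "energy N s UNIV W \<le> ennreal u" "0 \<le> u"
    using eW by (cases "energy N s UNIV W") auto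
  have add: "bil N s a K W z = bil N s a V W z + bil N s a W W z" for z
  proof -
    have "mat_app N a (K x - K y) i = mat_app N a (V x - V y) i + mat_app N a (W x - W y) i" for x y i
      by (simp add: mat_app_def K_def sum.distrib[symmetric] algebra_simps)
    then show ?thesis by (simp add: bil_def vinner_def add_divide_distrib[symmetric] sum.distrib[symmetric] distrib_right)
  qed
  \<comment> \<open>Additivity in the first argument requires both forms to be integrable over the
    whole space, hence the finite energy of \<open>W\<close> beyond the larger ball.\<close>
  have "(\<integral>z. bil N s a K W z \<partial>lborel) = (\<integral>z. bil N s a V W z \<partial>lborel) + (\<integral>z. bil N s a W W z \<partial>lborel)"
    unfolding add
    by (intro Bochner_Integration.integral_add bil_estimate(1)[OF V(1) W a zero_less_one eV(1)[OF b(1)] zero_le_power2 u]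
      bil_estimate(1)[OF W W a zero_less_one u u])
  with id have id': "(\<integral>z. bil N s a V W z \<partial>lborel) + (\<integral>z. bil N s a W W z \<partial>lborel) = (\<integral>x. vinner N (G x) (W x) \<partial>lborel)"
    by simp
  show thesis
    by (rule that[OF V(1) W G(1) V(2) wW G(2) hW W0[unfolded B_def] Gc eV(1)[OF b(1)] eV(1)[OF b(2)] eV(2)[OF b(1)] eW id'])
qed

section \<open>Comparison with the solution\<close>

text \<open>\<open>l\<close> and \<open>u\<close> stand for bounds on the mass and the energy of
  \<open>h - v\<close>. The summands are, in order, the \<open>L^2\<close> norm, the Gagliardo
  seminorm and the tail; the factor after \<open>real N\<close> bounds one component of the
  average.\<close>

definition solution_const :: "(real ^ 'n) itself \<Rightarrow> real \<Rightarrow> nat \<Rightarrow> real \<Rightarrow> real \<Rightarrow> real \<Rightarrow> real" where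
  "solution_const _ s N c l u = sqrt (2 * c\<^sup>2 + 2 * l) + sqrt (2 * c\<^sup>2 + 2 * u)
     + ((1 + real N * ((unit_ball_vol (real CARD('n)) + (2 * c\<^sup>2 + 2 * l)) * 32 ^ CARD('n) / unit_ball_vol (real CARD('n))))
          * (far_const TYPE(real ^ 'n) s * (1/32) powr (- 2 * s))
        + 32 powr (real CARD('n) + 2 * s) * c\<^sup>2)"

text \<open>The numerator is controlled by
  \<open>\<bar>H x i\<bar> \<le> 1 + (vnorm N (H x))\<^sup>2\<close>, the denominator by
  \<open>r > 1/32\<close>.\<close>

lemma average_le:
  fixes h H :: "real ^ 'n \<Rightarrow> nat \<Rightarrow> real"
  assumes h: "vae N h H" and H: "vborel N H" and r: "1/32 < r" "r < 1" and i: "i < N"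
    and l: "(\<integral>\<^sup>+x\<in>ball x0 r. ennreal ((vnorm N (H x))\<^sup>2) \<partial>lborel) \<le> ennreal l" "0 \<le> l"
  shows "\<bar>average (ball x0 r) h i\<bar>
     \<le> (unit_ball_vol (real CARD('n)) + l) * 32 ^ CARD('n) / unit_ball_vol (real CARD('n))"
proof -
  define \<omega> where "\<omega> = unit_ball_vol (real CARD('n))"
  have \<omega>: "0 < \<omega>" by (simp add: \<omega>_def)
  have vol: "emeasure lborel (ball x0 r) = ennreal (\<omega> * r ^ CARD('n))" using r by (simp add: emeasure_ball \<omega>_def)
  define F where "F x = indicator (ball x0 r) x * H x i" for x
  have Fm: "F \<in> borel_measurable borel"
    unfolding F_def using vborelD[OF H i]
    by (intro borel_measurable_times borel_measurable_indicator) auto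
  have num: "(LINT x:ball x0 r|lebesgue. h x i) = (\<integral>x. F x \<partial>lborel)"
    unfolding set_lebesgue_integral_def
    using h i by (intro integral_lebesgue_vae[OF Fm]) (auto simp: vae_def F_def elim: eventually_mono)
  define g where "g x = indicator (ball x0 r) x * (1 + (vnorm N (H x))\<^sup>2)" for x
  have le: "\<bar>F x\<bar> \<le> g x" for x
  proof -
    have "(H x i)\<^sup>2 \<le> (vnorm N (H x))\<^sup>2"
      unfolding vnorm_power2 using i by (intro member_le_sum) auto
    moreover have "0 \<le> (\<bar>H x i\<bar> - 1)\<^sup>2" by simp
    then have "2 * \<bar>H x i\<bar> \<le> 1 + (H x i)\<^sup>2" by (simp add: power2_diff)
    ultimately have "\<bar>H x i\<bar> \<le> 1 + (vnorm N (H x))\<^sup>2" using abs_ge_zero[of "H x i"] by linarith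
    then show ?thesis by (simp add: F_def g_def indicator_def)
  qed
  have "(\<integral>\<^sup>+x. ennreal (g x) \<partial>lborel)
      = (\<integral>\<^sup>+x. indicator (ball x0 r) x + ennreal ((vnorm N (H x))\<^sup>2) * indicator (ball x0 r) x \<partial>lborel)"
    by (intro nn_integral_cong) (auto simp: g_def indicator_def)
  also have "\<dots> = emeasure lborel (ball x0 r) + (\<integral>\<^sup>+x\<in>ball x0 r. ennreal ((vnorm N (H x))\<^sup>2) \<partial>lborel)"
    using measurable_vnorm[OF H]
    by (subst nn_integral_add) (auto simp: borel_measurable_indicator intro!: borel_measurable_times_ennreal)
  also have "\<dots> \<le> ennreal \<omega> + ennreal l"
    unfolding vol using r \<omega> by (intro add_mono l ennreal_leI mult_left_le power_le_one) auto
  finally have *: "(\<integral>\<^sup>+x. ennreal (g x) \<partial>lborel) \<le> ennreal (\<omega> + l)"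
    using \<omega> l by simp
  have "F \<in> borel_measurable lborel" using Fm by simp
  then have n: "\<bar>\<integral>x. F x \<partial>lborel\<bar> \<le> \<omega> + l"
    using \<omega> l by (intro integrable_dominated(2)[OF _ AE_I2[OF le] *]) auto
  have "measure lebesgue (ball x0 r) = \<omega> * r ^ CARD('n)"
    using vol r \<omega> by (simp add: measure_def)
  moreover have "\<omega> / 32 ^ CARD('n) \<le> \<omega> * r ^ CARD('n)"
  proof -
    have "(1/32) ^ CARD('n) \<le> r ^ CARD('n)" using r by (intro power_mono) auto
    then have "\<omega> * (1/32) ^ CARD('n) \<le> \<omega> * r ^ CARD('n)" using \<omega> by (intro mult_left_mono) auto
    then show ?thesis by (simp add: power_divide)
  qed
  ultimately have "\<bar>average (ball x0 r) h i\<bar> \<le> (\<omega> + l) / (\<omega> / 32 ^ CARD('n))"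
    unfolding average_def num abs_divide using n \<omega> l by (intro frac_le) auto
  then show ?thesis using \<omega> by (simp add: \<omega>_def)
qed

text \<open>Norms of \<open>h\<close> come from adding those of \<open>V\<close> and
  \<open>W\<close>. In the tail \<open>W\<close> is absent, so only \<open>V\<close> and the
  constant average remain. Every use of the inner radius goes through \<open>1/32 < r < 1\<close>,
  which keeps the bound uniform in the balls.\<close>

lemma solution_bounds:
  fixes v h V W :: "real ^ 'n \<Rightarrow> nat \<Rightarrow> real"
  assumes V: "vborel N V" and W: "vborel N W" and hV: "vae N h (\<lambda>x i. V x i + W x i)"
    and s: "0 < s" "s < 1" and r: "1/32 < r" "r < 1" and c: "0 \<le> c"
    and W0: "\<And>x i. x \<notin> ball x0 r \<Longrightarrow> i < N \<Longrightarrow> W x i = 0"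
    and eV: "energy N s UNIV V \<le> ennreal (c\<^sup>2)" and mV: "mass N V \<le> ennreal (c\<^sup>2)"
    and eW: "energy N s UNIV W \<le> ennreal u" "0 \<le> u" and mW: "mass N W \<le> ennreal l" "0 \<le> l"
  shows "Ws2_norm N s A h + Tail N s (\<lambda>x. h x - average (ball x0 r) h) x0 r
     \<le> ennreal (solution_const TYPE(real ^ 'n) s N c l u)"
proof -
  define n where "n = CARD('n)"
  define \<omega> where "\<omega> = unit_ball_vol (real n)"
  have \<omega>: "0 < \<omega>" by (simp add: \<omega>_def)
  define K where "K = (\<lambda>x i. V x i + W x i)"
  have K: "vborel N K"
    using vborelD[OF V] vborelD[OF W] by (auto simp: vborel_def K_def intro!: borel_measurable_add)
  have hK: "vae N h K" using hV by (simp add: K_def)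
  define a where "a = 2 * c\<^sup>2 + 2 * l"
  define b where "b = 2 * c\<^sup>2 + 2 * u"
  have ab: "0 \<le> a" "0 \<le> b" using mW eW by (auto simp: a_def b_def)
  have mK: "(\<integral>\<^sup>+x\<in>S. ennreal ((vnorm N (K x))\<^sup>2) \<partial>lborel) \<le> ennreal a" for S
  proof -
    have "(\<integral>\<^sup>+x\<in>S. ennreal ((vnorm N (K x))\<^sup>2) \<partial>lborel) \<le> (\<integral>\<^sup>+x\<in>UNIV. ennreal ((vnorm N (K x))\<^sup>2) \<partial>lborel)"
      by (intro nn_integral_mono) (auto simp: indicator_def)
    also have "\<dots> \<le> 2 * (\<integral>\<^sup>+x\<in>UNIV. ennreal ((vnorm N (V x))\<^sup>2) \<partial>lborel) + 2 * (\<integral>\<^sup>+x\<in>UNIV. ennreal ((vnorm N (W x))\<^sup>2) \<partial>lborel)"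
      by (intro mass_on_le V W) (auto simp: K_def)
    also have "\<dots> = 2 * mass N V + 2 * mass N W" by (simp add: mass_def)
    also have "\<dots> \<le> 2 * ennreal (c\<^sup>2) + 2 * ennreal l" by (intro add_mono mult_left_mono mV mW) auto
    finally show ?thesis using mW by (simp add: a_def ennreal_mult)
  qed
  have L2: "L2_norm N A h \<le> ennreal (sqrt a)"
    unfolding L2_norm_vae[OF hK] using ab mK by (intro ennreal_sqrt_le) auto
  have eK: "energy N s A K \<le> ennreal b"
  proof -
    have "energy N s A K \<le> energy N s UNIV K"
      unfolding energy_def by (intro nn_integral_mono) (auto simp: indicator_def)
    also have "\<dots> \<le> 2 * energy N s UNIV V + 2 * energy N s UNIV W"
      by (intro energy_add_le V W) (auto simp: K_def)
    also have "\<dots> \<le> 2 * ennreal (c\<^sup>2) + 2 * ennreal u" by (intro add_mono mult_left_mono eV eW) auto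
    finally show ?thesis using eW by (simp add: b_def ennreal_mult)
  qed
  have gag: "gagliardo_seminorm N s A h \<le> ennreal (sqrt b)"
    unfolding gagliardo_vae[OF hK] using ab eK by (intro ennreal_sqrt_le) auto
  define e where "e = real n + 2 * s"
  have e: "0 < e" using s by (simp add: e_def add_nonneg_pos)
  define m where "m = average (ball x0 r) h"
  define mb where "mb = real N * ((\<omega> + a) * 32 ^ n / \<omega>)"
  have mb: "vnorm N m \<le> mb" "0 \<le> mb"
  proof -
    have "vnorm N m \<le> (\<Sum>i<N. \<bar>m i\<bar>)" by (rule vnorm_le_sum)
    also have "\<dots> \<le> (\<Sum>i<N. (\<omega> + a) * 32 ^ n / \<omega>)"
      using average_le[OF hK K r _ mK ab(1)] by (intro sum_mono) (simp add: m_def \<omega>_def n_def)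
    finally show "vnorm N m \<le> mb" by (simp add: mb_def)
    show "0 \<le> mb" using \<omega> ab by (simp add: mb_def)
  qed
  define T where "T = far_const TYPE(real ^ 'n) s * (1/32) powr (- 2 * s)"
  have T: "0 \<le> T" using far_const_nonneg[OF s(1), where 'a="real ^ 'n"] by (simp add: T_def)
  \<comment> \<open>\<open>vnorm N (V y)\<close> is traded for
    \<open>1 + (vnorm N (V y))\<^sup>2\<close>: the constant part meets the far kernel, which is
    integrable, and the square meets a kernel bounded by \<open>32 powr e\<close>, hence the mass of
    \<open>V\<close>.\<close>
  have ae: "AE y in lborel. ennreal (vnorm N (h y - m) / norm (y - x0) powr e) * indicator (- ball x0 r) y
      \<le> ennreal (1 + mb) * (ennreal (1 / norm (y - x0) powr e) * indicator {y. 1/32 \<le> norm (y - x0)} y)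
        + ennreal (32 powr e) * ennreal ((vnorm N (V y))\<^sup>2)"
    using hV unfolding vae_def
  proof eventually_elim
    case (elim y)
    show ?case
    proof (cases "y \<in> ball x0 r")
      case False
      define d where "d = norm (y - x0)"
      have d: "1/32 \<le> d" using False r by (simp add: d_def dist_norm norm_minus_commute)
      have "vnorm N (h y - m) = vnorm N (\<lambda>i. V y i + - m i)"
        using elim W0[OF False] by (intro vnorm_cong) auto
      also have "\<dots> \<le> vnorm N (V y) + vnorm N (\<lambda>i. - m i)" by (rule vnorm_triangle)
      also have "vnorm N (\<lambda>i. - m i) = vnorm N m" by (simp add: vnorm_def L2_set_def)
      finally have "vnorm N (h y - m) \<le> vnorm N (V y) + vnorm N m" .
      then have 1: "vnorm N (h y - m) \<le> vnorm N (V y) + mb" using mb(1) by linarith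
      have "0 \<le> (vnorm N (V y) - 1)\<^sup>2" by simp
      then have "2 * vnorm N (V y) \<le> 1 + (vnorm N (V y))\<^sup>2" by (simp add: power2_diff)
      then have "vnorm N (V y) \<le> 1 + (vnorm N (V y))\<^sup>2" using vnorm_nonneg[of N "V y"] by linarith
      with 1 have "vnorm N (h y - m) \<le> (1 + mb) + (vnorm N (V y))\<^sup>2" by linarith
      then have "vnorm N (h y - m) / d powr e \<le> ((1 + mb) + (vnorm N (V y))\<^sup>2) / d powr e"
        by (rule divide_right_mono) simp
      also have "\<dots> = (1 + mb) * (1 / d powr e) + (1 / d powr e) * (vnorm N (V y))\<^sup>2"
        by (simp add: add_divide_distrib)
      also have "1 / d powr e \<le> 32 powr e"
      proof -
        have "1 / d powr e = (1 / d) powr e" using d by (simp add: powr_divide)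
        also have "\<dots> \<le> 32 powr e" using d e by (intro powr_mono2) (auto simp: field_simps)
        finally show ?thesis .
      qed
      then have "(1 + mb) * (1 / d powr e) + (1 / d powr e) * (vnorm N (V y))\<^sup>2
          \<le> (1 + mb) * (1 / d powr e) + 32 powr e * (vnorm N (V y))\<^sup>2"
        by (intro add_left_mono mult_right_mono) auto
      finally have "ennreal (vnorm N (h y - m) / d powr e)
         \<le> ennreal ((1 + mb) * (1 / d powr e) + 32 powr e * (vnorm N (V y))\<^sup>2)" by (rule ennreal_leI)
      also have "\<dots> = ennreal (1 + mb) * ennreal (1 / d powr e) + ennreal (32 powr e) * ennreal ((vnorm N (V y))\<^sup>2)"
        using mb by (simp add: ennreal_mult[symmetric] ennreal_plus[symmetric] del: ennreal_plus)
      finally show ?thesis using False d by (simp add: d_def)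
    qed simp
  qed
  have "(\<integral>\<^sup>+y\<in>- ball x0 r. ennreal (vnorm N (h y - m) / norm (y - x0) powr e) \<partial>lebesgue)
     \<le> (\<integral>\<^sup>+y. ennreal (1 + mb) * (ennreal (1 / norm (y - x0) powr e) * indicator {y. 1/32 \<le> norm (y - x0)} y)
        + ennreal (32 powr e) * ennreal ((vnorm N (V y))\<^sup>2) \<partial>lborel)"
    unfolding nn_integral_completion by (rule nn_integral_mono_AE[OF ae])
  also have "\<dots> = ennreal (1 + mb) * (\<integral>\<^sup>+y. ennreal (1 / norm (y - x0) powr e) * indicator {y. 1/32 \<le> norm (y - x0)} y \<partial>lborel)
      + ennreal (32 powr e) * mass N V"
  proof -
    have S: "{y. 1/32 \<le> norm (y - x0)} \<in> sets borel"
      by (intro borel_closed closed_Collect_le continuous_intros)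
    have m1: "(\<lambda>y. ennreal (1 / norm (y - x0) powr e) * indicator {y. 1/32 \<le> norm (y - x0)} y) \<in> borel_measurable lborel"
      using S by (intro borel_measurable_times_ennreal borel_measurable_indicator) auto
    have m2: "(\<lambda>y. ennreal ((vnorm N (V y))\<^sup>2)) \<in> borel_measurable lborel" using measurable_vnorm[OF V] by simp
    show ?thesis unfolding mass_def
      by (subst nn_integral_add) (use m1 m2 in \<open>simp_all only: nn_integral_cmult borel_measurable_times_ennreal borel_measurable_const\<close>)
  qed
  also have "\<dots> \<le> ennreal (1 + mb) * ennreal T + ennreal (32 powr e) * ennreal (c\<^sup>2)"
    using nn_integral_kernel_far[OF s(1), of "1/32" x0]
    by (intro add_mono mult_left_mono mV) (auto simp: e_def n_def T_def)
  also have "\<dots> = ennreal ((1 + mb) * T + 32 powr e * c\<^sup>2)"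
    using mb T by (simp add: ennreal_mult[symmetric] ennreal_plus[symmetric] del: ennreal_plus)
  finally have I: "(\<integral>\<^sup>+y\<in>- ball x0 r. ennreal (vnorm N (h y - m) / norm (y - x0) powr e) \<partial>lebesgue)
     \<le> ennreal ((1 + mb) * T + 32 powr e * c\<^sup>2)" .
  have "Tail N s (\<lambda>x. h x - m) x0 r \<le> 1 * ennreal ((1 + mb) * T + 32 powr e * c\<^sup>2)"
    unfolding Tail_def
  proof (rule mult_mono)
    have "r powr (2 * s) \<le> 1 powr (2 * s)" using r s by (intro powr_mono2) auto
    then show "ennreal (r powr (2 * s)) \<le> 1" by simp
  qed (use I in \<open>auto simp: e_def n_def\<close>)
  then have tail: "Tail N s (\<lambda>x. h x - m) x0 r \<le> ennreal ((1 + mb) * T + 32 powr e * c\<^sup>2)" by simp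
  have "Ws2_norm N s A h + Tail N s (\<lambda>x. h x - m) x0 r
     \<le> ennreal (sqrt a) + ennreal (sqrt b) + ennreal ((1 + mb) * T + 32 powr e * c\<^sup>2)"
    unfolding Ws2_norm_def by (intro add_mono L2 gag tail)
  also have "\<dots> = ennreal (sqrt a + sqrt b + ((1 + mb) * T + 32 powr e * c\<^sup>2))"
    using ab mb T by (simp add: ennreal_plus[symmetric] del: ennreal_plus)
  finally show ?thesis
    by (simp add: solution_const_def a_def b_def mb_def T_def e_def n_def \<omega>_def m_def)
qed

lemma hoelder_test_function:
  fixes \<Phi> :: "real ^ 'n \<Rightarrow> nat \<Rightarrow> real"
  assumes b: "\<exists>M. \<forall>x. vnorm N (\<Phi> x) \<le> M"
    and h: "\<And>x y. vnorm N (\<Phi> x - \<Phi> y) \<le> H * norm (x - y) powr t"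
  shows "hoelder_seminorm N t UNIV \<Phi> \<le> ennreal H" "\<Phi> \<in> C0t N t"
proof -
  show 1: "hoelder_seminorm N t UNIV \<Phi> \<le> ennreal H"
    unfolding hoelder_seminorm_def
  proof (rule SUP_least, clarify)
    fix x y :: "real ^ 'n" assume "x \<noteq> y"
    then have "0 < norm (x - y) powr t" by simp
    then have "vnorm N (\<Phi> x - \<Phi> y) / norm (x - y) powr t \<le> H"
      using h[of x y] by (simp add: pos_divide_le_eq)
    then show "ennreal (vnorm N (\<Phi> x - \<Phi> y) / norm (x - y) powr t) \<le> ennreal H" by (rule ennreal_leI)
  qed
  then show "\<Phi> \<in> C0t N t" using b by (auto simp: C0t_def intro: le_less_trans)
qed

theorem lemma6p3:
  fixes s :: real
  assumes "CARD('n::finite) \<ge> 2" and "0 < s" and "s < 1"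
  shows "\<exists>c' :: real. \<forall>N :: nat. \<forall>\<Lambda> :: real. 1 \<le> N \<longrightarrow> 1 \<le> \<Lambda> \<longrightarrow>
    (\<exists>c :: real \<Rightarrow> real. \<forall>\<delta>\<^sub>0 :: real. 0 < \<delta>\<^sub>0 \<longrightarrow> s + \<delta>\<^sub>0 < 1 \<longrightarrow>
      (\<exists>t p :: real. s < t \<and> t < 1 \<and> 2 < p \<and>
        (\<forall>c\<^sub>0 d :: real. 0 < c\<^sub>0 \<longrightarrow> 0 < d \<longrightarrow>
          (\<exists>c\<^sub>h :: real. 1 \<le> c\<^sub>h \<and>
            (\<forall>(a\<^sub>0 :: nat \<Rightarrow> nat \<Rightarrow> real) (x\<^sub>0 :: real ^ 'n) (r :: real) (R :: real) B B'
                (v :: real ^ 'n \<Rightarrow> nat \<Rightarrow> real) (g :: real ^ 'n \<Rightarrow> nat \<Rightarrow> real)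
                (h :: real ^ 'n \<Rightarrow> nat \<Rightarrow> real) (\<epsilon> :: real).
              (\<forall>\<xi>. (vnorm N \<xi>)\<^sup>2 / \<Lambda> \<le> vinner N (mat_app N a\<^sub>0 \<xi>) \<xi>) \<longrightarrow>
              mat_norm N a\<^sub>0 \<le> \<Lambda> \<longrightarrow>
              1/32 < r \<longrightarrow> r < 1 \<longrightarrow> 1/32 < R \<longrightarrow> R < 1 \<longrightarrow>
              B = ball x\<^sub>0 r \<longrightarrow> B' = ball x\<^sub>0 R \<longrightarrow> closure B \<subseteq> B' \<longrightarrow>
              d = setdist B (frontier B') \<longrightarrow>
              v \<in> Ws2 N s UNIV \<longrightarrow> g \<in> Linf N \<longrightarrow>
              Ws2_norm N s UNIV v + Ws2_norm N (s + \<delta>\<^sub>0) UNIV v + Tail N s v x\<^sub>0 R + Linf_norm N g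
                \<le> ennreal c\<^sub>0 \<longrightarrow>
              0 < \<epsilon> \<longrightarrow> \<epsilon> < 1 \<longrightarrow>
              (\<forall>\<phi> \<in> C0t N t. (\<forall>x. x \<notin> B \<longrightarrow> (\<forall>i<N. \<phi> x i = 0)) \<longrightarrow>
                ennreal \<bar>nonlocal_form N s a\<^sub>0 v \<phi> - (LINT x:B|lebesgue. vinner N (g x) (\<phi> x))\<bar>
                  \<le> ennreal ((\<epsilon> / c\<^sub>h) powr (2 * p / (p - 2))) * hoelder_seminorm N t UNIV \<phi>) \<longrightarrow>
              dirichlet_solution N s a\<^sub>0 g v B B' h \<longrightarrow>
              Ws2_norm N s B' h + Tail N s (\<lambda>x. h x - average B h) x\<^sub>0 r \<le> ennreal (c c\<^sub>0) \<and>
              gagliardo_seminorm N s B' (h - v) < ennreal \<epsilon> \<and>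
              L2_norm N B (h - v) \<le> ennreal (c' / sqrt d * \<epsilon>))))))"
proof -
  note s = assms(2,3)
  define P where "P = poincare_const TYPE(real ^ 'n) s"
  have P: "0 < P" unfolding P_def by (rule poincare_const_pos)
  define \<omega> where "\<omega> = unit_ball_vol (real CARD('n))"
  have \<omega>: "0 \<le> \<omega>" by (simp add: \<omega>_def)
  define k where "k = Suc CARD('n)"
  from near_solution_estimate[where 'n='n] show ?thesis
  proof (elim exE conjE, goal_cases)
    case (1 L)
    note L = 1(1) and near = 1(2)[rule_format]
    show ?case
    \<comment> \<open>The Poincare constant depends on dimension and order only, so
      \<open>c'\<close> can be fixed before \<open>N\<close> and \<open>\<Lambda>\<close>.\<close>
    proof (intro exI[of _ "sqrt P"] allI impI, goal_cases)
      case (1 N \<Lambda>)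
      note \<Lambda> = 1(2)
      define M where "M c = energy_const TYPE(real ^ 'n) s \<Lambda> c" for c
      have M: "0 \<le> M c" for c using \<Lambda> P \<omega> by (simp add: M_def energy_const_def P_def \<omega>_def)
      show ?case
      \<comment> \<open>The energy bound uses neither the extra differentiability nor the gap, so
        this constant can be given as a function of \<open>c0\<close> at this early place.\<close>
      proof (intro exI[of _ "\<lambda>c. solution_const TYPE(real ^ 'n) s N c (P * M c) (M c)"] allI impI, goal_cases)
        case (1 \<delta>)
        note \<delta> = 1
        define m where "m = min s \<delta> / 2"
        have m: "0 < m" using s \<delta> by (simp add: m_def)
        define q where "q = 2 * real k / m + 2"
        have q: "2 < q" using m by (simp add: q_def k_def)
        \<comment> \<open>The test functions are Hoelder of every order up to 1, so any exponent
          between \<open>s\<close> and 1 will do.\<close>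
        define t where "t = (1 + s) / 2"
        \<comment> \<open>The map taking \<open>p\<close> to \<open>2 * p / (p - 2)\<close> is its
          own inverse on the numbers above 2, so the required exponent \<open>q\<close> determines
          \<open>p\<close>.\<close>
        define p where "p = 2 * q / (q - 2)"
        have t: "s < t" "t < 1" "0 \<le> t" "t \<le> 1" using s by (auto simp: t_def)
        have p: "2 < p" "2 * p / (p - 2) = q"
          using q by (auto simp: p_def field_simps)
        show ?case
        proof (rule exI[of _ t], rule exI[of _ p], intro conjI allI impI t(1,2) p(1), unfold p(2), goal_cases)
          case (1 c0 d)
          note c0 = 1(1) and d = 1(2)
          define C where "C = real N * (L * (\<omega> + P * M c0))"
          have C: "0 \<le> C" using L \<omega> P M by (simp add: C_def)
          define K where "K = defect_const TYPE(real ^ 'n) s \<Lambda> c0 L"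
          have K: "0 \<le> K"
            using \<omega> L \<Lambda> M[of c0] far_const_nonneg[OF s(1), where 'a="real ^ 'n"]
            by (simp add: K_def defect_const_def Let_def flip: M_def \<omega>_def)
          obtain ch where ch: "1 \<le> ch" and scale: "\<And>\<epsilon>. 0 < \<epsilon> \<Longrightarrow> \<epsilon> < 1 \<Longrightarrow> \<exists>\<rho>. 0 < \<rho> \<and> \<rho> \<le> 1/32
             \<and> 0 \<le> \<Lambda> * ((\<epsilon> / ch) powr q * (C / \<rho> ^ k) + K * \<rho> powr m)
             \<and> \<Lambda> * ((\<epsilon> / ch) powr q * (C / \<rho> ^ k) + K * \<rho> powr m) < \<epsilon>\<^sup>2"
            using choice_of_scale[OF \<Lambda> C K m, of k] unfolding q_def by blast
          show ?case
          proof (rule exI[of _ ch], rule conjI[OF ch], intro allI impI, goal_cases)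
            case (1 a x0 r R B B' v g h \<epsilon>)
            note ell = 1(1) and a = 1(2) and r = 1(3,4) and R = 1(5,6) and BB = 1(7,8)
              and clB = 1(9) and d_eq = 1(10) and v = 1(11) and g = 1(12) and bnd = 1(13)
              and \<epsilon> = 1(14,15) and nearv = 1(16) and dir = 1(17)
            have r0: "0 < r" "0 < R" using r R by auto
            have rR: "r < R" and dle: "d \<le> R - r"
              using ball_gap[OF r0 clB[unfolded BB]] d_eq BB by auto
            obtain V W G where V: "vborel N V" and W: "vborel N W" and G: "vborel N G"
              and vV: "vae N v V" and wW: "vae N (h - v) W" and gG: "vae N g G"
              and hV: "vae N h (\<lambda>x i. V x i + W x i)"
              and W0: "\<And>x i. x \<notin> ball x0 r \<Longrightarrow> i < N \<Longrightarrow> W x i = 0"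
              and Gc: "AE x in lborel. vnorm N (G x) \<le> c0"
              and eV: "energy N s UNIV V \<le> ennreal (c0\<^sup>2)" and eV': "energy N (s + \<delta>) UNIV V \<le> ennreal (c0\<^sup>2)"
              and mV: "mass N V \<le> ennreal (c0\<^sup>2)" and fin: "energy N s UNIV W < \<infinity>"
              and id: "(\<integral>z. bil N s a V W z \<partial>lborel) + (\<integral>z. bil N s a W W z \<partial>lborel) = (\<integral>x. vinner N (G x) (W x) \<partial>lborel)"
              by (rule borel_reduction[OF s(1) a r0(1) rR less_imp_le[OF c0] v g bnd dir[unfolded BB]]) blast
            have c0': "0 \<le> c0" using c0 by simp
            note ee = energy_estimate[OF V W G ell[rule_format] \<Lambda> a fin s(1) r W0 Gc c0' eV id, folded M_def P_def]
            have mW: "mass N W \<le> ennreal (P * M c0)"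
              using order_trans[OF ee(2) mult_left_mono[OF ee(1)]] P M[of c0] by (simp add: ennreal_mult)
            have PM: "0 \<le> P * M c0" using P M by simp
            have bound: "Ws2_norm N s B' h + Tail N s (\<lambda>x. h x - average B h) x0 r
                \<le> ennreal (solution_const TYPE(real ^ 'n) s N c0 (P * M c0) (M c0))"
              unfolding BB by (rule solution_bounds[OF V W hV s r c0' W0 eV mV ee(1) M mW PM])
            obtain \<rho> where \<rho>: "0 < \<rho>" "\<rho> \<le> 1/32"
              and small: "0 \<le> \<Lambda> * ((\<epsilon> / ch) powr q * (C / \<rho> ^ k) + K * \<rho> powr m)"
                "\<Lambda> * ((\<epsilon> / ch) powr q * (C / \<rho> ^ k) + K * \<rho> powr m) < \<epsilon>\<^sup>2"
              using scale[OF \<epsilon>] by blast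
            define y where "y = \<Lambda> * ((\<epsilon> / ch) powr q * (C / \<rho> ^ k) + K * \<rho> powr m)"
            have EW: "energy N s UNIV W \<le> ennreal y"
            proof -
              have "energy N s UNIV W \<le> ennreal (\<Lambda> * ((\<epsilon> / ch) powr q * (real N * (L * (unit_ball_vol (real CARD('n))
                    + poincare_const TYPE(real ^ 'n) s * energy_const TYPE(real ^ 'n) s \<Lambda> c0) / \<rho> ^ Suc CARD('n)))
                  + defect_const TYPE(real ^ 'n) s \<Lambda> c0 L * \<rho> powr (min s \<delta> / 2)))"
              \<comment> \<open>It remains to translate the hypothesis on \<open>v\<close> into the
                one on \<open>V\<close>, with \<open>\<kappa> = (\<epsilon> / ch) powr q\<close>;
                Borel test functions are their own representatives.\<close>
              proof (rule near[OF V W G ell[rule_format] \<Lambda> a fin s(1) less_imp_le[OF s(2)] \<delta>(1) t(3,4) r W0 Gc c0' eV eV' id \<rho>])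
                fix \<Phi> :: "real ^ 'n \<Rightarrow> nat \<Rightarrow> real" and H
                assume \<Phi>: "vborel N \<Phi>" "\<And>x i. x \<notin> ball x0 r \<Longrightarrow> i < N \<Longrightarrow> \<Phi> x i = 0"
                  "\<exists>M. \<forall>x. vnorm N (\<Phi> x) \<le> M" "0 \<le> H"
                  "\<And>x y. vnorm N (\<Phi> x - \<Phi> y) \<le> H * norm (x - y) powr t"
                note ht = hoelder_test_function[OF \<Phi>(3) \<Phi>(5)]
                have \<Phi>\<Phi>: "vae N \<Phi> \<Phi>" by (simp add: vae_def)
                have "ennreal \<bar>nonlocal_form N s a v \<Phi> - (LINT x:B|lebesgue. vinner N (g x) (\<Phi> x))\<bar>
                    \<le> ennreal ((\<epsilon> / ch) powr q) * hoelder_seminorm N t UNIV \<Phi>"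
                  using nearv ht(2) \<Phi>(2) BB by blast
                also have "\<dots> \<le> ennreal ((\<epsilon> / ch) powr q) * ennreal H"
                  by (intro mult_left_mono ht(1)) simp
                also have "\<dots> = ennreal ((\<epsilon> / ch) powr q * H)" using \<Phi>(4) by (simp add: ennreal_mult)
                finally have "\<bar>nonlocal_form N s a v \<Phi> - (LINT x:B|lebesgue. vinner N (g x) (\<Phi> x))\<bar> \<le> (\<epsilon> / ch) powr q * H"
                  using \<Phi>(4) by (subst (asm) ennreal_le_iff) auto
                moreover have "(LINT x:B|lebesgue. vinner N (g x) (\<Phi> x)) = (\<integral>x. vinner N (G x) (\<Phi> x) \<partial>lborel)"
                  unfolding BB by (rule source_vae[OF gG \<Phi>\<Phi> G \<Phi>(1) \<Phi>(2)])
                ultimately show "\<bar>(\<integral>z. bil N s a V \<Phi> z \<partial>lborel) - (\<integral>x. vinner N (G x) (\<Phi> x) \<partial>lborel)\<bar> \<le> (\<epsilon> / ch) powr q * H"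
                  using nonlocal_form_vae[OF vV \<Phi>\<Phi> V \<Phi>(1), of s a] by simp
              qed
              then show ?thesis by (simp add: y_def C_def K_def m_def k_def M_def P_def \<omega>_def)
            qed
            have y: "0 \<le> y" "y < \<epsilon>\<^sup>2" using small by (auto simp: y_def)
            have EB: "energy N s B' W \<le> ennreal y"
              by (rule order_trans[OF _ EW]) (auto simp: energy_def indicator_def intro!: nn_integral_mono)
            have gag: "gagliardo_seminorm N s B' (h - v) < ennreal \<epsilon>"
              unfolding gagliardo_vae[OF wW] using EB y \<epsilon>(1) by (rule ennreal_sqrt_less)
            have mB: "(\<integral>\<^sup>+x\<in>B. ennreal ((vnorm N (W x))\<^sup>2) \<partial>lborel) \<le> ennreal ((sqrt P / sqrt d * \<epsilon>)\<^sup>2)"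
            proof -
              have R2: "R \<le> 2" using R by simp
              obtain l where l: "mass N W = ennreal l" "0 \<le> l"
                using mW by (cases "mass N W") (auto simp: top_unique)
              \<comment> \<open>Here the Poincare inequality is used on the larger ball itself,
                where the energy is already below \<open>\<epsilon>\<^sup>2\<close>; dividing by the
                gap and taking the root gives \<open>1 / sqrt d\<close>.\<close>
              have "ennreal (R - r) * mass N W \<le> ennreal P * energy N s (ball x0 R) W"
                unfolding P_def by (rule vector_poincare[OF W s(1) r(1) rR R2 W0])
              also have "\<dots> \<le> ennreal P * ennreal y" using EB BB by (intro mult_left_mono) auto
              finally have "ennreal ((R - r) * l) \<le> ennreal (P * y)"
                using l rR P y by (simp add: ennreal_mult)
              then have "(R - r) * l \<le> P * y" using P y by (subst (asm) ennreal_le_iff) auto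
              moreover have "d * l \<le> (R - r) * l" using dle l by (intro mult_right_mono) auto
              moreover have "P * y \<le> P * \<epsilon>\<^sup>2" using P y by (intro mult_left_mono) auto
              ultimately have "d * l \<le> P * \<epsilon>\<^sup>2" by linarith
              then have "l \<le> P * \<epsilon>\<^sup>2 / d" using d by (simp add: pos_le_divide_eq mult.commute)
              also have "\<dots> = (sqrt P / sqrt d * \<epsilon>)\<^sup>2" using P d by (simp add: power_mult_distrib power_divide)
              finally have "mass N W \<le> ennreal ((sqrt P / sqrt d * \<epsilon>)\<^sup>2)" unfolding l(1) by (rule ennreal_leI)
              moreover have "(\<integral>\<^sup>+x\<in>B. ennreal ((vnorm N (W x))\<^sup>2) \<partial>lborel) \<le> mass N W"
                unfolding mass_def by (intro nn_integral_mono) (auto simp: indicator_def)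
              ultimately show ?thesis by (rule order_trans[rotated])
            qed
            have "L2_norm N B (h - v) \<le> ennreal (sqrt P / sqrt d * \<epsilon>)"
              unfolding L2_norm_vae[OF wW] using P d \<epsilon> by (intro ennreal_sqrt_le mB) auto
            with bound gag show ?case by blast
          qed
        qed
      qed
    qed
  qed
qed

end
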